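(* Let $\Lambda_1$ and $\Lambda_2$ be two hypergraphs and suppose that $\mathcal O(\Lambda_1,\Lambda_2)\neq0$. Then $\mathcal O(\Lambda_1,\Lambda_2)$ admits a non-zero $*$-representation as bounded operators on a Hilbert space. In particular, it admits a faithful bi-invariant tracial state.
   Context: Algebras are over $\mathbb C$; $\otimes$ between $*$-algebras is algebraic. A hypergraph $\Lambda=(V,E)$ consists of a finite set $V$ of vertices and a finite non-empty family $E$ of hyperedges, each identified with a subset of $V$ (repeated hyperedges allowed); all hypergraphs are assumed full (every vertex lies in some hyperedge). Its incidence matrix $A_\Lambda$ is the $V\times E$ matrix with entry $1$ at $(v,e)$ if $v\in e$ and $0$ otherwise. A magic unitary over a unital $*$-algebra is a matrix $(p_{i,j})$ with $p_{i,j}=p_{i,j}^*=p_{i,j}^2$, all rows and columns summing to $1$, $p_{i,j}p_{i,j'}=0$ for $j\ne j'$, $p_{i,j}p_{i',j}=0$ for $i\ne i'$. For $\Lambda_i=(V_i,E_i)$, $\mathcal O(\Lambda_1,\Lambda_2)$ (the quantum isomorphism space, i.e. the game $*$-algebra of the hypergraph isomorphism game) is the universal unital $*$-algebra generated by the entries of magic unitaries $P_V=(p_{v_1,v_2})_{v_1\in V_1,v_2\in V_2}$ and $P_E=(p_{e_1,e_2})_{e_1\in E_1,e_2\in E_2}$ with $A_{\Lambda_1}P_E=P_VA_{\Lambda_2}$. $\mathcal O(\Lambda):=\mathcal O(\Lambda,\Lambda)$ is a Hopf $*$-algebra with generating magic unitaries $(u_{v,w})_{v,w\in V}$, $(u_{e,f})_{e,f\in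 E}$ and $\Delta(u_{ij})=\sum_ku_{ik}\otimes u_{kj}$, $\varepsilon(u_{ij})=\delta_{ij}$, $S(u_{ij})=u_{ji}$ (within each block). Write $u$ for the generators of $\mathcal O(\Lambda_1)$ and $u'$ for those of $\mathcal O(\Lambda_2)$. The left coaction $\delta:\mathcal O(\Lambda_1,\Lambda_2)\to\mathcal O(\Lambda_1)\otimes\mathcal O(\Lambda_1,\Lambda_2)$ and right coaction $\gamma:\mathcal O(\Lambda_1,\Lambda_2)\to\mathcal O(\Lambda_1,\Lambda_2)\otimes\mathcal O(\Lambda_2)$ are the unital $*$-homomorphisms with $\delta(p_{ij})=\sum_ku_{ik}\otimes p_{kj}$ and $\gamma(p_{ij})=\sum_kp_{ik}\otimes u'_{kj}$ (on both vertex and edge generators). A state on a unital $*$-algebra $\mathcal Z$ is a linear $\tau:\mathcal Z\to\mathbb C$ with $\tau(z^*z)\ge0$ and $\tau(1)=1$; it is tracial if $\tau(zz')=\tau(z'z)$; faithful if $\tau(z^*z)=0\Rightarrow z=0$; bi-invariant (for $\mathcal Z=\mathcal O(\Lambda_1,\Lambda_2)$) if $(\mathrm{id}\otimes\tau)\delta(z)=\tau(z)1$ and $(\tau\otimes\mathrm{id})\gamma(z)=\tau(z)1$ for all $z$. *)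

theory Defs
  imports Complex_Main "HOL-Library.Poly_Mapping" "HOL-Library.Nonpos_Ints" "HOL-Algebra.QuotRing" "HOL-Algebra.Module"
begin

section \<open>Unital *-algebras over the complex numbers\<close>

text \<open>
  Vector spaces and algebras follow the conventions of HOL-Algebra: they are records with an
  explicit carrier, extending \<^typ>\<open>('a, 'b) module\<close>.
\<close>

definition complex_field :: "complex ring" where
  "complex_field = \<lparr>carrier = UNIV, mult = (*), one = 1, zero = 0, add = (+)\<rparr>"

record 'a star_algebra = "(complex, 'a) module" +
  star :: "'a \<Rightarrow> 'a"

definition unital_star_hom ::
  "('a, 'm) star_algebra_scheme \<Rightarrow> ('b, 'n) star_algebra_scheme \<Rightarrow> ('a \<Rightarrow> 'b) \<Rightarrow> bool" where
  "unital_star_hom A B h \<longleftrightarrow>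
     h \<in> ring_hom A B \<and>
     (\<forall>c. \<forall>x\<in>carrier A. h (c \<odot>\<^bsub>A\<^esub> x) = c \<odot>\<^bsub>B\<^esub> h x) \<and>
     (\<forall>x\<in>carrier A. h (star A x) = star B (h x))"

text \<open>
  The *-algebra \<open>\<complex>[M]\<close> of a monoid \<open>M\<close> with an anti-multiplicative involution \<open>\<iota>\<close>: finitely
  supported functions on \<open>M\<close> with the convolution product and \<open>(\<Sum>x. c\<^sub>x x)\<^sup>* = \<Sum>x. cnj c\<^sub>x \<iota> x\<close>.
\<close>

definition monoid_algebra ::
  "('x, 'm) monoid_scheme \<Rightarrow> ('x \<Rightarrow> 'x) \<Rightarrow> ('x \<Rightarrow>\<^sub>0 complex) star_algebra" where
  "monoid_algebra M \<iota> =
     \<lparr>carrier = {f. Poly_Mapping.keys f \<subseteq> carrier M},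
      mult = (\<lambda>f g. \<Sum>x\<in>Poly_Mapping.keys f. \<Sum>y\<in>Poly_Mapping.keys g.
                Poly_Mapping.single (x \<otimes>\<^bsub>M\<^esub> y)
                  (Poly_Mapping.lookup f x * Poly_Mapping.lookup g y)),
      one = Poly_Mapping.single \<one>\<^bsub>M\<^esub> 1,
      zero = 0,
      add = (+),
      smult = (\<lambda>c. Poly_Mapping.map ((*) c)),
      star = (\<lambda>f. \<Sum>x\<in>Poly_Mapping.keys f.
                Poly_Mapping.single (\<iota> x) (cnj (Poly_Mapping.lookup f x)))\<rparr>"

text \<open>
  The quotient of \<open>A\<close> by the two-sided *-ideal generated by \<open>S\<close>. Its elements are cosets; scalar
  multiplication and involution are computed on representatives, as in \<^const>\<open>rcoset_mult\<close>.
\<close>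

definition star_ideal :: "('a, 'm) star_algebra_scheme \<Rightarrow> 'a set \<Rightarrow> 'a set" where
  "star_ideal A S = Idl\<^bsub>A\<^esub> (S \<union> star A ` S)"

definition star_quotient ::
  "('a, 'm) star_algebra_scheme \<Rightarrow> 'a set \<Rightarrow> 'a set star_algebra" where
  "star_quotient A S =
     (let I = star_ideal A S; Q = A Quot I in
      \<lparr>carrier = carrier Q, mult = mult Q, one = one Q, zero = zero Q, add = add Q,
       smult = (\<lambda>c X. \<Union>x\<in>X. I +>\<^bsub>A\<^esub> (c \<odot>\<^bsub>A\<^esub> x)),
       star = (\<lambda>X. \<Union>x\<in>X. I +>\<^bsub>A\<^esub> star A x)\<rparr>)"

text \<open>
  The free unital *-algebra on the set \<open>G\<close>: the monoid algebra of the words in the letters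
  \<open>(g, False)\<close>, standing for \<open>g\<close>, and \<open>(g, True)\<close>, standing for \<open>g\<^sup>*\<close>.
\<close>

definition free_star_algebra :: "'g set \<Rightarrow> (('g \<times> bool) list \<Rightarrow>\<^sub>0 complex) star_algebra" where
  "free_star_algebra G =
     monoid_algebra \<lparr>carrier = lists (G \<times> UNIV), mult = (@), one = []\<rparr>
       (\<lambda>w. rev (map (\<lambda>(g, s). (g, \<not> s)) w))"

definition free_gen :: "'g \<Rightarrow> ('g \<times> bool) list \<Rightarrow>\<^sub>0 complex" where
  "free_gen g = Poly_Mapping.single [(g, False)] 1"


section \<open>Algebraic tensor products\<close>

text \<open>
  \<open>A \<otimes> B\<close> is the quotient of the free vector space on \<open>A \<times> B\<close>, multiplied componentwise, by the
  bilinearity relations. The linear span of these relations is already a two-sided *-ideal, so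
  passing to the generated *-ideal adds nothing.
\<close>

definition pre_tensor_algebra ::
  "('a, 'm) star_algebra_scheme \<Rightarrow> ('b, 'n) star_algebra_scheme
     \<Rightarrow> ('a \<times> 'b \<Rightarrow>\<^sub>0 complex) star_algebra" where
  "pre_tensor_algebra A B = monoid_algebra (A \<times>\<times> B) (map_prod (star A) (star B))"

definition bilinear_relations ::
  "('a, 'm) star_algebra_scheme \<Rightarrow> ('b, 'n) star_algebra_scheme \<Rightarrow> ('a \<times> 'b \<Rightarrow>\<^sub>0 complex) set"
  where
  "bilinear_relations A B =
     (let e = (\<lambda>a b. Poly_Mapping.single (a, b) (1::complex)) in
      {e (a \<oplus>\<^bsub>A\<^esub> a') b - e a b - e a' b | a a' b.
         a \<in> carrier A \<and> a' \<in> carrier A \<and> b \<in> carrier B} \<union>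
      {e a (b \<oplus>\<^bsub>B\<^esub> b') - e a b - e a b' | a b b'.
         a \<in> carrier A \<and> b \<in> carrier B \<and> b' \<in> carrier B} \<union>
      {e (c \<odot>\<^bsub>A\<^esub> a) b - Poly_Mapping.single (a, b) c | c a b.
         a \<in> carrier A \<and> b \<in> carrier B} \<union>
      {e a (c \<odot>\<^bsub>B\<^esub> b) - Poly_Mapping.single (a, b) c | c a b.
         a \<in> carrier A \<and> b \<in> carrier B})"

definition tensor_algebra ::
  "('a, 'm) star_algebra_scheme \<Rightarrow> ('b, 'n) star_algebra_scheme
     \<Rightarrow> ('a \<times> 'b \<Rightarrow>\<^sub>0 complex) set star_algebra" where
  "tensor_algebra A B = star_quotient (pre_tensor_algebra A B) (bilinear_relations A B)"

definition tensor_elem ::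
  "('a, 'm) star_algebra_scheme \<Rightarrow> ('b, 'n) star_algebra_scheme \<Rightarrow> 'a \<Rightarrow> 'b
     \<Rightarrow> ('a \<times> 'b \<Rightarrow>\<^sub>0 complex) set" where
  "tensor_elem A B a b =
     star_ideal (pre_tensor_algebra A B) (bilinear_relations A B)
       +>\<^bsub>pre_tensor_algebra A B\<^esub> Poly_Mapping.single (a, b) 1"

text \<open>
  The slice maps \<open>id \<otimes> \<tau> : A \<otimes> B \<rightarrow> A\<close> and \<open>\<tau> \<otimes> id : A \<otimes> B \<rightarrow> B\<close>, evaluated on an arbitrary
  representative \<open>\<Sum> c\<^sub>p (fst p, snd p)\<close> of a tensor; for linear \<open>\<tau>\<close> the result does not depend on
  the representative.
\<close>

definition slice_right ::
  "('a, 'm) star_algebra_scheme \<Rightarrow> ('b \<Rightarrow> complex) \<Rightarrow> ('a \<times> 'b \<Rightarrow>\<^sub>0 complex) set \<Rightarrow> 'a" where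
  "slice_right A \<tau> X =
     the_elem ((\<lambda>f. \<Oplus>\<^bsub>A\<^esub>p\<in>Poly_Mapping.keys f.
                       (Poly_Mapping.lookup f p * \<tau> (snd p)) \<odot>\<^bsub>A\<^esub> fst p) ` X)"

definition slice_left ::
  "('b, 'n) star_algebra_scheme \<Rightarrow> ('a \<Rightarrow> complex) \<Rightarrow> ('a \<times> 'b \<Rightarrow>\<^sub>0 complex) set \<Rightarrow> 'b" where
  "slice_left B \<tau> X =
     the_elem ((\<lambda>f. \<Oplus>\<^bsub>B\<^esub>p\<in>Poly_Mapping.keys f.
                       (Poly_Mapping.lookup f p * \<tau> (fst p)) \<odot>\<^bsub>B\<^esub> snd p) ` X)"


section \<open>States and Hilbert space representations\<close>

definition linear_functional :: "('a, 'm) star_algebra_scheme \<Rightarrow> ('a \<Rightarrow> complex) \<Rightarrow> bool" where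
  "linear_functional A \<tau> \<longleftrightarrow>
     (\<forall>x\<in>carrier A. \<forall>y\<in>carrier A. \<tau> (x \<oplus>\<^bsub>A\<^esub> y) = \<tau> x + \<tau> y) \<and>
     (\<forall>c. \<forall>x\<in>carrier A. \<tau> (c \<odot>\<^bsub>A\<^esub> x) = c * \<tau> x)"

definition state :: "('a, 'm) star_algebra_scheme \<Rightarrow> ('a \<Rightarrow> complex) \<Rightarrow> bool" where
  "state A \<tau> \<longleftrightarrow>
     linear_functional A \<tau> \<and>
     (\<forall>z\<in>carrier A. \<tau> (star A z \<otimes>\<^bsub>A\<^esub> z) \<in> \<real>\<^sub>\<ge>\<^sub>0) \<and> \<tau> \<one>\<^bsub>A\<^esub> = 1"

definition tracial :: "('a, 'm) star_algebra_scheme \<Rightarrow> ('a \<Rightarrow> complex) \<Rightarrow> bool" where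
  "tracial A \<tau> \<longleftrightarrow> (\<forall>z\<in>carrier A. \<forall>z'\<in>carrier A. \<tau> (z \<otimes>\<^bsub>A\<^esub> z') = \<tau> (z' \<otimes>\<^bsub>A\<^esub> z))"

definition faithful :: "('a, 'm) star_algebra_scheme \<Rightarrow> ('a \<Rightarrow> complex) \<Rightarrow> bool" where
  "faithful A \<tau> \<longleftrightarrow> (\<forall>z\<in>carrier A. \<tau> (star A z \<otimes>\<^bsub>A\<^esub> z) = 0 \<longrightarrow> z = \<zero>\<^bsub>A\<^esub>)"

text \<open>As usual in HOL-Algebra, the fields \<open>mult\<close> and \<open>one\<close> of a module record are unused for a
  vector space. Inner products are linear in the second argument. Every separable Hilbert space has an
  isomorphic copy with carrier in the type \<^typ>\<open>nat \<Rightarrow> complex\<close>, and a countably generated *-algebra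
  with a non-zero *-representation has one on a separable Hilbert space.\<close>

record 'h inner_product_space = "(complex, 'h) module" +
  inner_prod :: "'h \<Rightarrow> 'h \<Rightarrow> complex"

definition hnorm :: "('h, 'm) inner_product_space_scheme \<Rightarrow> 'h \<Rightarrow> real" where
  "hnorm H x = sqrt (Re (inner_prod H x x))"

definition hilbert_space :: "('h, 'm) inner_product_space_scheme \<Rightarrow> bool" where
  "hilbert_space H \<longleftrightarrow>
     module complex_field H \<and>
     (\<forall>x\<in>carrier H. \<forall>y\<in>carrier H. \<forall>z\<in>carrier H.
        inner_prod H x (y \<oplus>\<^bsub>H\<^esub> z) = inner_prod H x y + inner_prod H x z) \<and>
     (\<forall>c. \<forall>x\<in>carrier H. \<forall>y\<in>carrier H. inner_prod H x (c \<odot>\<^bsub>H\<^esub> y) = c * inner_prod H x y) \<and>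
     (\<forall>x\<in>carrier H. \<forall>y\<in>carrier H. inner_prod H y x = cnj (inner_prod H x y)) \<and>
     (\<forall>x\<in>carrier H. inner_prod H x x \<in> \<real>\<^sub>\<ge>\<^sub>0 \<and> (inner_prod H x x = 0 \<longrightarrow> x = \<zero>\<^bsub>H\<^esub>)) \<and>
     (\<forall>s :: nat \<Rightarrow> 'h.
        (\<forall>n. s n \<in> carrier H) \<and>
        (\<forall>e>0. \<exists>N. \<forall>m\<ge>N. \<forall>n\<ge>N. hnorm H (s m \<ominus>\<^bsub>H\<^esub> s n) < e) \<longrightarrow>
        (\<exists>l\<in>carrier H. (\<lambda>n. hnorm H (s n \<ominus>\<^bsub>H\<^esub> l)) \<longlonglongrightarrow> 0))"

definition bounded_operator ::
  "('h, 'm) inner_product_space_scheme \<Rightarrow> ('h \<Rightarrow> 'h) \<Rightarrow> bool" where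
  "bounded_operator H T \<longleftrightarrow>
     (\<forall>x\<in>carrier H. T x \<in> carrier H) \<and>
     (\<forall>x\<in>carrier H. \<forall>y\<in>carrier H. T (x \<oplus>\<^bsub>H\<^esub> y) = T x \<oplus>\<^bsub>H\<^esub> T y) \<and>
     (\<forall>c. \<forall>x\<in>carrier H. T (c \<odot>\<^bsub>H\<^esub> x) = c \<odot>\<^bsub>H\<^esub> T x) \<and>
     (\<exists>K. \<forall>x\<in>carrier H. hnorm H (T x) \<le> K * hnorm H x)"

text \<open>
  A *-representation is a unital *-homomorphism into the bounded operators on \<open>H\<close>. The last
  clause says that \<open>\<pi> (z\<^sup>*)\<close> is the adjoint of \<open>\<pi> z\<close>.
\<close>

definition star_representation ::
  "('a, 'm) star_algebra_scheme \<Rightarrow> ('h, 'n) inner_product_space_scheme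
     \<Rightarrow> ('a \<Rightarrow> 'h \<Rightarrow> 'h) \<Rightarrow> bool" where
  "star_representation A H \<pi> \<longleftrightarrow>
     (\<forall>z\<in>carrier A. bounded_operator H (\<pi> z)) \<and>
     (\<forall>x\<in>carrier H.
        \<pi> \<one>\<^bsub>A\<^esub> x = x \<and>
        (\<forall>z\<in>carrier A. \<forall>w\<in>carrier A.
           \<pi> (z \<oplus>\<^bsub>A\<^esub> w) x = \<pi> z x \<oplus>\<^bsub>H\<^esub> \<pi> w x \<and> \<pi> (z \<otimes>\<^bsub>A\<^esub> w) x = \<pi> z (\<pi> w x)) \<and>
        (\<forall>c. \<forall>z\<in>carrier A. \<pi> (c \<odot>\<^bsub>A\<^esub> z) x = c \<odot>\<^bsub>H\<^esub> \<pi> z x)) \<and>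
     (\<forall>z\<in>carrier A. \<forall>x\<in>carrier H. \<forall>y\<in>carrier H.
        inner_prod H (\<pi> (star A z) x) y = inner_prod H x (\<pi> z y))"

definition nonzero_representation ::
  "('a, 'm) star_algebra_scheme \<Rightarrow> ('h, 'n) inner_product_space_scheme
     \<Rightarrow> ('a \<Rightarrow> 'h \<Rightarrow> 'h) \<Rightarrow> bool" where
  "nonzero_representation A H \<pi> \<longleftrightarrow> (\<exists>z\<in>carrier A. \<exists>x\<in>carrier H. \<pi> z x \<noteq> \<zero>\<^bsub>H\<^esub>)"


section \<open>Hypergraphs and the quantum isomorphism space\<close>

text \<open>A hyperedge is a label \<open>e\<close> together with its set of vertices \<open>incid \<Lambda> e\<close>, so that hyperedges
  may be repeated.\<close>

record ('v, 'e) hypergraph =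
  verts :: "'v set"
  edges :: "'e set"
  incid :: "'e \<Rightarrow> 'v set"

definition full_hypergraph :: "('v, 'e) hypergraph \<Rightarrow> bool" where
  "full_hypergraph \<Lambda> \<longleftrightarrow>
     finite (verts \<Lambda>) \<and> finite (edges \<Lambda>) \<and> edges \<Lambda> \<noteq> {} \<and>
     (\<forall>e\<in>edges \<Lambda>. incid \<Lambda> e \<subseteq> verts \<Lambda>) \<and>
     (\<forall>v\<in>verts \<Lambda>. \<exists>e\<in>edges \<Lambda>. v \<in> incid \<Lambda> e)"

definition incidence_matrix :: "('v, 'e) hypergraph \<Rightarrow> 'v \<Rightarrow> 'e \<Rightarrow> complex" where
  "incidence_matrix \<Lambda> v e = (if v \<in> incid \<Lambda> e then 1 else 0)"

text \<open>The relations making \<open>(p i j)\<close>, \<open>i \<in> I\<close>, \<open>j \<in> J\<close>, a magic unitary over \<open>A\<close>, each written as an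
  element of \<open>A\<close> required to vanish.\<close>

definition magic_relations ::
  "('a, 'm) star_algebra_scheme \<Rightarrow> 'i set \<Rightarrow> 'j set \<Rightarrow> ('i \<Rightarrow> 'j \<Rightarrow> 'a) \<Rightarrow> 'a set" where
  "magic_relations A I J p =
     {p i j \<ominus>\<^bsub>A\<^esub> star A (p i j) | i j. i \<in> I \<and> j \<in> J} \<union>
     {p i j \<ominus>\<^bsub>A\<^esub> p i j \<otimes>\<^bsub>A\<^esub> p i j | i j. i \<in> I \<and> j \<in> J} \<union>
     {(\<Oplus>\<^bsub>A\<^esub>j\<in>J. p i j) \<ominus>\<^bsub>A\<^esub> \<one>\<^bsub>A\<^esub> | i. i \<in> I} \<union>
     {(\<Oplus>\<^bsub>A\<^esub>i\<in>I. p i j) \<ominus>\<^bsub>A\<^esub> \<one>\<^bsub>A\<^esub> | j. j \<in> J} \<union>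
     {p i j \<otimes>\<^bsub>A\<^esub> p i j' | i j j'. i \<in> I \<and> j \<in> J \<and> j' \<in> J \<and> j \<noteq> j'} \<union>
     {p i j \<otimes>\<^bsub>A\<^esub> p i' j | i i' j. i \<in> I \<and> i' \<in> I \<and> j \<in> J \<and> i \<noteq> i'}"

text \<open>The entries of \<open>A\<^bsub>\<Lambda>1\<^esub> P\<^sub>E - P\<^sub>V A\<^bsub>\<Lambda>2\<^esub>\<close>.\<close>

definition intertwiner_relations ::
  "('a, 'm) star_algebra_scheme \<Rightarrow> ('v1, 'e1) hypergraph \<Rightarrow> ('v2, 'e2) hypergraph
     \<Rightarrow> ('v1 \<Rightarrow> 'v2 \<Rightarrow> 'a) \<Rightarrow> ('e1 \<Rightarrow> 'e2 \<Rightarrow> 'a) \<Rightarrow> 'a set" where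
  "intertwiner_relations A \<Lambda>1 \<Lambda>2 pV pE =
     {(\<Oplus>\<^bsub>A\<^esub>e1\<in>edges \<Lambda>1. incidence_matrix \<Lambda>1 v1 e1 \<odot>\<^bsub>A\<^esub> pE e1 e2) \<ominus>\<^bsub>A\<^esub>
      (\<Oplus>\<^bsub>A\<^esub>v2\<in>verts \<Lambda>2. incidence_matrix \<Lambda>2 v2 e2 \<odot>\<^bsub>A\<^esub> pV v1 v2) | v1 e2.
        v1 \<in> verts \<Lambda>1 \<and> e2 \<in> edges \<Lambda>2}"

datatype ('v1, 'v2, 'e1, 'e2) qiso_gen = VGen 'v1 'v2 | EGen 'e1 'e2

definition qiso_gens ::
  "('v1, 'e1) hypergraph \<Rightarrow> ('v2, 'e2) hypergraph \<Rightarrow> ('v1, 'v2, 'e1, 'e2) qiso_gen set" where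
  "qiso_gens \<Lambda>1 \<Lambda>2 =
     {VGen v1 v2 | v1 v2. v1 \<in> verts \<Lambda>1 \<and> v2 \<in> verts \<Lambda>2} \<union>
     {EGen e1 e2 | e1 e2. e1 \<in> edges \<Lambda>1 \<and> e2 \<in> edges \<Lambda>2}"

definition qiso_relations ::
  "('v1, 'e1) hypergraph \<Rightarrow> ('v2, 'e2) hypergraph
     \<Rightarrow> ((('v1, 'v2, 'e1, 'e2) qiso_gen \<times> bool) list \<Rightarrow>\<^sub>0 complex) set" where
  "qiso_relations \<Lambda>1 \<Lambda>2 =
     (let F = free_star_algebra (qiso_gens \<Lambda>1 \<Lambda>2);
          pV = (\<lambda>v1 v2. free_gen (VGen v1 v2));
          pE = (\<lambda>e1 e2. free_gen (EGen e1 e2))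
      in magic_relations F (verts \<Lambda>1) (verts \<Lambda>2) pV \<union>
         magic_relations F (edges \<Lambda>1) (edges \<Lambda>2) pE \<union>
         intertwiner_relations F \<Lambda>1 \<Lambda>2 pV pE)"

type_synonym ('v1, 'v2, 'e1, 'e2) qiso_elem =
  "((('v1, 'v2, 'e1, 'e2) qiso_gen \<times> bool) list \<Rightarrow>\<^sub>0 complex) set"

definition qiso_algebra ::
  "('v1, 'e1) hypergraph \<Rightarrow> ('v2, 'e2) hypergraph
     \<Rightarrow> ('v1, 'v2, 'e1, 'e2) qiso_elem star_algebra" (\<open>\<O>\<close>) where
  "\<O> \<Lambda>1 \<Lambda>2 = star_quotient (free_star_algebra (qiso_gens \<Lambda>1 \<Lambda>2)) (qiso_relations \<Lambda>1 \<Lambda>2)"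

definition qiso_class ::
  "('v1, 'e1) hypergraph \<Rightarrow> ('v2, 'e2) hypergraph
     \<Rightarrow> ('v1, 'v2, 'e1, 'e2) qiso_gen \<Rightarrow> ('v1, 'v2, 'e1, 'e2) qiso_elem" where
  "qiso_class \<Lambda>1 \<Lambda>2 g =
     star_ideal (free_star_algebra (qiso_gens \<Lambda>1 \<Lambda>2)) (qiso_relations \<Lambda>1 \<Lambda>2)
       +>\<^bsub>free_star_algebra (qiso_gens \<Lambda>1 \<Lambda>2)\<^esub> free_gen g"

definition genV ::
  "('v1, 'e1) hypergraph \<Rightarrow> ('v2, 'e2) hypergraph \<Rightarrow> 'v1 \<Rightarrow> 'v2
     \<Rightarrow> ('v1, 'v2, 'e1, 'e2) qiso_elem" where
  "genV \<Lambda>1 \<Lambda>2 v1 v2 = qiso_class \<Lambda>1 \<Lambda>2 (VGen v1 v2)"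

definition genE ::
  "('v1, 'e1) hypergraph \<Rightarrow> ('v2, 'e2) hypergraph \<Rightarrow> 'e1 \<Rightarrow> 'e2
     \<Rightarrow> ('v1, 'v2, 'e1, 'e2) qiso_elem" where
  "genE \<Lambda>1 \<Lambda>2 e1 e2 = qiso_class \<Lambda>1 \<Lambda>2 (EGen e1 e2)"


section \<open>Coactions and bi-invariance\<close>

definition left_coaction ::
  "('v1, 'e1) hypergraph \<Rightarrow> ('v2, 'e2) hypergraph
     \<Rightarrow> (('v1, 'v2, 'e1, 'e2) qiso_elem
          \<Rightarrow> (('v1, 'v1, 'e1, 'e1) qiso_elem \<times> ('v1, 'v2, 'e1, 'e2) qiso_elem \<Rightarrow>\<^sub>0 complex) set)
     \<Rightarrow> bool" where
  "left_coaction \<Lambda>1 \<Lambda>2 \<delta> \<longleftrightarrow>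
     (let T = tensor_algebra (\<O> \<Lambda>1 \<Lambda>1) (\<O> \<Lambda>1 \<Lambda>2);
          t = tensor_elem (\<O> \<Lambda>1 \<Lambda>1) (\<O> \<Lambda>1 \<Lambda>2) in
      unital_star_hom (\<O> \<Lambda>1 \<Lambda>2) T \<delta> \<and>
      (\<forall>i\<in>verts \<Lambda>1. \<forall>j\<in>verts \<Lambda>2.
         \<delta> (genV \<Lambda>1 \<Lambda>2 i j) = (\<Oplus>\<^bsub>T\<^esub>k\<in>verts \<Lambda>1. t (genV \<Lambda>1 \<Lambda>1 i k) (genV \<Lambda>1 \<Lambda>2 k j))) \<and>
      (\<forall>i\<in>edges \<Lambda>1. \<forall>j\<in>edges \<Lambda>2.
         \<delta> (genE \<Lambda>1 \<Lambda>2 i j) = (\<Oplus>\<^bsub>T\<^esub>k\<in>edges \<Lambda>1. t (genE \<Lambda>1 \<Lambda>1 i k) (genE \<Lambda>1 \<Lambda>2 k j))))"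

definition right_coaction ::
  "('v1, 'e1) hypergraph \<Rightarrow> ('v2, 'e2) hypergraph
     \<Rightarrow> (('v1, 'v2, 'e1, 'e2) qiso_elem
          \<Rightarrow> (('v1, 'v2, 'e1, 'e2) qiso_elem \<times> ('v2, 'v2, 'e2, 'e2) qiso_elem \<Rightarrow>\<^sub>0 complex) set)
     \<Rightarrow> bool" where
  "right_coaction \<Lambda>1 \<Lambda>2 \<gamma> \<longleftrightarrow>
     (let T = tensor_algebra (\<O> \<Lambda>1 \<Lambda>2) (\<O> \<Lambda>2 \<Lambda>2);
          t = tensor_elem (\<O> \<Lambda>1 \<Lambda>2) (\<O> \<Lambda>2 \<Lambda>2) in
      unital_star_hom (\<O> \<Lambda>1 \<Lambda>2) T \<gamma> \<and>
      (\<forall>i\<in>verts \<Lambda>1. \<forall>j\<in>verts \<Lambda>2.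
         \<gamma> (genV \<Lambda>1 \<Lambda>2 i j) = (\<Oplus>\<^bsub>T\<^esub>k\<in>verts \<Lambda>2. t (genV \<Lambda>1 \<Lambda>2 i k) (genV \<Lambda>2 \<Lambda>2 k j))) \<and>
      (\<forall>i\<in>edges \<Lambda>1. \<forall>j\<in>edges \<Lambda>2.
         \<gamma> (genE \<Lambda>1 \<Lambda>2 i j) = (\<Oplus>\<^bsub>T\<^esub>k\<in>edges \<Lambda>2. t (genE \<Lambda>1 \<Lambda>2 i k) (genE \<Lambda>2 \<Lambda>2 k j))))"

text \<open>
  The generators generate \<open>\<O> \<Lambda>1 \<Lambda>2\<close>, so \<open>\<delta>\<close> and \<open>\<gamma>\<close> are determined on its carrier; the existential
  quantifiers merely name them.
\<close>

definition bi_invariant ::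
  "('v1, 'e1) hypergraph \<Rightarrow> ('v2, 'e2) hypergraph
     \<Rightarrow> (('v1, 'v2, 'e1, 'e2) qiso_elem \<Rightarrow> complex) \<Rightarrow> bool" where
  "bi_invariant \<Lambda>1 \<Lambda>2 \<tau> \<longleftrightarrow>
     (\<exists>\<delta> \<gamma>. left_coaction \<Lambda>1 \<Lambda>2 \<delta> \<and> right_coaction \<Lambda>1 \<Lambda>2 \<gamma> \<and>
        (\<forall>z\<in>carrier (\<O> \<Lambda>1 \<Lambda>2).
           slice_right (\<O> \<Lambda>1 \<Lambda>1) \<tau> (\<delta> z) = \<tau> z \<odot>\<^bsub>\<O> \<Lambda>1 \<Lambda>1\<^esub> \<one>\<^bsub>\<O> \<Lambda>1 \<Lambda>1\<^esub> \<and>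
           slice_left (\<O> \<Lambda>2 \<Lambda>2) \<tau> (\<gamma> z) = \<tau> z \<odot>\<^bsub>\<O> \<Lambda>2 \<Lambda>2\<^esub> \<one>\<^bsub>\<O> \<Lambda>2 \<Lambda>2\<^esub>))"

end

theory Submission
  imports Defs "HOL-Library.Countable_Set"
begin

text \<open>
  Put the vertices and the edges of a hypergraph into one alphabet. The two magic unitaries become a
  single block diagonal magic unitary, and \<open>\<O> \<Lambda>1 \<Lambda>2\<close> is spanned by the products \<open>p(a, b)\<close> of its
  entries along two words \<open>a\<close>, \<open>b\<close> of equal length. A linear functional \<open>f\<close> is determined by its
  coefficients \<open>x a b = f (p(a, b))\<close>, and the functions \<open>x\<close> that arise are those satisfying the
  defining relations at every position inside a word. This explicit set \<open>coefs \<Lambda>1 \<Lambda>2\<close> is a stand-in for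
  the dual space (lemmas \<open>coef_in_coefs\<close> and \<open>in_I_iff\<close>). Dual to the comultiplications, matrix
  multiplication maps \<open>coefs \<Lambda>i \<Lambda>j\<close> and \<open>coefs \<Lambda>j \<Lambda>k\<close> to \<open>coefs \<Lambda>i \<Lambda>k\<close>; the antipode makes the conjugate
  transpose map \<open>coefs \<Lambda>1 \<Lambda>2\<close> to \<open>coefs \<Lambda>2 \<Lambda>1\<close>. So the \<open>coefs \<Lambda>i \<Lambda>j\<close> form a linking *-algebra of block
  matrices, one block for each word length, with the character \<open>\<chi> x = x [] []\<close>.

  The algebra is non-zero exactly when \<open>\<chi>\<close> does not vanish on \<open>coefs \<Lambda>1 \<Lambda>2\<close>. Then, on words of length at
  most \<open>N\<close>, there is \<open>p\<close> with \<open>\<chi> p = 1\<close> that is orthogonal to the kernel of \<open>\<chi>\<close>. As \<open>x\<^sup>*\<close> preserves this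
  kernel, \<open>x p\<close> is again orthogonal to it, whence \<open>x p = \<chi>(x) p\<close> for \<open>x\<close> in \<open>coefs \<Lambda>1 \<Lambda>1\<close>; likewise
  \<open>p x = \<chi>(x) p\<close> for \<open>x\<close> in \<open>coefs \<Lambda>2 \<Lambda>2\<close>. Such a \<open>p\<close> is unique, since \<open>q = q (q\<^sup>* p) = (q q\<^sup>*) p = p\<close>, so
  the \<open>p\<close> for the various \<open>N\<close> fit together to a bi-invariant functional, the Haar functional \<open>haar\<close>.

  Positivity, faithfulness and the trace property all come from one identity, \<open>haar_slide\<close>: it expresses
  the Gram matrix of the Haar functional, applied to any \<open>x\<close>, by a finite matrix \<open>density\<close> built from the
  projection \<open>haar\<^sup>* haar\<close>. This matrix is positive definite, hence invertible, and \<open>\<tau> (z\<^sup>* z)\<close> becomes a sum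
  of values of its quadratic form (\<open>haar_positive\<close>). The same identity shows that the Gram matrix of
  \<open>\<tau> (z\<^sup>* w)\<close> and that of \<open>\<tau> (w z\<^sup>*)\<close> have equal Hilbert-Schmidt norms and that their inner product is the
  square of this norm, so they coincide (\<open>haar_tracial\<close>).

  For the coaction, a word is mapped to an element of the free vector space over pairs. That this descends
  to the quotients (\<open>lin_ext_comult_I\<close>) is the bilinear form of the statement that \<open>coefs\<close> is closed under
  matrix multiplication.

  Finally, the GNS construction for \<open>\<tau>\<close> gives the representation: the generators are projections, so that
  left multiplications are bounded, and Gram-Schmidt over the countable set of words turns
  the completion into square-summable sequences.
\<close>


section \<open>Words\<close>

definition words :: "'a set \<Rightarrow> nat \<Rightarrow> 'a list set" where
  "words A n = {a. set a \<subseteq> A \<and> length a = n}"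

lemma finite_words [simp]: "finite A \<Longrightarrow> finite (words A n)"
  by (simp add: words_def finite_lists_length_eq)

lemma words_0 [simp]: "words A 0 = {[]}"
  by (auto simp: words_def)

lemma sum_words_append:
  "(\<Sum>b\<in>words A (m + n). f b) = (\<Sum>b\<in>words A m. \<Sum>c\<in>words A n. f (b @ c))"
proof -
  have "(\<Sum>b\<in>words A (m + n). f b) = (\<Sum>p\<in>words A m \<times> words A n. f (fst p @ snd p))"
    by (rule sum.reindex_bij_witness[of _ "\<lambda>p. fst p @ snd p" "\<lambda>b. (take m b, drop m b)"])
       (auto simp: words_def dest: in_set_takeD in_set_dropD)
  then show ?thesis by (simp add: sum.cartesian_product case_prod_beta)
qed

lemma sum_words_1 [simp]: "(\<Sum>b\<in>words A (Suc 0). f b) = (\<Sum>j\<in>A. f [j])"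
  by (rule sum.reindex_bij_witness[of _ "\<lambda>j. [j]" hd]) (auto simp: words_def length_Suc_conv)

lemma sum_words_2: "(\<Sum>b\<in>words A 2. f b) = (\<Sum>j\<in>A. \<Sum>k\<in>A. f [j, k])"
  using sum_words_append[of f A "Suc 0" "Suc 0"] by (simp add: numeral_2_eq_2)

lemma sum_words_rev: "(\<Sum>b\<in>words A n. f (rev b)) = (\<Sum>b\<in>words A n. f b)"
  by (rule sum.reindex_bij_witness[of _ rev rev]) (auto simp: words_def)

definition ball :: "'a set \<Rightarrow> nat \<Rightarrow> 'a list set" where
  "ball A n = {a. set a \<subseteq> A \<and> length a \<le> n}"

lemma finite_ball [simp]: "finite A \<Longrightarrow> finite (ball A n)"
  by (simp add: ball_def finite_lists_length_le)

lemma words_subset_ball: "k \<le> n \<Longrightarrow> words A k \<subseteq> ball A n"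
  by (auto simp: words_def ball_def)

lemma sum_ball_words:
  assumes "finite A" "k \<le> n" "\<And>a. a \<in> ball A n \<Longrightarrow> length a \<noteq> k \<Longrightarrow> f a = 0"
  shows "(\<Sum>a\<in>ball A n. f a) = (\<Sum>a\<in>words A k. f a)"
proof (rule sum.mono_neutral_right)
  show "\<forall>a\<in>ball A n - words A k. f a = 0"
    using assms(3) by (auto simp: words_def ball_def)
qed (use assms words_subset_ball[of k n A] in auto)



section \<open>Orthogonal decomposition in finitely many coordinates\<close>

text \<open>
  Vectors are functions on the whole type and only the coordinates in \<open>X\<close> are compared, so that the
  induction can remove one coordinate at a time.
\<close>

lemma orthogonal_decomposition:
  fixes v :: "'x \<Rightarrow> complex"
  assumes "finite X" "S \<noteq> {}"
    and "\<And>f g. f \<in> S \<Longrightarrow> g \<in> S \<Longrightarrow> (\<lambda>x. f x + g x) \<in> S"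
    and "\<And>c f. f \<in> S \<Longrightarrow> (\<lambda>x. c * f x) \<in> S"
  shows "\<exists>s\<in>S. \<forall>f\<in>S. (\<Sum>x\<in>X. cnj (f x) * (v x - s x)) = 0"
  using assms
proof (induction X arbitrary: S v rule: finite_induct)
  case empty
  then show ?case by auto
next
  case (insert x0 X)
  define S0 where "S0 = {f\<in>S. f x0 = 0}"
  have S0: "S0 \<noteq> {}" "\<And>f g. f \<in> S0 \<Longrightarrow> g \<in> S0 \<Longrightarrow> (\<lambda>x. f x + g x) \<in> S0"
    "\<And>c f. f \<in> S0 \<Longrightarrow> (\<lambda>x. c * f x) \<in> S0"
  proof -
    obtain f where "f \<in> S" using insert.prems(1) by auto
    then have "(\<lambda>x. 0 * f x) \<in> S0" using insert.prems(3)[of f 0] by (simp add: S0_def)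
    then show "S0 \<noteq> {}" by blast
  qed (use insert.prems in \<open>auto simp: S0_def\<close>)
  have IH: "\<exists>s\<in>S0. \<forall>f\<in>S0. (\<Sum>x\<in>insert x0 X. cnj (f x) * (w x - s x)) = 0" for w
  proof -
    obtain s where s: "s \<in> S0" "\<forall>f\<in>S0. (\<Sum>x\<in>X. cnj (f x) * (w x - s x)) = 0"
      using insert.IH[OF S0, of w] by blast
    have "\<forall>f\<in>S0. (\<Sum>x\<in>insert x0 X. cnj (f x) * (w x - s x)) = 0"
      using s(2) insert.hyps by (simp add: S0_def)
    with s(1) show ?thesis by blast
  qed
  show ?case
  proof (cases "S \<subseteq> S0")
    case True
    moreover have "S0 \<subseteq> S" by (auto simp: S0_def)
    ultimately have "S = S0" by blast
    then show ?thesis using IH[of v] by simp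
  next
    case False
    then obtain e where e: "e \<in> S" "e x0 \<noteq> 0" by (auto simp: S0_def)
    obtain se where se: "se \<in> S0" "\<forall>f\<in>S0. (\<Sum>x\<in>insert x0 X. cnj (f x) * (e x - se x)) = 0"
      using IH[of e] by blast
    obtain sv where sv: "sv \<in> S0" "\<forall>f\<in>S0. (\<Sum>x\<in>insert x0 X. cnj (f x) * (v x - sv x)) = 0"
      using IH[of v] by blast
    have sub: "(\<lambda>x. f x + c * g x) \<in> S" if "f \<in> S" "g \<in> S" for f g c
      using insert.prems(2)[OF that(1) insert.prems(3)[OF that(2), of c]] .
    \<comment> \<open>\<open>S\<close> is spanned by \<open>S0\<close> and \<open>q\<close>, which is orthogonal to \<open>S0\<close>: one Gram-Schmidt step.\<close>
    define q where "q = (\<lambda>x. e x + (-1) * se x)"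
    have q: "q \<in> S" "q x0 \<noteq> 0" using sub[OF e(1), of se "-1"] se(1) e(2) by (auto simp: q_def S0_def)
    have qS0: "(\<Sum>x\<in>insert x0 X. cnj (f x) * q x) = 0" if "f \<in> S0" for f
      using se(2) that by (simp add: q_def)
    define qq where "qq = (\<Sum>x\<in>insert x0 X. cnj (q x) * q x)"
    have "qq = of_real (\<Sum>x\<in>insert x0 X. (cmod (q x))\<^sup>2)"
      unfolding qq_def of_real_sum
      by (intro sum.cong refl) (simp add: complex_norm_square mult.commute del: of_real_power)
    moreover have "(\<Sum>x\<in>insert x0 X. (cmod (q x))\<^sup>2) > 0"
      using q(2) insert.hyps by (intro sum_pos2[of _ x0]) auto
    ultimately have qq: "qq \<noteq> 0" by (metis less_irrefl of_real_eq_0_iff)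
    define c where "c = (\<Sum>x\<in>insert x0 X. cnj (q x) * (v x - sv x)) / qq"
    define s where "s = (\<lambda>x. sv x + c * q x)"
    have sS: "s \<in> S" unfolding s_def using sub[OF _ q(1)] sv(1) by (auto simp: S0_def)
    have sq: "(\<Sum>x\<in>insert x0 X. cnj (q x) * (v x - s x)) = 0"
    proof -
      have "(\<Sum>x\<in>insert x0 X. cnj (q x) * (v x - s x)) =
            (\<Sum>x\<in>insert x0 X. cnj (q x) * (v x - sv x)) - c * qq"
        unfolding qq_def s_def sum_distrib_left sum_subtractf[symmetric]
        by (intro sum.cong) (auto simp: algebra_simps)
      then show ?thesis using qq by (simp add: c_def)
    qed
    have sS0: "(\<Sum>x\<in>insert x0 X. cnj (f x) * (v x - s x)) = 0" if "f \<in> S0" for f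
    proof -
      have "(\<Sum>x\<in>insert x0 X. cnj (f x) * (v x - s x)) =
            (\<Sum>x\<in>insert x0 X. cnj (f x) * (v x - sv x)) - c * (\<Sum>x\<in>insert x0 X. cnj (f x) * q x)"
        unfolding s_def sum_distrib_left sum_subtractf[symmetric]
        by (intro sum.cong) (auto simp: algebra_simps)
      then show ?thesis using sv(2) qS0[OF that] that by simp
    qed
    have "(\<Sum>x\<in>insert x0 X. cnj (f x) * (v x - s x)) = 0" if f: "f \<in> S" for f
    proof -
      define k where "k = f x0 / q x0"
      define f0 where "f0 = (\<lambda>x. f x + (-k) * q x)"
      have f0: "f0 \<in> S0" using sub[OF f q(1), of "-k"] q(2) by (simp add: S0_def f0_def k_def)
      have "(\<Sum>x\<in>insert x0 X. cnj (f x) * (v x - s x)) =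
            (\<Sum>x\<in>insert x0 X. cnj (f0 x) * (v x - s x)) + cnj k * (\<Sum>x\<in>insert x0 X. cnj (q x) * (v x - s x))"
        unfolding sum_distrib_left sum.distrib[symmetric]
        by (intro sum.cong) (auto simp: f0_def algebra_simps)
      then show ?thesis using sS0[OF f0] sq by simp
    qed
    then show ?thesis using sS by blast
  qed
qed


section \<open>Coefficient functions of linear functionals\<close>

definition letters :: "('v, 'e) hypergraph \<Rightarrow> ('v + 'e) set" where
  "letters \<Lambda> = Inl ` verts \<Lambda> \<union> Inr ` edges \<Lambda>"

text \<open>
  The incidence matrix as a matrix over the joint alphabet, zero outside the block \<open>V \<times> E\<close>. With a block
  diagonal \<open>P\<close>, the relation \<open>A\<^bsub>\<Lambda>1\<^esub> P\<^sub>E = P\<^sub>V A\<^bsub>\<Lambda>2\<^esub>\<close> reads \<open>inc \<Lambda>1 P = P (inc \<Lambda>2)\<close>.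
\<close>

definition inc :: "('v, 'e) hypergraph \<Rightarrow> 'v + 'e \<Rightarrow> 'v + 'e \<Rightarrow> complex" where
  "inc \<Lambda> i j = (case i of Inl v \<Rightarrow> (case j of Inr e \<Rightarrow> incidence_matrix \<Lambda> v e | _ \<Rightarrow> 0) | _ \<Rightarrow> 0)"

lemma cnj_inc [simp]: "cnj (inc \<Lambda> i j) = inc \<Lambda> i j"
  by (simp add: inc_def incidence_matrix_def split: sum.split)

lemma finite_letters [simp]: "full_hypergraph \<Lambda> \<Longrightarrow> finite (letters \<Lambda>)"
  by (simp add: letters_def full_hypergraph_def)

type_synonym ('i, 'j) coef = "'i list \<Rightarrow> 'j list \<Rightarrow> complex"

text \<open>
  Word pairs along which the product of entries of a block diagonal \<open>P\<close> is not forced to vanish: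
  \<^const>\<open>isl\<close> distinguishes vertices from edges.
\<close>

definition matched ::
  "('v1, 'e1) hypergraph \<Rightarrow> ('v2, 'e2) hypergraph \<Rightarrow> ('v1 + 'e1) list \<Rightarrow> ('v2 + 'e2) list \<Rightarrow> bool" where
  "matched \<Lambda>1 \<Lambda>2 a b \<longleftrightarrow> set a \<subseteq> letters \<Lambda>1 \<and> set b \<subseteq> letters \<Lambda>2 \<and> map isl a = map isl b"

lemma matched_length: "matched \<Lambda>1 \<Lambda>2 a b \<Longrightarrow> length a = length b"
  unfolding matched_def by (metis length_map)

lemma matched_append:
  "length a = length b \<Longrightarrow>
    matched \<Lambda>1 \<Lambda>2 (a @ c) (b @ d) \<longleftrightarrow> matched \<Lambda>1 \<Lambda>2 a b \<and> matched \<Lambda>1 \<Lambda>2 c d"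
  by (auto simp: matched_def)

lemma matched_rev: "matched \<Lambda>1 \<Lambda>2 (rev a) (rev b) \<longleftrightarrow> matched \<Lambda>1 \<Lambda>2 a b"
  by (simp add: matched_def rev_map[symmetric])

lemma matched_sym: "matched \<Lambda>1 \<Lambda>2 a b \<Longrightarrow> matched \<Lambda>2 \<Lambda>1 b a"
  by (simp add: matched_def)

definition shift :: "'i list \<Rightarrow> 'j list \<Rightarrow> 'i list \<Rightarrow> 'j list \<Rightarrow> ('i, 'j) coef \<Rightarrow> ('i, 'j) coef" where
  "shift u u' v v' x = (\<lambda>a b. x (u @ a @ v) (u' @ b @ v'))"

text \<open>
  The relations of a magic unitary and of the intertwiner, for the values \<open>y\<close> of a functional on words
  of length at most two. Together with the contexts supplied by \<^const>\<open>shift\<close> this says that the functional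
  vanishes on the two-sided ideal that the relations generate.
\<close>

definition local_rels ::
  "('v1, 'e1) hypergraph \<Rightarrow> ('v2, 'e2) hypergraph \<Rightarrow> ('v1 + 'e1, 'v2 + 'e2) coef \<Rightarrow> bool" where
  "local_rels \<Lambda>1 \<Lambda>2 y \<longleftrightarrow>
     (\<forall>i\<in>letters \<Lambda>1. \<forall>j\<in>letters \<Lambda>2. \<forall>j'\<in>letters \<Lambda>2.
        y [i, i] [j, j'] = (if j = j' then y [i] [j] else 0)) \<and>
     (\<forall>i\<in>letters \<Lambda>1. \<forall>i'\<in>letters \<Lambda>1. \<forall>j\<in>letters \<Lambda>2.
        y [i, i'] [j, j] = (if i = i' then y [i] [j] else 0)) \<and>
     (\<forall>i\<in>letters \<Lambda>1. (\<Sum>j\<in>letters \<Lambda>2. y [i] [j]) = y [] []) \<and>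
     (\<forall>j\<in>letters \<Lambda>2. (\<Sum>i\<in>letters \<Lambda>1. y [i] [j]) = y [] []) \<and>
     (\<forall>i\<in>letters \<Lambda>1. \<forall>j\<in>letters \<Lambda>2.
        (\<Sum>k\<in>letters \<Lambda>1. inc \<Lambda>1 i k * y [k] [j]) = (\<Sum>l\<in>letters \<Lambda>2. inc \<Lambda>2 l j * y [i] [l]))"

definition coefs ::
  "('v1, 'e1) hypergraph \<Rightarrow> ('v2, 'e2) hypergraph \<Rightarrow> ('v1 + 'e1, 'v2 + 'e2) coef set" where
  "coefs \<Lambda>1 \<Lambda>2 = {x. (\<forall>a b. x a b \<noteq> 0 \<longrightarrow> matched \<Lambda>1 \<Lambda>2 a b) \<and>
     (\<forall>u u' v v'. length u = length u' \<longrightarrow> length v = length v' \<longrightarrow>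
        local_rels \<Lambda>1 \<Lambda>2 (shift u u' v v' x))}"

lemma coefs_support: "x \<in> coefs \<Lambda>1 \<Lambda>2 \<Longrightarrow> \<not> matched \<Lambda>1 \<Lambda>2 a b \<Longrightarrow> x a b = 0"
  by (auto simp: coefs_def)

lemma coefs_length: "x \<in> coefs \<Lambda>1 \<Lambda>2 \<Longrightarrow> length a \<noteq> length b \<Longrightarrow> x a b = 0"
  using coefs_support matched_length by metis

lemma coefs_local:
  "x \<in> coefs \<Lambda>1 \<Lambda>2 \<Longrightarrow> length u = length u' \<Longrightarrow> length v = length v' \<Longrightarrow>
    local_rels \<Lambda>1 \<Lambda>2 (shift u u' v v' x)"
  by (auto simp: coefs_def)

lemma coefs_local_0: "x \<in> coefs \<Lambda>1 \<Lambda>2 \<Longrightarrow> local_rels \<Lambda>1 \<Lambda>2 x"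
  using coefs_local[of x \<Lambda>1 \<Lambda>2 "[]" "[]" "[]" "[]"] by (simp add: shift_def)

lemma coefs_shift:
  fixes \<Lambda>1 :: "('v1, 'e1) hypergraph" and \<Lambda>2 :: "('v2, 'e2) hypergraph"
  assumes "x \<in> coefs \<Lambda>1 \<Lambda>2" "length u = length u'" "length v = length v'"
  shows "shift u u' v v' x \<in> coefs \<Lambda>1 \<Lambda>2"
  unfolding coefs_def
proof (intro CollectI conjI allI impI)
  fix a b assume "shift u u' v v' x a b \<noteq> 0"
  then have m: "matched \<Lambda>1 \<Lambda>2 (u @ a @ v) (u' @ b @ v')"
    using coefs_support[OF assms(1)] by (auto simp: shift_def)
  then have "length a = length b" using matched_length[OF m] assms by simp
  with m assms show "matched \<Lambda>1 \<Lambda>2 a b" by (simp add: matched_append)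
next
  fix w s :: "('v1 + 'e1) list" and w' s' :: "('v2 + 'e2) list"
  assume "length w = length w'" "length s = length s'"
  then show "local_rels \<Lambda>1 \<Lambda>2 (shift w w' s s' (shift u u' v v' x))"
    using coefs_local[OF assms(1), of "u @ w" "u' @ w'" "s @ v" "s' @ v'"] assms
    by (simp add: shift_def)
qed

lemma local_rels_add:
  "local_rels \<Lambda>1 \<Lambda>2 x \<Longrightarrow> local_rels \<Lambda>1 \<Lambda>2 y \<Longrightarrow> local_rels \<Lambda>1 \<Lambda>2 (\<lambda>a b. x a b + y a b)"
  unfolding local_rels_def by (auto simp: sum.distrib distrib_left)

lemma sum_scale_left:
  fixes f g :: "'z \<Rightarrow> complex"
  shows "(\<Sum>k\<in>A. g k * (c * f k)) = c * (\<Sum>k\<in>A. g k * f k)"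
  by (simp add: sum_distrib_left mult.left_commute)

lemma local_rels_scale: "local_rels \<Lambda>1 \<Lambda>2 x \<Longrightarrow> local_rels \<Lambda>1 \<Lambda>2 (\<lambda>a b. c * x a b)"
  unfolding local_rels_def by (simp add: sum_scale_left flip: sum_distrib_left)

lemma local_rels_0: "local_rels \<Lambda>1 \<Lambda>2 (\<lambda>a b. 0)"
  by (simp add: local_rels_def)

lemma local_rels_sum:
  "(\<And>s. s \<in> A \<Longrightarrow> local_rels \<Lambda>1 \<Lambda>2 (x s)) \<Longrightarrow> local_rels \<Lambda>1 \<Lambda>2 (\<lambda>a b. \<Sum>s\<in>A. x s a b)"
  by (induction A rule: infinite_finite_induct) (auto simp: local_rels_0 local_rels_add)

lemma coefs_add: "x \<in> coefs \<Lambda>1 \<Lambda>2 \<Longrightarrow> y \<in> coefs \<Lambda>1 \<Lambda>2 \<Longrightarrow> (\<lambda>a b. x a b + y a b) \<in> coefs \<Lambda>1 \<Lambda>2"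
proof -
  assume x: "x \<in> coefs \<Lambda>1 \<Lambda>2" and y: "y \<in> coefs \<Lambda>1 \<Lambda>2"
  have "x a b = 0 \<and> y a b = 0" if "\<not> matched \<Lambda>1 \<Lambda>2 a b" for a b
    using coefs_support that x y by blast
  then show ?thesis
    using local_rels_add[OF coefs_local[OF x] coefs_local[OF y]] unfolding coefs_def shift_def
    by fastforce
qed

lemma coefs_scale: "x \<in> coefs \<Lambda>1 \<Lambda>2 \<Longrightarrow> (\<lambda>a b. c * x a b) \<in> coefs \<Lambda>1 \<Lambda>2"
  using local_rels_scale[of \<Lambda>1 \<Lambda>2 "shift _ _ _ _ x"]
  unfolding coefs_def shift_def by simp

lemma coefs_0: "(\<lambda>a b. 0) \<in> coefs \<Lambda>1 \<Lambda>2"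
  by (simp add: coefs_def shift_def local_rels_0)

lemma coefs_sum: "(\<And>s. s \<in> A \<Longrightarrow> x s \<in> coefs \<Lambda>1 \<Lambda>2) \<Longrightarrow> (\<lambda>a b. \<Sum>s\<in>A. x s a b) \<in> coefs \<Lambda>1 \<Lambda>2"
  by (induction A rule: infinite_finite_induct) (auto simp: coefs_0 coefs_add)

lemma coefs_row: "x \<in> coefs \<Lambda>1 \<Lambda>2 \<Longrightarrow> i \<in> letters \<Lambda>1 \<Longrightarrow> length u = length u' \<Longrightarrow> length v = length v' \<Longrightarrow>
    (\<Sum>j\<in>letters \<Lambda>2. x (u @ i # v) (u' @ j # v')) = x (u @ v) (u' @ v')"
  using coefs_local[of x \<Lambda>1 \<Lambda>2 u u' v v'] unfolding local_rels_def shift_def by simp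

lemma coefs_col: "x \<in> coefs \<Lambda>1 \<Lambda>2 \<Longrightarrow> j \<in> letters \<Lambda>2 \<Longrightarrow> length u = length u' \<Longrightarrow> length v = length v' \<Longrightarrow>
    (\<Sum>i\<in>letters \<Lambda>1. x (u @ i # v) (u' @ j # v')) = x (u @ v) (u' @ v')"
  using coefs_local[of x \<Lambda>1 \<Lambda>2 u u' v v'] unfolding local_rels_def shift_def by simp

lemma coefs_idem_row: "x \<in> coefs \<Lambda>1 \<Lambda>2 \<Longrightarrow> i \<in> letters \<Lambda>1 \<Longrightarrow> j \<in> letters \<Lambda>2 \<Longrightarrow> j' \<in> letters \<Lambda>2 \<Longrightarrow>
    length u = length u' \<Longrightarrow> length v = length v' \<Longrightarrow>
    x (u @ i # i # v) (u' @ j # j' # v') = (if j = j' then x (u @ i # v) (u' @ j # v') else 0)"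
  using coefs_local[of x \<Lambda>1 \<Lambda>2 u u' v v'] unfolding local_rels_def shift_def by simp

lemma coefs_idem_col: "x \<in> coefs \<Lambda>1 \<Lambda>2 \<Longrightarrow> i \<in> letters \<Lambda>1 \<Longrightarrow> i' \<in> letters \<Lambda>1 \<Longrightarrow> j \<in> letters \<Lambda>2 \<Longrightarrow>
    length u = length u' \<Longrightarrow> length v = length v' \<Longrightarrow>
    x (u @ i # i' # v) (u' @ j # j # v') = (if i = i' then x (u @ i # v) (u' @ j # v') else 0)"
  using coefs_local[of x \<Lambda>1 \<Lambda>2 u u' v v'] unfolding local_rels_def shift_def by simp

lemma coefs_inc: "x \<in> coefs \<Lambda>1 \<Lambda>2 \<Longrightarrow> i \<in> letters \<Lambda>1 \<Longrightarrow> j \<in> letters \<Lambda>2 \<Longrightarrow>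
    length u = length u' \<Longrightarrow> length v = length v' \<Longrightarrow>
    (\<Sum>k\<in>letters \<Lambda>1. inc \<Lambda>1 i k * x (u @ k # v) (u' @ j # v')) =
    (\<Sum>l\<in>letters \<Lambda>2. inc \<Lambda>2 l j * x (u @ i # v) (u' @ l # v'))"
  using coefs_local[of x \<Lambda>1 \<Lambda>2 u u' v v'] unfolding local_rels_def shift_def by simp

text \<open>
  Each relation involves words of bounded length. This is what allows functionals to be
  constructed separately for every length.
\<close>

lemma coefs_locality:
  fixes \<Lambda>1 :: "('v1, 'e1) hypergraph" and \<Lambda>2 :: "('v2, 'e2) hypergraph"
  assumes "\<And>N. \<exists>p\<in>coefs \<Lambda>1 \<Lambda>2. \<forall>a b. length a \<le> N \<longrightarrow> t a b = p a b"
  shows "t \<in> coefs \<Lambda>1 \<Lambda>2"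
  unfolding coefs_def
proof (intro CollectI conjI allI impI)
  fix a b assume "t a b \<noteq> 0"
  then show "matched \<Lambda>1 \<Lambda>2 a b" using assms[of "length a"] coefs_support by (metis le_refl)
next
  fix u v :: "('v1 + 'e1) list" and u' v' :: "('v2 + 'e2) list"
  assume l: "length u = length u'" "length v = length v'"
  obtain p where p: "p \<in> coefs \<Lambda>1 \<Lambda>2" "\<forall>a b. length a \<le> length u + length v + 2 \<longrightarrow> t a b = p a b"
    using assms by blast
  have "local_rels \<Lambda>1 \<Lambda>2 (shift u u' v v' t) = local_rels \<Lambda>1 \<Lambda>2 (shift u u' v v' p)"
    unfolding local_rels_def shift_def using p(2) by simp
  then show "local_rels \<Lambda>1 \<Lambda>2 (shift u u' v v' t)" using coefs_local[OF p(1) l] by simp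
qed


subsection \<open>Convolution\<close>

text \<open>
  The functional \<open>\<Phi> \<circ> \<Delta>\<close> for a bilinear form \<open>\<Phi>\<close> on \<open>\<O> \<Lambda>1 \<Lambda> \<times> \<O> \<Lambda> \<Lambda>3\<close>. General bilinear forms, and not only
  products of two functionals, are needed to see that \<open>\<Delta>\<close> is well defined on the quotient.
\<close>

definition convolve ::
  "('v, 'e) hypergraph \<Rightarrow> ('i list \<Rightarrow> ('v + 'e) list \<Rightarrow> ('v + 'e) list \<Rightarrow> 'k list \<Rightarrow> complex)
     \<Rightarrow> ('i, 'k) coef" where
  "convolve \<Lambda> \<Phi> a b = (\<Sum>c\<in>words (letters \<Lambda>) (length a). \<Phi> a c c b)"

text \<open>
  The computation that \<open>\<Sum>j. p(i, j) \<otimes> p(j, k)\<close> is again a magic unitary that intertwines the incidence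
  matrices, read off on functionals.
\<close>

lemma local_rels_convolve:
  assumes L: "\<And>c' b. (\<lambda>a c. \<Phi> a c c' b) \<in> coefs \<Lambda>1 \<Lambda>2"
    and R: "\<And>a c. (\<lambda>c' b. \<Phi> a c c' b) \<in> coefs \<Lambda>2 \<Lambda>3"
    and fin: "finite (letters \<Lambda>2)"
  shows "local_rels \<Lambda>1 \<Lambda>3 (convolve \<Lambda>2 \<Phi>)"
proof -
  let ?I = "letters \<Lambda>1" and ?J = "letters \<Lambda>2" and ?K = "letters \<Lambda>3"
  have c0: "convolve \<Lambda>2 \<Phi> [] [] = \<Phi> [] [] [] []" by (simp add: convolve_def)
  have c1: "convolve \<Lambda>2 \<Phi> [i] [k] = (\<Sum>j\<in>?J. \<Phi> [i] [j] [j] [k])" for i k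
    by (simp add: convolve_def)
  have c2: "convolve \<Lambda>2 \<Phi> [i, i'] [k, k'] = (\<Sum>j\<in>?J. \<Sum>j'\<in>?J. \<Phi> [i, i'] [j, j'] [j, j'] [k, k'])" for i i' k k'
    using sum_words_2[of "\<lambda>c. \<Phi> [i, i'] c c [k, k']" ?J] by (simp add: convolve_def numeral_2_eq_2)
  note l = L[THEN coefs_idem_row, of _ _ _ "[]" "[]" "[]" "[]", simplified]
    L[THEN coefs_idem_col, of _ _ _ "[]" "[]" "[]" "[]", simplified]
  note r = R[THEN coefs_idem_row, of _ _ _ "[]" "[]" "[]" "[]", simplified]
    R[THEN coefs_idem_col, of _ _ _ "[]" "[]" "[]" "[]", simplified]
  show ?thesis
    unfolding local_rels_def
  proof (intro conjI ballI)
    fix i k k' assume m: "i \<in> ?I" "k \<in> ?K" "k' \<in> ?K"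
    have "convolve \<Lambda>2 \<Phi> [i, i] [k, k'] = (\<Sum>j\<in>?J. \<Sum>j'\<in>?J. if j = j' then \<Phi> [i] [j] [j, j'] [k, k'] else 0)"
      unfolding c2 using m by (intro sum.cong refl) (simp add: l)
    also have "\<dots> = (\<Sum>j\<in>?J. \<Phi> [i] [j] [j, j] [k, k'])" using fin by (simp add: sum.delta)
    also have "\<dots> = (if k = k' then convolve \<Lambda>2 \<Phi> [i] [k] else 0)" using m by (simp add: r c1)
    finally show "convolve \<Lambda>2 \<Phi> [i, i] [k, k'] = (if k = k' then convolve \<Lambda>2 \<Phi> [i] [k] else 0)" .
  next
    fix i i' k assume m: "i \<in> ?I" "i' \<in> ?I" "k \<in> ?K"
    have "convolve \<Lambda>2 \<Phi> [i, i'] [k, k] = (\<Sum>j\<in>?J. \<Sum>j'\<in>?J. if j = j' then \<Phi> [i, i'] [j, j'] [j] [k] else 0)"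
      unfolding c2 using m by (intro sum.cong refl) (simp add: r)
    also have "\<dots> = (\<Sum>j\<in>?J. \<Phi> [i, i'] [j, j] [j] [k])" using fin by (simp add: sum.delta)
    also have "\<dots> = (if i = i' then convolve \<Lambda>2 \<Phi> [i] [k] else 0)" using m by (simp add: l c1)
    finally show "convolve \<Lambda>2 \<Phi> [i, i'] [k, k] = (if i = i' then convolve \<Lambda>2 \<Phi> [i] [k] else 0)" .
  next
    fix i assume m: "i \<in> ?I"
    have "(\<Sum>k\<in>?K. convolve \<Lambda>2 \<Phi> [i] [k]) = (\<Sum>j\<in>?J. \<Sum>k\<in>?K. \<Phi> [i] [j] [j] [k])"
      unfolding c1 by (rule sum.swap)
    also have "\<dots> = (\<Sum>j\<in>?J. \<Phi> [i] [j] [] [])"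
      using coefs_row[OF R, of _ "[]" "[]" "[]" "[]"] by simp
    also have "\<dots> = \<Phi> [] [] [] []" using m coefs_row[OF L, of _ "[]" "[]" "[]" "[]"] by simp
    finally show "(\<Sum>k\<in>?K. convolve \<Lambda>2 \<Phi> [i] [k]) = convolve \<Lambda>2 \<Phi> [] []" by (simp add: c0)
  next
    fix k assume m: "k \<in> ?K"
    have "(\<Sum>i\<in>?I. convolve \<Lambda>2 \<Phi> [i] [k]) = (\<Sum>j\<in>?J. \<Sum>i\<in>?I. \<Phi> [i] [j] [j] [k])"
      unfolding c1 by (rule sum.swap)
    also have "\<dots> = (\<Sum>j\<in>?J. \<Phi> [] [] [j] [k])"
      using coefs_col[OF L, of _ "[]" "[]" "[]" "[]"] by simp
    also have "\<dots> = \<Phi> [] [] [] []" using m coefs_col[OF R, of _ "[]" "[]" "[]" "[]"] by simp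
    finally show "(\<Sum>i\<in>?I. convolve \<Lambda>2 \<Phi> [i] [k]) = convolve \<Lambda>2 \<Phi> [] []" by (simp add: c0)
  next
    fix i k assume m: "i \<in> ?I" "k \<in> ?K"
    have "(\<Sum>i'\<in>?I. inc \<Lambda>1 i i' * convolve \<Lambda>2 \<Phi> [i'] [k]) =
        (\<Sum>j\<in>?J. \<Sum>i'\<in>?I. inc \<Lambda>1 i i' * \<Phi> [i'] [j] [j] [k])"
      unfolding c1 sum_distrib_left by (rule sum.swap)
    also have "\<dots> = (\<Sum>j\<in>?J. \<Sum>j'\<in>?J. inc \<Lambda>2 j' j * \<Phi> [i] [j'] [j] [k])"
      using m coefs_inc[OF L, of _ _ "[]" "[]" "[]" "[]"] by simp
    also have "\<dots> = (\<Sum>j'\<in>?J. \<Sum>j\<in>?J. inc \<Lambda>2 j' j * \<Phi> [i] [j'] [j] [k])" by (rule sum.swap)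
    also have "\<dots> = (\<Sum>j'\<in>?J. \<Sum>k'\<in>?K. inc \<Lambda>3 k' k * \<Phi> [i] [j'] [j'] [k'])"
      using m coefs_inc[OF R, of _ _ "[]" "[]" "[]" "[]"] by simp
    also have "\<dots> = (\<Sum>k'\<in>?K. inc \<Lambda>3 k' k * convolve \<Lambda>2 \<Phi> [i] [k'])"
      unfolding c1 sum_distrib_left by (rule sum.swap)
    finally show "(\<Sum>i'\<in>?I. inc \<Lambda>1 i i' * convolve \<Lambda>2 \<Phi> [i'] [k]) =
      (\<Sum>k'\<in>?K. inc \<Lambda>3 k' k * convolve \<Lambda>2 \<Phi> [i] [k'])" .
  qed
qed

lemma convolve_in_coefs:
  fixes \<Lambda>1 :: "('v1, 'e1) hypergraph" and \<Lambda>2 :: "('v2, 'e2) hypergraph"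
    and \<Lambda>3 :: "('v3, 'e3) hypergraph"
  assumes L: "\<And>c' b. (\<lambda>a c. \<Phi> a c c' b) \<in> coefs \<Lambda>1 \<Lambda>2"
    and R: "\<And>a c. (\<lambda>c' b. \<Phi> a c c' b) \<in> coefs \<Lambda>2 \<Lambda>3"
    and fin: "finite (letters \<Lambda>2)"
  shows "convolve \<Lambda>2 \<Phi> \<in> coefs \<Lambda>1 \<Lambda>3"
  unfolding coefs_def
proof (intro CollectI conjI allI impI)
  fix a b assume "convolve \<Lambda>2 \<Phi> a b \<noteq> 0"
  then obtain c where "\<Phi> a c c b \<noteq> 0" unfolding convolve_def by (meson sum.neutral)
  then have "matched \<Lambda>1 \<Lambda>2 a c" "matched \<Lambda>2 \<Lambda>3 c b"
    using coefs_support[OF L, of a c c b] coefs_support[OF R, of c b a c] by blast+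
  then show "matched \<Lambda>1 \<Lambda>3 a b" by (simp add: matched_def)
next
  fix u v :: "('v1 + 'e1) list" and u' v' :: "('v3 + 'e3) list"
  assume l: "length u = length u'" "length v = length v'"
  \<comment> \<open>Splitting the summation word at the ends of the context reduces the claim to the empty context.\<close>
  define \<Psi> where "\<Psi> \<beta> \<beta>' = (\<lambda>a c c' b. \<Phi> (u @ a @ v) (\<beta> @ c @ \<beta>') (\<beta> @ c' @ \<beta>') (u' @ b @ v'))" for \<beta> \<beta>'
  have eq: "shift u u' v v' (convolve \<Lambda>2 \<Phi>) =
    (\<lambda>a b. \<Sum>\<beta>\<in>words (letters \<Lambda>2) (length u). \<Sum>\<beta>'\<in>words (letters \<Lambda>2) (length v). convolve \<Lambda>2 (\<Psi> \<beta> \<beta>') a b)"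
  proof (intro ext)
    fix a b
    have "shift u u' v v' (convolve \<Lambda>2 \<Phi>) a b =
      (\<Sum>c\<in>words (letters \<Lambda>2) (length u + (length a + length v)). \<Phi> (u @ a @ v) c c (u' @ b @ v'))"
      by (simp add: shift_def convolve_def)
    also have "\<dots> = (\<Sum>\<beta>\<in>words (letters \<Lambda>2) (length u). \<Sum>c\<in>words (letters \<Lambda>2) (length a).
        \<Sum>\<beta>'\<in>words (letters \<Lambda>2) (length v). \<Psi> \<beta> \<beta>' a c c b)"
      unfolding sum_words_append \<Psi>_def by simp
    also have "\<dots> = (\<Sum>\<beta>\<in>words (letters \<Lambda>2) (length u). \<Sum>\<beta>'\<in>words (letters \<Lambda>2) (length v). convolve \<Lambda>2 (\<Psi> \<beta> \<beta>') a b)"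
      unfolding convolve_def by (intro sum.cong refl sum.swap)
    finally show "shift u u' v v' (convolve \<Lambda>2 \<Phi>) a b = \<dots>" .
  qed
  show "local_rels \<Lambda>1 \<Lambda>3 (shift u u' v v' (convolve \<Lambda>2 \<Phi>))"
    unfolding eq
  proof (intro local_rels_sum local_rels_convolve fin)
    fix \<beta> \<beta>' c' b assume "\<beta> \<in> words (letters \<Lambda>2) (length u)" "\<beta>' \<in> words (letters \<Lambda>2) (length v)"
    then show "(\<lambda>a c. \<Psi> \<beta> \<beta>' a c c' b) \<in> coefs \<Lambda>1 \<Lambda>2"
      using coefs_shift[OF L, of u \<beta> v \<beta>'] by (simp add: words_def \<Psi>_def shift_def)
  next
    fix \<beta> \<beta>' a c assume "\<beta> \<in> words (letters \<Lambda>2) (length u)" "\<beta>' \<in> words (letters \<Lambda>2) (length v)"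
    then show "(\<lambda>c' b. \<Psi> \<beta> \<beta>' a c c' b) \<in> coefs \<Lambda>2 \<Lambda>3"
      using coefs_shift[OF R, of \<beta> u' \<beta>' v'] l by (simp add: words_def \<Psi>_def shift_def)
  qed
qed

definition conv :: "('v, 'e) hypergraph \<Rightarrow> ('i, 'v + 'e) coef \<Rightarrow> ('v + 'e, 'k) coef \<Rightarrow> ('i, 'k) coef" where
  "conv \<Lambda> x y = convolve \<Lambda> (\<lambda>a c c' b. x a c * y c' b)"

lemma conv_apply: "conv \<Lambda> x y a b = (\<Sum>c\<in>words (letters \<Lambda>) (length a). x a c * y c b)"
  by (simp add: conv_def convolve_def)

lemma conv_in_coefs:
  assumes "x \<in> coefs \<Lambda>1 \<Lambda>2" "y \<in> coefs \<Lambda>2 \<Lambda>3" "finite (letters \<Lambda>2)"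
  shows "conv \<Lambda>2 x y \<in> coefs \<Lambda>1 \<Lambda>3"
  unfolding conv_def
proof (rule convolve_in_coefs)
  show "(\<lambda>a c. x a c * y c' b) \<in> coefs \<Lambda>1 \<Lambda>2" for c' b
    using coefs_scale[OF assms(1), of "y c' b"] by (simp add: mult.commute)
qed (auto intro: coefs_scale assms)

lemma conv_Nil [simp]: "conv \<Lambda> x y [] [] = x [] [] * y [] []"
  by (simp add: conv_apply)

lemma conv_assoc: "conv \<Lambda>2 (conv \<Lambda>1 x y) z = conv \<Lambda>1 x (conv \<Lambda>2 y z)"
proof (intro ext)
  fix a b
  have "conv \<Lambda>2 (conv \<Lambda>1 x y) z a b = (\<Sum>d\<in>words (letters \<Lambda>2) (length a). \<Sum>c\<in>words (letters \<Lambda>1) (length a). x a c * (y c d * z d b))"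
    by (simp add: conv_apply sum_distrib_right mult.assoc)
  also have "\<dots> = (\<Sum>c\<in>words (letters \<Lambda>1) (length a). \<Sum>d\<in>words (letters \<Lambda>2) (length a). x a c * (y c d * z d b))"
    by (rule sum.swap)
  also have "\<dots> = conv \<Lambda>1 x (conv \<Lambda>2 y z) a b"
    by (auto simp: conv_apply sum_distrib_left words_def intro!: sum.cong)
  finally show "conv \<Lambda>2 (conv \<Lambda>1 x y) z a b = conv \<Lambda>1 x (conv \<Lambda>2 y z) a b" .
qed


subsection \<open>Unitarity and the two involutions\<close>

text \<open>
  Adjacent middle letters collapse by orthogonality of the entries in a column and are then summed away
  along a row; this repeats from the inside outwards. On generators:
  \<open>\<Sum>b. p(a, b) p(a', b)\<^sup>* = \<delta>(a, a')\<close>.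
\<close>

lemma coefs_unitary_row:
  assumes x: "x \<in> coefs \<Lambda>1 \<Lambda>2" and "set a \<subseteq> letters \<Lambda>1" "set a' \<subseteq> letters \<Lambda>1" "length a = length a'"
    and l: "length u = length u'" "length v = length v'"
  shows "(\<Sum>b\<in>words (letters \<Lambda>2) (length a). x (u @ a @ rev a' @ v) (u' @ b @ rev b @ v')) =
    (if a = a' then x (u @ v) (u' @ v') else 0)"
  using assms(2-4)
proof (induction a arbitrary: a' rule: rev_induct)
  case Nil
  then show ?case by simp
next
  case (snoc i \<alpha>)
  then obtain \<alpha>' i' where a': "a' = \<alpha>' @ [i']" by (metis append_is_Nil_conv length_0_conv not_Cons_self2 rev_exhaust)
  let ?J = "letters \<Lambda>2"
  have "(\<Sum>b\<in>words ?J (length (\<alpha> @ [i])). x (u @ (\<alpha> @ [i]) @ rev a' @ v) (u' @ b @ rev b @ v')) =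
      (\<Sum>b\<in>words ?J (length \<alpha>). \<Sum>j\<in>?J. x ((u @ \<alpha>) @ i # i' # rev \<alpha>' @ v) ((u' @ b) @ j # j # rev b @ v'))"
    using sum_words_append[of "\<lambda>b. x (u @ (\<alpha> @ [i]) @ rev a' @ v) (u' @ b @ rev b @ v')" ?J "length \<alpha>" "Suc 0"]
    by (simp add: a')
  also have "\<dots> = (\<Sum>b\<in>words ?J (length \<alpha>). \<Sum>j\<in>?J. if i = i' then x ((u @ \<alpha>) @ i # rev \<alpha>' @ v) ((u' @ b) @ j # rev b @ v') else 0)"
    using snoc.prems a' l x by (intro sum.cong refl coefs_idem_col) (auto simp: words_def)
  also have "\<dots> = (\<Sum>b\<in>words ?J (length \<alpha>). if i = i' then x ((u @ \<alpha>) @ rev \<alpha>' @ v) ((u' @ b) @ rev b @ v') else 0)"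
  proof (intro sum.cong refl)
    fix b assume "b \<in> words ?J (length \<alpha>)"
    then show "(\<Sum>j\<in>?J. if i = i' then x ((u @ \<alpha>) @ i # rev \<alpha>' @ v) ((u' @ b) @ j # rev b @ v') else 0) =
      (if i = i' then x ((u @ \<alpha>) @ rev \<alpha>' @ v) ((u' @ b) @ rev b @ v') else 0)"
      using coefs_row[OF x, of i "u @ \<alpha>" "u' @ b" "rev \<alpha>' @ v" "rev b @ v'"] snoc.prems a' l
      by (auto simp: words_def)
  qed
  also have "\<dots> = (if i = i' then \<Sum>b\<in>words ?J (length \<alpha>). x (u @ \<alpha> @ rev \<alpha>' @ v) (u' @ b @ rev b @ v') else 0)"
    by simp
  also have "\<dots> = (if \<alpha> @ [i] = a' then x (u @ v) (u' @ v') else 0)"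
    using snoc.IH[of \<alpha>'] snoc.prems a' by auto
  finally show ?case .
qed

text \<open>
  Two conjugate-linear involutions on functionals: \<open>adj x\<close> is \<open>f \<mapsto> cnj (f \<circ> \<kappa>)\<close> for the conjugate-linear
  multiplicative map \<open>\<kappa> p(j, i) = p(i, j)\<close>, and \<open>bar x\<close> is \<open>f \<mapsto> cnj (f (\<cdot>\<^sup>*))\<close>.
\<close>

definition adj :: "('i, 'j) coef \<Rightarrow> ('j, 'i) coef" where
  "adj x = (\<lambda>b a. cnj (x a b))"

definition bar :: "('i, 'j) coef \<Rightarrow> ('i, 'j) coef" where
  "bar x = (\<lambda>a b. cnj (x (rev a) (rev b)))"

text \<open>
  Multiplying \<open>A P = P B\<close> by the transpose of \<open>P\<close> on both sides gives \<open>P\<^sup>T A = B P\<^sup>T\<close>, because \<open>P\<close> is unitary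
  with self-adjoint entries. This is the one relation of \<open>\<O> \<Lambda>2 \<Lambda>1\<close> that is not visibly symmetric.
\<close>

lemma transposed_intertwiner:
  assumes x: "x \<in> coefs \<Lambda>1 \<Lambda>2" and m: "i \<in> letters \<Lambda>1" "j \<in> letters \<Lambda>2"
    and fin: "finite (letters \<Lambda>1)" "finite (letters \<Lambda>2)"
  shows "(\<Sum>l\<in>letters \<Lambda>1. inc \<Lambda>1 l i * x [l] [j]) = (\<Sum>k\<in>letters \<Lambda>2. inc \<Lambda>2 j k * x [i] [k])"
proof -
  let ?I = "letters \<Lambda>1" and ?J = "letters \<Lambda>2"
  have row: "(\<Sum>k\<in>?J. x [l, m, i] [j, k, k]) = (if m = i then x [l] [j] else 0)" if "m \<in> ?I" "l \<in> ?I" for l m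
    using that m coefs_unitary_row[OF x, of "[m]" "[i]" "[l]" "[j]" "[]" "[]"] by simp
  have col: "(\<Sum>l\<in>?I. x [l, l, i] [j, n, k]) = (if j = n then x [i] [k] else 0)" if "n \<in> ?J" "k \<in> ?J" for n k
  proof -
    have "(\<Sum>l\<in>?I. x [l, l, i] [j, n, k]) = (\<Sum>l\<in>?I. if j = n then x [l, i] [j, k] else 0)"
      using that m coefs_idem_row[OF x, of _ j n "[]" "[]" "[i]" "[k]"] by (intro sum.cong) auto
    then show ?thesis using coefs_col[OF x m(2), of "[]" "[]" "[i]" "[k]"]
      by (cases "j = n") simp_all
  qed
  have "(\<Sum>l\<in>?I. inc \<Lambda>1 l i * x [l] [j]) = (\<Sum>l\<in>?I. \<Sum>m\<in>?I. inc \<Lambda>1 l m * (\<Sum>k\<in>?J. x [l, m, i] [j, k, k]))"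
  proof (intro sum.cong refl)
    fix l assume l: "l \<in> ?I"
    have "(\<Sum>m\<in>?I. inc \<Lambda>1 l m * (\<Sum>k\<in>?J. x [l, m, i] [j, k, k])) = (\<Sum>m\<in>?I. if m = i then inc \<Lambda>1 l i * x [l] [j] else 0)"
      by (intro sum.cong refl) (simp add: row l)
    then show "inc \<Lambda>1 l i * x [l] [j] = (\<Sum>m\<in>?I. inc \<Lambda>1 l m * (\<Sum>k\<in>?J. x [l, m, i] [j, k, k]))"
      using fin m by simp
  qed
  also have "\<dots> = (\<Sum>l\<in>?I. \<Sum>k\<in>?J. \<Sum>m\<in>?I. inc \<Lambda>1 l m * x ([l] @ m # [i]) ([j] @ k # [k]))"
    unfolding sum_distrib_left append_Cons append_Nil by (intro sum.cong refl sum.swap)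
  also have "\<dots> = (\<Sum>l\<in>?I. \<Sum>k\<in>?J. \<Sum>n\<in>?J. inc \<Lambda>2 n k * x ([l] @ l # [i]) ([j] @ n # [k]))"
    by (intro sum.cong refl coefs_inc[OF x]) auto
  also have "\<dots> = (\<Sum>k\<in>?J. \<Sum>l\<in>?I. \<Sum>n\<in>?J. inc \<Lambda>2 n k * x ([l] @ l # [i]) ([j] @ n # [k]))"
    by (rule sum.swap)
  also have "\<dots> = (\<Sum>k\<in>?J. \<Sum>n\<in>?J. inc \<Lambda>2 n k * (\<Sum>l\<in>?I. x [l, l, i] [j, n, k]))"
    unfolding sum_distrib_left append_Cons append_Nil by (intro sum.cong refl sum.swap)
  also have "\<dots> = (\<Sum>k\<in>?J. \<Sum>n\<in>?J. if j = n then inc \<Lambda>2 j k * x [i] [k] else 0)"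
    by (intro sum.cong refl) (simp add: col)
  also have "\<dots> = (\<Sum>k\<in>?J. inc \<Lambda>2 j k * x [i] [k])"
    using fin m by simp
  finally show ?thesis .
qed

lemma adj_in_coefs:
  fixes \<Lambda>1 :: "('v1, 'e1) hypergraph" and \<Lambda>2 :: "('v2, 'e2) hypergraph"
  assumes x: "x \<in> coefs \<Lambda>1 \<Lambda>2" and fin: "finite (letters \<Lambda>1)" "finite (letters \<Lambda>2)"
  shows "adj x \<in> coefs \<Lambda>2 \<Lambda>1"
proof -
  have loc: "local_rels \<Lambda>2 \<Lambda>1 (adj y)" if y: "y \<in> coefs \<Lambda>1 \<Lambda>2" for y
  proof -
    have i: "(\<Sum>k\<in>letters \<Lambda>2. inc \<Lambda>2 j k * cnj (y [i] [k])) = (\<Sum>l\<in>letters \<Lambda>1. inc \<Lambda>1 l i * cnj (y [l] [j]))"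
      if "i \<in> letters \<Lambda>1" "j \<in> letters \<Lambda>2" for i j
      using arg_cong[OF transposed_intertwiner[OF y that fin], of cnj] by simp
    show ?thesis using coefs_local_0[OF y] i unfolding local_rels_def adj_def
      by (simp flip: cnj_sum)
  qed
  show ?thesis
    unfolding coefs_def
  proof (intro CollectI conjI allI impI)
    show "matched \<Lambda>2 \<Lambda>1 b a" if "adj x b a \<noteq> 0" for a b
      using that coefs_support[OF x, of a b] by (auto simp: adj_def intro: matched_sym)
  next
    fix u' v' :: "('v2 + 'e2) list" and u v :: "('v1 + 'e1) list"
    assume "length u' = length u" "length v' = length v"
    then show "local_rels \<Lambda>2 \<Lambda>1 (shift u' u v' v (adj x))"
      using loc[OF coefs_shift[OF x, of u u' v v']] by (simp add: shift_def adj_def)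
  qed
qed

lemma bar_in_coefs:
  fixes \<Lambda>1 :: "('v1, 'e1) hypergraph" and \<Lambda>2 :: "('v2, 'e2) hypergraph"
  assumes x: "x \<in> coefs \<Lambda>1 \<Lambda>2"
  shows "bar x \<in> coefs \<Lambda>1 \<Lambda>2"
proof -
  have loc: "local_rels \<Lambda>1 \<Lambda>2 (bar y)" if y: "y \<in> coefs \<Lambda>1 \<Lambda>2" for y
  proof -
    have i: "(\<Sum>k\<in>letters \<Lambda>1. inc \<Lambda>1 i k * cnj (y [k] [j])) = (\<Sum>l\<in>letters \<Lambda>2. inc \<Lambda>2 l j * cnj (y [i] [l]))"
      if "i \<in> letters \<Lambda>1" "j \<in> letters \<Lambda>2" for i j
      using arg_cong[OF coefs_inc[OF y that, of "[]" "[]" "[]" "[]"], of cnj] by simp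
    show ?thesis using coefs_local_0[OF y] i unfolding local_rels_def bar_def
      by (auto simp flip: cnj_sum)
  qed
  show ?thesis
    unfolding coefs_def
  proof (intro CollectI conjI allI impI)
    show "matched \<Lambda>1 \<Lambda>2 a b" if "bar x a b \<noteq> 0" for a b
      using that coefs_support[OF x, of "rev a" "rev b"] by (auto simp: bar_def matched_rev)
  next
    fix u' v' :: "('v2 + 'e2) list" and u v :: "('v1 + 'e1) list"
    assume "length u = length u'" "length v = length v'"
    then show "local_rels \<Lambda>1 \<Lambda>2 (shift u u' v v' (bar x))"
      using loc[OF coefs_shift[OF x, of "rev v" "rev v'" "rev u" "rev u'"]] by (simp add: shift_def bar_def)
  qed
qed

lemma coefs_unitary_col:
  assumes x: "x \<in> coefs \<Lambda>1 \<Lambda>2" and "set b \<subseteq> letters \<Lambda>2" "set b' \<subseteq> letters \<Lambda>2" "length b = length b'"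
    and l: "length u = length u'" "length v = length v'"
    and fin: "finite (letters \<Lambda>1)" "finite (letters \<Lambda>2)"
  shows "(\<Sum>a\<in>words (letters \<Lambda>1) (length b). x (u @ a @ rev a @ v) (u' @ b @ rev b' @ v')) =
    (if b = b' then x (u @ v) (u' @ v') else 0)"
proof -
  have "cnj (\<Sum>a\<in>words (letters \<Lambda>1) (length b). x (u @ a @ rev a @ v) (u' @ b @ rev b' @ v')) =
    (if b = b' then cnj (x (u @ v) (u' @ v')) else 0)"
    using coefs_unitary_row[OF adj_in_coefs[OF x fin] assms(2-4), of u' u v' v] l by (simp add: adj_def)
  then show ?thesis
    by (cases "b = b'") (simp_all only: if_True if_False complex_cnj_cancel_iff complex_cnj_zero_iff refl)
qed

lemma adj_conv:
  assumes "x \<in> coefs \<Lambda>1 \<Lambda>2" "y \<in> coefs \<Lambda>2 \<Lambda>3"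
  shows "adj (conv \<Lambda>2 x y) = conv \<Lambda>2 (adj y) (adj x)"
proof (intro ext)
  fix b a
  have "length c = length a \<Longrightarrow> length a \<noteq> length b \<Longrightarrow> y c b = 0" "length c = length b \<Longrightarrow> length a \<noteq> length b \<Longrightarrow> x a c = 0" for c
    using coefs_length[OF assms(1)] coefs_length[OF assms(2)] by auto
  then show "adj (conv \<Lambda>2 x y) b a = conv \<Lambda>2 (adj y) (adj x) b a"
    by (cases "length a = length b") (auto simp: adj_def conv_apply mult.commute words_def intro!: sum.neutral)
qed

lemma bar_conv: "bar (conv \<Lambda> x y) = conv \<Lambda> (bar x) (bar y)"
proof (intro ext)
  fix a b
  show "bar (conv \<Lambda> x y) a b = conv \<Lambda> (bar x) (bar y) a b"
    using sum_words_rev[of "\<lambda>c. cnj (x (rev a) c * y c (rev b))" "letters \<Lambda>" "length a"]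
    by (simp add: bar_def conv_apply)
qed

lemma adj_adj [simp]: "adj (adj x) = x" and bar_bar [simp]: "bar (bar x) = x"
  by (simp_all add: adj_def bar_def)


section \<open>The Haar functional\<close>

lemma sum_cnj_mult_zero:
  fixes f :: "'x \<Rightarrow> complex"
  assumes "finite A" "(\<Sum>x\<in>A. cnj (f x) * f x) = 0" "x \<in> A"
  shows "f x = 0"
proof -
  have "(\<Sum>x\<in>A. cnj (f x) * f x) = of_real (\<Sum>x\<in>A. (cmod (f x))\<^sup>2)"
    unfolding of_real_sum by (intro sum.cong refl) (simp add: complex_norm_square mult.commute del: of_real_power)
  then have "(\<Sum>x\<in>A. (cmod (f x))\<^sup>2) = 0" using assms(2) by (metis of_real_eq_0_iff)
  then show ?thesis using assms(1,3) by (simp add: sum_nonneg_eq_0_iff)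
qed

lemma sum_cnj_mult_nonneg: "(\<Sum>x\<in>A. cnj (f x) * f x) \<in> \<real>\<^sub>\<ge>\<^sub>0" for f :: "'x \<Rightarrow> complex"
proof -
  have "(\<Sum>x\<in>A. cnj (f x) * f x) = of_real (\<Sum>x\<in>A. (cmod (f x))\<^sup>2)"
    unfolding of_real_sum by (intro sum.cong refl) (simp add: complex_norm_square mult.commute del: of_real_power)
  moreover have "(\<Sum>x\<in>A. (cmod (f x))\<^sup>2) \<ge> 0" by (simp add: sum_nonneg)
  ultimately show ?thesis by (simp only: nonneg_Reals_of_real_iff)
qed

lemma sum_in_nonneg_Reals:
  "(\<And>x. x \<in> A \<Longrightarrow> f x \<in> \<real>\<^sub>\<ge>\<^sub>0) \<Longrightarrow> sum f A \<in> (\<real>\<^sub>\<ge>\<^sub>0 :: complex set)"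
  by (induction A rule: infinite_finite_induct) auto

lemma sum_pairs: "(\<Sum>p\<in>A \<times> B. f p) = (\<Sum>a\<in>A. \<Sum>b\<in>B. f (a, b))"
  by (simp add: sum.cartesian_product)

locale linked =
  fixes \<Lambda>1 :: "('v1, 'e1) hypergraph" and \<Lambda>2 :: "('v2, 'e2) hypergraph"
  assumes full1: "full_hypergraph \<Lambda>1" and full2: "full_hypergraph \<Lambda>2"
    and nontrivial: "\<exists>x\<in>coefs \<Lambda>1 \<Lambda>2. x [] [] \<noteq> 0"
begin

abbreviation "I \<equiv> letters \<Lambda>1"
abbreviation "J \<equiv> letters \<Lambda>2"
abbreviation "D \<equiv> coefs \<Lambda>1 \<Lambda>2"

lemma fin [simp]: "finite I" "finite J"
  using full1 full2 by auto

lemma conv_ball: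
  assumes "x \<in> coefs \<Lambda>' \<Lambda>" "finite (letters \<Lambda>)" "length a \<le> n"
  shows "conv \<Lambda> x y a b = (\<Sum>c\<in>ball (letters \<Lambda>) n. x a c * y c b)"
  unfolding conv_apply
  by (rule sum_ball_words[symmetric]) (use assms coefs_length[OF assms(1)] in auto)


subsection \<open>Existence and uniqueness\<close>

text \<open>
  The Haar property tested on rows of length at most \<open>N\<close>; the factor \<open>x [] []\<close> is the value at the unit of the
  functional with coefficients \<open>x\<close>.
\<close>

definition invariant_upto :: "nat \<Rightarrow> ('v1 + 'e1, 'v2 + 'e2) coef \<Rightarrow> bool" where
  "invariant_upto N p \<longleftrightarrow> p \<in> D \<and> p [] [] = 1 \<and>
     (\<forall>a b. length a \<le> N \<longrightarrow> (\<forall>x\<in>coefs \<Lambda>1 \<Lambda>1. conv \<Lambda>1 x p a b = x [] [] * p a b)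
        \<and> (\<forall>x\<in>coefs \<Lambda>2 \<Lambda>2. conv \<Lambda>2 p x a b = x [] [] * p a b))"

definition ip :: "nat \<Rightarrow> ('v1 + 'e1, 'v2 + 'e2) coef \<Rightarrow> ('v1 + 'e1, 'v2 + 'e2) coef \<Rightarrow> complex" where
  "ip N y p = (\<Sum>a\<in>ball I N. \<Sum>b\<in>ball J N. cnj (y a b) * p a b)"

lemma ip_definite:
  assumes "ip N d d = 0" "d \<in> D" "length a \<le> N"
  shows "d a b = 0"
proof (cases "matched \<Lambda>1 \<Lambda>2 a b")
  case True
  then have "(a, b) \<in> ball I N \<times> ball J N"
    using assms(3) matched_length[OF True] by (auto simp: matched_def ball_def)
  moreover have "(\<Sum>p\<in>ball I N \<times> ball J N. cnj (case_prod d p) * case_prod d p) = 0"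
    using assms(1) by (simp add: ip_def sum.cartesian_product case_prod_beta)
  ultimately show ?thesis
    using sum_cnj_mult_zero[of "ball I N \<times> ball J N" "case_prod d" "(a, b)"] by simp
next
  case False
  then show ?thesis using coefs_support[OF assms(2)] by simp
qed

lemma ip_conv_left:
  assumes x: "x \<in> coefs \<Lambda>1 \<Lambda>1"
  shows "ip N d (conv \<Lambda>1 x p) = ip N (conv \<Lambda>1 (adj x) d) p"
proof -
  have ax: "adj x \<in> coefs \<Lambda>1 \<Lambda>1" using adj_in_coefs[OF x] by simp
  let ?B = "ball I N" and ?E = "ball J N"
  have cv: "conv \<Lambda>1 (adj x) d c b = (\<Sum>a\<in>?B. adj x c a * d a b)" if "c \<in> ?B" for b c
    using conv_ball[OF ax, of c N d b] that by (simp add: ball_def)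
  have "ip N d (conv \<Lambda>1 x p) = (\<Sum>a\<in>?B. \<Sum>b\<in>?E. \<Sum>c\<in>?B. cnj (d a b) * x a c * p c b)"
    unfolding ip_def by (intro sum.cong refl)
      (simp add: conv_ball[OF x, of _ N] ball_def sum_distrib_left mult.assoc)
  also have "\<dots> = (\<Sum>a\<in>?B. \<Sum>c\<in>?B. \<Sum>b\<in>?E. cnj (d a b) * x a c * p c b)"
    by (intro sum.cong refl sum.swap)
  also have "\<dots> = (\<Sum>c\<in>?B. \<Sum>a\<in>?B. \<Sum>b\<in>?E. cnj (d a b) * x a c * p c b)" by (rule sum.swap)
  also have "\<dots> = (\<Sum>c\<in>?B. \<Sum>b\<in>?E. \<Sum>a\<in>?B. cnj (d a b) * x a c * p c b)"
    by (intro sum.cong refl sum.swap)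
  also have "\<dots> = ip N (conv \<Lambda>1 (adj x) d) p"
    unfolding ip_def by (intro sum.cong refl)
      (simp add: cv sum_distrib_right sum_distrib_left, simp add: adj_def mult_ac)
  finally show ?thesis .
qed

lemma ip_conv_right:
  assumes x: "x \<in> coefs \<Lambda>2 \<Lambda>2" and d: "d \<in> D" and p: "p \<in> D"
  shows "ip N d (conv \<Lambda>2 p x) = ip N (conv \<Lambda>2 d (adj x)) p"
proof -
  let ?B = "ball I N" and ?E = "ball J N"
  have "ip N d (conv \<Lambda>2 p x) = (\<Sum>a\<in>?B. \<Sum>b\<in>?E. \<Sum>c\<in>?E. cnj (d a b) * p a c * x c b)"
    unfolding ip_def by (intro sum.cong refl)
      (simp add: conv_ball[OF p, of _ N] ball_def sum_distrib_left mult.assoc)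
  also have "\<dots> = (\<Sum>a\<in>?B. \<Sum>c\<in>?E. \<Sum>b\<in>?E. cnj (d a b) * p a c * x c b)"
    by (intro sum.cong refl sum.swap)
  also have "\<dots> = ip N (conv \<Lambda>2 d (adj x)) p"
    unfolding ip_def by (intro sum.cong refl)
      (simp add: conv_ball[OF d, of _ N] ball_def sum_distrib_left adj_def mult_ac)
  finally show ?thesis .
qed

lemma ip_diff: "ip N y (\<lambda>a b. p a b - q a b) = ip N y p - ip N y q"
  by (simp add: ip_def right_diff_distrib sum_subtractf)

lemma ip_scale: "ip N y (\<lambda>a b. k * q a b) = k * ip N y q"
  by (simp add: ip_def sum_distrib_left mult_ac)

lemma D_diff: "x \<in> D \<Longrightarrow> y \<in> D \<Longrightarrow> (\<lambda>a b. x a b - k * y a b) \<in> D"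
  using coefs_add[OF _ coefs_scale[of y _ _ "-k"], of x] by simp

text \<open>
  The element \<open>p\<close> with \<open>p [] [] = 1\<close> that is orthogonal, on words of length at most \<open>N\<close>, to
  \<open>{y. y [] [] = 0}\<close>. The adjoint of a multiplication is a multiplication and therefore preserves that
  kernel, so the difference \<open>d\<close> of the two sides is orthogonal to itself.
\<close>

lemma exists_invariant_upto: "\<exists>p. invariant_upto N p"
proof -
  define S where "S = case_prod ` {y\<in>D. y [] [] = 0}"
  obtain e0 where e0: "e0 \<in> D" "e0 [] [] \<noteq> 0" using nontrivial by blast
  define e where "e = (\<lambda>a b. inverse (e0 [] []) * e0 a b)"
  have e: "e \<in> D" "e [] [] = 1" using e0 coefs_scale by (auto simp: e_def)
  have "\<exists>s\<in>S. \<forall>f\<in>S. (\<Sum>x\<in>ball I N \<times> ball J N. cnj (f x) * (case_prod e x - s x)) = 0"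
  proof (rule orthogonal_decomposition)
    show "S \<noteq> {}" using coefs_0[of \<Lambda>1 \<Lambda>2] by (auto simp: S_def)
  next
    fix f g assume "f \<in> S" "g \<in> S"
    then obtain y z where "y \<in> D" "y [] [] = 0" "z \<in> D" "z [] [] = 0" "f = case_prod y" "g = case_prod z"
      by (auto simp: S_def)
    then show "(\<lambda>x. f x + g x) \<in> S"
      using coefs_add[of y \<Lambda>1 \<Lambda>2 z] unfolding S_def
      by (intro image_eqI[of _ _ "\<lambda>a b. y a b + z a b"]) auto
  next
    fix c f assume "f \<in> S"
    then obtain y where "y \<in> D" "y [] [] = 0" "f = case_prod y"
      by (auto simp: S_def)
    then show "(\<lambda>x. c * f x) \<in> S"
      using coefs_scale[of y \<Lambda>1 \<Lambda>2 c] unfolding S_def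
      by (intro image_eqI[of _ _ "\<lambda>a b. c * y a b"]) auto
  qed simp
  then obtain y where y: "y \<in> D" "y [] [] = 0"
    and perp: "\<And>z. z \<in> D \<Longrightarrow> z [] [] = 0 \<Longrightarrow>
      (\<Sum>x\<in>ball I N \<times> ball J N. cnj (case_prod z x) * (case_prod e x - case_prod y x)) = 0"
    by (auto simp: S_def)
  define p where "p = (\<lambda>a b. e a b - 1 * y a b)"
  have p: "p \<in> D" "p [] [] = 1" using D_diff[OF e(1) y(1), of 1] e y by (auto simp: p_def)
  have ort: "ip N z p = 0" if "z \<in> D" "z [] [] = 0" for z
    using perp[OF that] by (simp add: ip_def p_def sum.cartesian_product case_prod_beta)
  show ?thesis
  proof (intro exI[of _ p], unfold invariant_upto_def, intro conjI allI impI ballI p)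
    fix a :: "('v1 + 'e1) list" and b x assume a: "length a \<le> N" and x: "x \<in> coefs \<Lambda>1 \<Lambda>1"
    have ax: "adj x \<in> coefs \<Lambda>1 \<Lambda>1" using adj_in_coefs[OF x] by simp
    define d where "d = (\<lambda>a b. conv \<Lambda>1 x p a b - x [] [] * p a b)"
    have d: "d \<in> D" "d [] [] = 0"
      using D_diff[OF conv_in_coefs[OF x p(1)] p(1)] p by (auto simp: d_def)
    have "ip N d d = ip N d (conv \<Lambda>1 x p) - x [] [] * ip N d p"
      using ip_diff[of N d "conv \<Lambda>1 x p"] ip_scale[of N d] unfolding d_def by simp
    also have "\<dots> = ip N (conv \<Lambda>1 (adj x) d) p - x [] [] * ip N d p" by (simp add: ip_conv_left[OF x])
    also have "\<dots> = 0" using ort[OF conv_in_coefs[OF ax d(1)]] ort[OF d] d by simp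
    finally have "ip N d d = 0" .
    from ip_definite[OF this d(1) a, of b] show "conv \<Lambda>1 x p a b = x [] [] * p a b" by (simp add: d_def)
  next
    fix a :: "('v1 + 'e1) list" and b x assume a: "length a \<le> N" and x: "x \<in> coefs \<Lambda>2 \<Lambda>2"
    have ax: "adj x \<in> coefs \<Lambda>2 \<Lambda>2" using adj_in_coefs[OF x] by simp
    define d where "d = (\<lambda>a b. conv \<Lambda>2 p x a b - x [] [] * p a b)"
    have d: "d \<in> D" "d [] [] = 0"
      using D_diff[OF conv_in_coefs[OF p(1) x] p(1)] p by (auto simp: d_def)
    have "ip N d d = ip N d (conv \<Lambda>2 p x) - x [] [] * ip N d p"
      using ip_diff[of N d "conv \<Lambda>2 p x"] ip_scale[of N d] unfolding d_def by simp
    also have "\<dots> = ip N (conv \<Lambda>2 d (adj x)) p - x [] [] * ip N d p" by (simp add: ip_conv_right[OF x d(1) p(1)])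
    also have "\<dots> = 0" using ort[OF conv_in_coefs[OF d(1) ax]] ort[OF d] d by simp
    finally have "ip N d d = 0" .
    from ip_definite[OF this d(1) a, of b] show "conv \<Lambda>2 p x a b = x [] [] * p a b" by (simp add: d_def)
  qed
qed

text \<open>
  \<open>p = (q q\<^sup>*) p = q (q\<^sup>* p) = q\<close>: the products \<open>q q\<^sup>*\<close> and \<open>q\<^sup>* p\<close> lie over \<open>\<Lambda>1\<close> and over \<open>\<Lambda>2\<close> alone, where
  invariance applies.
\<close>

lemma invariant_upto_unique:
  assumes p: "invariant_upto N p" and q: "invariant_upto N q" and a: "length a \<le> N"
  shows "p a b = q a b"
proof -
  have m: "p \<in> D" "q \<in> D" using p q by (auto simp: invariant_upto_def)
  note m = m adj_in_coefs[OF m(2) fin]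
  have "p a b = conv \<Lambda>1 (conv \<Lambda>2 q (adj q)) p a b"
    using p q a conv_in_coefs[OF m(2,3)] by (simp add: invariant_upto_def adj_def)
  also have "\<dots> = conv \<Lambda>2 q (conv \<Lambda>1 (adj q) p) a b" by (simp add: conv_assoc)
  also have "\<dots> = q a b"
    using p q a conv_in_coefs[OF m(3,1)] by (simp add: invariant_upto_def adj_def)
  finally show ?thesis .
qed

definition haar :: "('v1 + 'e1, 'v2 + 'e2) coef" where
  "haar a b = (SOME p. invariant_upto (length a) p) a b"

lemma haar_eq:
  assumes "invariant_upto N p" "length a \<le> N"
  shows "haar a b = p a b"
proof -
  have "invariant_upto (length a) (SOME p. invariant_upto (length a) p)"
    using exists_invariant_upto by (rule someI_ex)
  moreover have "invariant_upto (length a) p"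
    using assms by (auto simp: invariant_upto_def)
  ultimately show ?thesis unfolding haar_def using invariant_upto_unique by blast
qed

lemma haar_in_D: "haar \<in> D"
proof (rule coefs_locality)
  fix N
  obtain p where p: "invariant_upto N p" using exists_invariant_upto by blast
  then show "\<exists>p\<in>D. \<forall>a b. length a \<le> N \<longrightarrow> haar a b = p a b"
    using haar_eq by (intro bexI[of _ p]) (auto simp: invariant_upto_def)
qed

lemma haar_Nil [simp]: "haar [] [] = 1"
proof -
  obtain p where p: "invariant_upto 0 p" using exists_invariant_upto by blast
  then show ?thesis using haar_eq[OF p, of "[]" "[]"] by (simp add: invariant_upto_def)
qed

lemma haar_left: "x \<in> coefs \<Lambda>1 \<Lambda>1 \<Longrightarrow> conv \<Lambda>1 x haar a b = x [] [] * haar a b"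
proof -
  assume x: "x \<in> coefs \<Lambda>1 \<Lambda>1"
  obtain p where p: "invariant_upto (length a) p" using exists_invariant_upto by blast
  have "conv \<Lambda>1 x haar a b = conv \<Lambda>1 x p a b"
    unfolding conv_apply by (intro sum.cong refl) (simp add: haar_eq[OF p] words_def)
  then show ?thesis using p x haar_eq[OF p, of a b] by (simp add: invariant_upto_def)
qed

lemma haar_right: "x \<in> coefs \<Lambda>2 \<Lambda>2 \<Longrightarrow> conv \<Lambda>2 haar x a b = x [] [] * haar a b"
proof -
  assume x: "x \<in> coefs \<Lambda>2 \<Lambda>2"
  obtain p where p: "invariant_upto (length a) p" using exists_invariant_upto by blast
  have "conv \<Lambda>2 haar x a b = conv \<Lambda>2 p x a b"
    unfolding conv_apply by (intro sum.cong refl) (simp add: haar_eq[OF p])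
  then show ?thesis using p x haar_eq[OF p, of a b] by (simp add: invariant_upto_def)
qed

lemma haar_invariant_upto: "invariant_upto N haar"
  by (simp add: invariant_upto_def haar_in_D haar_left haar_right)

text \<open>
  The functional \<open>z \<mapsto> cnj (haar (z\<^sup>*))\<close> is invariant too, so uniqueness applies.
\<close>

lemma haar_hermitian: "haar (rev a) (rev b) = cnj (haar a b)"
proof -
  have "invariant_upto (length a) (bar haar)"
    unfolding invariant_upto_def
  proof (intro conjI allI impI ballI)
    show "bar haar \<in> D" by (simp add: bar_in_coefs haar_in_D)
    show "bar haar [] [] = 1" by (simp add: bar_def)
    fix a b
    show "conv \<Lambda>1 x (bar haar) a b = x [] [] * bar haar a b" if x: "x \<in> coefs \<Lambda>1 \<Lambda>1" for x
    proof -
      have "conv \<Lambda>1 x (bar haar) a b = cnj (conv \<Lambda>1 (bar x) haar (rev a) (rev b))"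
        using fun_cong[OF fun_cong[OF bar_conv[of \<Lambda>1 "bar x" haar]], of a b] by (simp add: bar_def[of "conv _ _ _"])
      then show ?thesis using haar_left[OF bar_in_coefs[OF x]] by (simp add: bar_def)
    qed
    show "conv \<Lambda>2 (bar haar) x a b = x [] [] * bar haar a b" if x: "x \<in> coefs \<Lambda>2 \<Lambda>2" for x
    proof -
      have "conv \<Lambda>2 (bar haar) x a b = cnj (conv \<Lambda>2 haar (bar x) (rev a) (rev b))"
        using fun_cong[OF fun_cong[OF bar_conv[of \<Lambda>2 haar "bar x"]], of a b] by (simp add: bar_def[of "conv _ _ _"])
      then show ?thesis using haar_right[OF bar_in_coefs[OF x]] by (simp add: bar_def)
    qed
  qed
  from invariant_upto_unique[OF this haar_invariant_upto, of a b] show ?thesis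
    by (simp add: bar_def) (metis complex_cnj_cnj)
qed

text \<open>
  The Haar functional of \<open>\<O> \<Lambda>2 \<Lambda>2\<close>; as a block matrix it is the projection \<open>haar\<^sup>* haar\<close>.
\<close>

definition haar2 :: "('v2 + 'e2, 'v2 + 'e2) coef" where
  "haar2 = conv \<Lambda>1 (adj haar) haar"

lemma haar2_in: "haar2 \<in> coefs \<Lambda>2 \<Lambda>2"
  unfolding haar2_def by (intro conv_in_coefs adj_in_coefs haar_in_D fin)

lemma haar2_Nil [simp]: "haar2 [] [] = 1"
  by (simp add: haar2_def adj_def)

lemma conv_haar2:
  assumes "y \<in> D"
  shows "conv \<Lambda>2 y haar2 a b = y [] [] * haar a b"
proof -
  have "conv \<Lambda>2 y (adj haar) \<in> coefs \<Lambda>1 \<Lambda>1"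
    by (intro conv_in_coefs adj_in_coefs haar_in_D assms fin)
  then show ?thesis
    unfolding haar2_def conv_assoc[symmetric] by (simp add: haar_left adj_def)
qed

lemma haar2_hermitian: "haar2 b a = cnj (haar2 a b)"
proof -
  have "adj haar2 = haar2"
    unfolding haar2_def by (simp add: adj_conv[OF adj_in_coefs[OF haar_in_D fin] haar_in_D])
  then show ?thesis by (metis adj_def)
qed

lemma haar2_idem: "conv \<Lambda>2 haar2 haar2 = haar2"
proof -
  have "conv \<Lambda>2 haar haar2 = haar" by (intro ext) (simp add: conv_haar2[OF haar_in_D])
  then have "conv \<Lambda>1 (adj haar) (conv \<Lambda>2 haar haar2) = haar2" by (simp add: haar2_def)
  then show ?thesis by (metis conv_assoc haar2_def)
qed


subsection \<open>Positivity, faithfulness and the trace property\<close>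

text \<open>
  Strong invariance. In terms of the word products, \<open>conv_haar2\<close> says that the scalar \<open>haar (rev a @ c) (rev b @ d)\<close>
  is \<open>\<Sum>m n. haar2 (m @ n) (rev b @ d) p(rev a, m) p(c, n)\<close>. Multiply by \<open>p(a, b)\<close> from the left and sum over \<open>a\<close>: by
  unitarity, only \<open>m = rev b\<close> is left.
\<close>

lemma haar_slide:
  assumes x: "x \<in> D" and c: "set c \<subseteq> I" and b: "set b \<subseteq> J"
  shows "(\<Sum>a\<in>words I (length b). haar (rev a @ c) (rev b @ d) * x a b) =
    (\<Sum>n\<in>words J (length c). x c n * haar2 (rev b @ n) (rev b @ d))"
proof -
  let ?k = "length b"
  have 1: "haar (rev a @ c) (rev b @ d) * x a b =
      (\<Sum>m\<in>words J ?k. \<Sum>n\<in>words J (length c). x (a @ rev a @ c) (b @ m @ n) * haar2 (m @ n) (rev b @ d))"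
    if a: "a \<in> words I ?k" for a
  proof -
    have l: "length a = length b" using a by (simp add: words_def)
    have "conv \<Lambda>2 (shift a b [] [] x) haar2 (rev a @ c) (rev b @ d) = x a b * haar (rev a @ c) (rev b @ d)"
      using conv_haar2[OF coefs_shift[OF x l, of "[]" "[]"]] by (simp add: shift_def)
    then show ?thesis using l by (simp add: conv_apply shift_def sum_words_append mult.commute)
  qed
  have "(\<Sum>a\<in>words I ?k. haar (rev a @ c) (rev b @ d) * x a b) =
    (\<Sum>a\<in>words I ?k. \<Sum>m\<in>words J ?k. \<Sum>n\<in>words J (length c). x (a @ rev a @ c) (b @ m @ n) * haar2 (m @ n) (rev b @ d))"
    by (intro sum.cong refl 1)
  also have "\<dots> = (\<Sum>m\<in>words J ?k. \<Sum>a\<in>words I ?k. \<Sum>n\<in>words J (length c). x (a @ rev a @ c) (b @ m @ n) * haar2 (m @ n) (rev b @ d))"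
    by (rule sum.swap)
  also have "\<dots> = (\<Sum>m\<in>words J ?k. \<Sum>n\<in>words J (length c). (\<Sum>a\<in>words I ?k. x (a @ rev a @ c) (b @ m @ n)) * haar2 (m @ n) (rev b @ d))"
    unfolding sum_distrib_right by (intro sum.cong refl sum.swap)
  also have "\<dots> = (\<Sum>m\<in>words J ?k. if m = rev b then \<Sum>n\<in>words J (length c). x c n * haar2 (m @ n) (rev b @ d) else 0)"
  proof (intro sum.cong refl)
    fix m assume m: "m \<in> words J ?k"
    have "(\<Sum>a\<in>words I ?k. x (a @ rev a @ c) (b @ m @ n)) = (if m = rev b then x c n else 0)" if "n \<in> words J (length c)" for n
      using coefs_unitary_col[OF x b, of "rev m" "[]" "[]" c n] m that by (auto simp: words_def)
    then show "(\<Sum>n\<in>words J (length c). (\<Sum>a\<in>words I ?k. x (a @ rev a @ c) (b @ m @ n)) * haar2 (m @ n) (rev b @ d)) =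
      (if m = rev b then \<Sum>n\<in>words J (length c). x c n * haar2 (m @ n) (rev b @ d) else 0)"
      by simp
  qed
  also have "\<dots> = (\<Sum>n\<in>words J (length c). x c n * haar2 (rev b @ n) (rev b @ d))"
    using b by (simp add: words_def sum.delta finite_lists_length_eq)
  finally show ?thesis .
qed

text \<open>
  The value of the Haar functional at \<open>p(a, b)\<^sup>* p(c, d)\<close>. Without the guard, concatenation could match the
  letters of word pairs whose lengths differ.
\<close>

definition gram :: "('v1 + 'e1) list \<Rightarrow> ('v2 + 'e2) list \<Rightarrow> ('v1 + 'e1, 'v2 + 'e2) coef" where
  "gram a b c d = (if length a = length b then haar (rev a @ c) (rev b @ d) else 0)"

text \<open>
  For \<open>n\<close> and \<open>d\<close> of length at most \<open>N\<close>, the words \<open>b\<close> of length at most \<open>N\<close> already make this matrix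
  positive definite.
\<close>

definition density :: "nat \<Rightarrow> ('v2 + 'e2) list \<Rightarrow> ('v2 + 'e2) list \<Rightarrow> complex" where
  "density N n d = (\<Sum>b\<in>ball J N. haar2 (rev b @ n) (rev b @ d))"

lemma gram_in_D: "gram a b \<in> D"
proof (cases "length a = length b")
  case True
  then have "gram a b = shift (rev a) (rev b) [] [] haar" by (simp add: gram_def shift_def fun_eq_iff)
  then show ?thesis using coefs_shift[OF haar_in_D, of "rev a" "rev b" "[]" "[]"] True by simp
qed (simp add: gram_def[abs_def] coefs_0)

lemma gram_hermitian: "gram c d a b = cnj (gram a b c d)"
  using haar_hermitian[of "rev a @ c" "rev b @ d"] coefs_length[OF haar_in_D, of "rev a @ c" "rev b @ d"]
    coefs_length[OF haar_in_D, of "rev c @ a" "rev d @ b"]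
  by (cases "length a = length b"; cases "length c = length d") (auto simp: gram_def)

lemma gram_slide:
  assumes x: "x \<in> D" and c: "c \<in> ball I N"
  shows "(\<Sum>a\<in>ball I N. \<Sum>b\<in>ball J N. gram a b c d * x a b) = (\<Sum>n\<in>ball J N. x c n * density N n d)"
proof -
  have "(\<Sum>a\<in>ball I N. \<Sum>b\<in>ball J N. gram a b c d * x a b) = (\<Sum>b\<in>ball J N. \<Sum>a\<in>ball I N. gram a b c d * x a b)"
    by (rule sum.swap)
  also have "\<dots> = (\<Sum>b\<in>ball J N. \<Sum>n\<in>ball J N. x c n * haar2 (rev b @ n) (rev b @ d))"
  proof (intro sum.cong refl)
    fix b assume b: "b \<in> ball J N"
    have "(\<Sum>a\<in>ball I N. gram a b c d * x a b) = (\<Sum>a\<in>words I (length b). gram a b c d * x a b)"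
      using b coefs_length[OF x] by (intro sum_ball_words) (auto simp: ball_def)
    also have "\<dots> = (\<Sum>a\<in>words I (length b). haar (rev a @ c) (rev b @ d) * x a b)"
      by (intro sum.cong) (auto simp: gram_def words_def)
    also have "\<dots> = (\<Sum>n\<in>words J (length c). x c n * haar2 (rev b @ n) (rev b @ d))"
      using b c by (intro haar_slide x) (auto simp: ball_def)
    also have "\<dots> = (\<Sum>n\<in>ball J N. x c n * haar2 (rev b @ n) (rev b @ d))"
      using c coefs_length[OF x] by (intro sum_ball_words[symmetric]) (auto simp: ball_def)
    finally show "(\<Sum>a\<in>ball I N. gram a b c d * x a b) = \<dots>" .
  qed
  also have "\<dots> = (\<Sum>n\<in>ball J N. x c n * density N n d)"
    unfolding density_def sum_distrib_left by (rule sum.swap)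
  finally show ?thesis .
qed

text \<open>
  \<^const>\<open>haar2\<close> is a projection, so every summand of \<^const>\<open>density\<close> is a Gram matrix. Concatenated words
  have length at most \<open>2 * N\<close>.
\<close>

lemma density_form:
  "(\<Sum>n\<in>ball J N. \<Sum>d\<in>ball J N. cnj (u n) * density N n d * u d) =
   (\<Sum>b\<in>ball J N. \<Sum>m\<in>ball J (2 * N). cnj (\<Sum>d\<in>ball J N. haar2 m (rev b @ d) * u d) * (\<Sum>d\<in>ball J N. haar2 m (rev b @ d) * u d))"
proof -
  let ?B = "ball J N" and ?M = "ball J (2 * N)"
  have h: "haar2 (rev b @ n) \<beta> = (\<Sum>m\<in>?M. cnj (haar2 m (rev b @ n)) * haar2 m \<beta>)"
    if "b \<in> ?B" "n \<in> ?B" for b n \<beta>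
  proof -
    have "haar2 (rev b @ n) \<beta> = conv \<Lambda>2 haar2 haar2 (rev b @ n) \<beta>" by (simp add: haar2_idem)
    also have "\<dots> = (\<Sum>m\<in>?M. haar2 (rev b @ n) m * haar2 m \<beta>)"
      using that by (intro conv_ball[OF haar2_in]) (auto simp: ball_def)
    finally show ?thesis by (simp add: haar2_hermitian[of "rev b @ n"])
  qed
  have "(\<Sum>n\<in>?B. \<Sum>d\<in>?B. cnj (u n) * density N n d * u d) =
    (\<Sum>n\<in>?B. \<Sum>d\<in>?B. \<Sum>b\<in>?B. cnj (u n) * haar2 (rev b @ n) (rev b @ d) * u d)"
    by (simp add: density_def sum_distrib_left sum_distrib_right)
  also have "\<dots> = (\<Sum>n\<in>?B. \<Sum>b\<in>?B. \<Sum>d\<in>?B. cnj (u n) * haar2 (rev b @ n) (rev b @ d) * u d)"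
    by (intro sum.cong refl sum.swap)
  also have "\<dots> = (\<Sum>b\<in>?B. \<Sum>n\<in>?B. \<Sum>d\<in>?B. cnj (u n) * haar2 (rev b @ n) (rev b @ d) * u d)"
    by (rule sum.swap)
  also have "\<dots> = (\<Sum>b\<in>?B. \<Sum>n\<in>?B. \<Sum>d\<in>?B. \<Sum>m\<in>?M. cnj (haar2 m (rev b @ n) * u n) * (haar2 m (rev b @ d) * u d))"
    by (intro sum.cong refl) (simp add: h sum_distrib_left sum_distrib_right mult_ac)
  also have "\<dots> = (\<Sum>b\<in>?B. \<Sum>n\<in>?B. \<Sum>m\<in>?M. \<Sum>d\<in>?B. cnj (haar2 m (rev b @ n) * u n) * (haar2 m (rev b @ d) * u d))"
    by (intro sum.cong refl sum.swap)
  also have "\<dots> = (\<Sum>b\<in>?B. \<Sum>m\<in>?M. \<Sum>n\<in>?B. \<Sum>d\<in>?B. cnj (haar2 m (rev b @ n) * u n) * (haar2 m (rev b @ d) * u d))"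
    by (intro sum.cong refl sum.swap)
  also have "\<dots> = (\<Sum>b\<in>?B. \<Sum>m\<in>?M. cnj (\<Sum>d\<in>?B. haar2 m (rev b @ d) * u d) * (\<Sum>d\<in>?B. haar2 m (rev b @ d) * u d))"
    by (simp add: sum_product)
  finally show ?thesis .
qed

lemma density_nonneg:
  "(\<Sum>n\<in>ball J N. \<Sum>d\<in>ball J N. cnj (u n) * density N n d * u d) \<in> \<real>\<^sub>\<ge>\<^sub>0"
  unfolding density_form unfolding sum.cartesian_product case_prod_beta by (rule sum_cnj_mult_nonneg)

text \<open>
  If the form vanishes at \<open>u\<close>, all vectors \<open>haar2 (rev b \<otimes> u)\<close> vanish. Summing their
  entries at the words \<open>rev c @ c\<close> recovers \<open>u b\<close>, by unitarity.
\<close>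

lemma density_definite:
  assumes z: "(\<Sum>n\<in>ball J N. \<Sum>d\<in>ball J N. cnj (u n) * density N n d * u d) = 0" and b: "b \<in> ball J N"
  shows "u b = 0"
proof -
  let ?B = "ball J N" and ?M = "ball J (2 * N)" and ?k = "length b"
  define s where "s b m = (\<Sum>d\<in>?B. haar2 m (rev b @ d) * u d)" for b m
  have "(\<Sum>p\<in>?B \<times> ?M. cnj (case_prod s p) * case_prod s p) = 0"
    using z unfolding density_form s_def[symmetric] by (simp add: sum.cartesian_product case_prod_beta)
  then have s0: "s b m = 0" if "m \<in> ?M" for m
    using sum_cnj_mult_zero[of "?B \<times> ?M" "case_prod s" "(b, m)"] b that by simp
  have k: "?k \<le> N" "set b \<subseteq> J" using b by (auto simp: ball_def)
  have "(\<Sum>c\<in>words J ?k. s b (rev c @ c)) = 0"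
    using k by (intro sum.neutral ballI s0) (auto simp: words_def ball_def)
  also have "(\<Sum>c\<in>words J ?k. s b (rev c @ c)) = (\<Sum>d\<in>?B. (\<Sum>c\<in>words J ?k. haar2 (rev c @ c) (rev b @ d)) * u d)"
    unfolding s_def sum_distrib_right by (rule sum.swap)
  also have "\<dots> = (\<Sum>d\<in>?B. if d = b then u d else 0)"
  proof (intro sum.cong refl)
    fix d assume d: "d \<in> ?B"
    have "(\<Sum>c\<in>words J ?k. haar2 (rev c @ c) (rev b @ d)) = (if d = b then 1 else 0)"
    proof (cases "length d = ?k")
      case True
      have "(\<Sum>c\<in>words J ?k. haar2 (rev c @ c) (rev b @ d)) = (\<Sum>c\<in>words J ?k. haar2 (c @ rev c) (rev b @ d))"
        using sum_words_rev[of "\<lambda>c. haar2 (c @ rev c) (rev b @ d)"] by simp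
      then show ?thesis
        using coefs_unitary_col[OF haar2_in, of "rev b" "rev d" "[]" "[]" "[]" "[]"] True d k
        by (auto simp: ball_def)
    next
      case False
      then show ?thesis using coefs_length[OF haar2_in] by (auto simp: words_def intro!: sum.neutral)
    qed
    then show "(\<Sum>c\<in>words J ?k. haar2 (rev c @ c) (rev b @ d)) * u d = (if d = b then u d else 0)" by simp
  qed
  also have "\<dots> = u b" using b by simp
  finally show ?thesis by simp
qed

text \<open>
  A positive definite matrix is onto: the component of \<open>v\<close> orthogonal to its range is annihilated by the
  quadratic form.
\<close>

lemma density_solve: "\<exists>w. \<forall>n\<in>ball J N. v n = (\<Sum>d\<in>ball J N. w d * density N n d)"
proof -
  let ?B = "ball J N"
  define S where "S = range (\<lambda>w n. \<Sum>d\<in>?B. w d * density N n d)"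
  have "\<exists>s\<in>S. \<forall>f\<in>S. (\<Sum>x\<in>?B. cnj (f x) * (v x - s x)) = 0"
  proof (rule orthogonal_decomposition)
    fix f g assume "f \<in> S" "g \<in> S"
    then obtain w z where "f = (\<lambda>n. \<Sum>d\<in>?B. w d * density N n d)" "g = (\<lambda>n. \<Sum>d\<in>?B. z d * density N n d)"
      by (auto simp: S_def)
    then have "(\<lambda>x. f x + g x) = (\<lambda>n. \<Sum>d\<in>?B. (w d + z d) * density N n d)"
      by (simp add: sum.distrib distrib_right)
    then show "(\<lambda>x. f x + g x) \<in> S" unfolding S_def by (rule range_eqI[where x = "\<lambda>d. w d + z d"])
  next
    fix c f assume "f \<in> S"
    then obtain w where "f = (\<lambda>n. \<Sum>d\<in>?B. w d * density N n d)"
      by (auto simp: S_def)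
    then have "(\<lambda>x. c * f x) = (\<lambda>n. \<Sum>d\<in>?B. (c * w d) * density N n d)"
      by (simp add: sum_distrib_left mult.assoc)
    then show "(\<lambda>x. c * f x) \<in> S" unfolding S_def by (rule range_eqI[where x = "\<lambda>d. c * w d"])
  qed (auto simp: S_def)
  then obtain w where w: "\<And>z. (\<Sum>n\<in>?B. cnj (\<Sum>d\<in>?B. z d * density N n d) * (v n - (\<Sum>d\<in>?B. w d * density N n d))) = 0"
    by (auto simp: S_def)
  define u where "u n = v n - (\<Sum>d\<in>?B. w d * density N n d)" for n
  have herm: "cnj (density N n d) = density N d n" for n d
    by (simp add: density_def haar2_hermitian[symmetric])
  have "(\<Sum>d\<in>?B. \<Sum>n\<in>?B. cnj (u d) * density N d n * u n) = (\<Sum>n\<in>?B. \<Sum>d\<in>?B. cnj (u d) * density N d n * u n)"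
    by (rule sum.swap)
  also have "\<dots> = (\<Sum>n\<in>?B. cnj (\<Sum>d\<in>?B. u d * density N n d) * u n)"
    by (simp add: herm sum_distrib_right)
  also have "\<dots> = 0" using w[of u] by (simp add: u_def)
  finally have "u n = 0" if "n \<in> ?B" for n using density_definite that by blast
  then show ?thesis by (intro exI[of _ w]) (auto simp: u_def)
qed

text \<open>
  Write \<open>z = \<Sum>p. v p \<cdot> W p\<close> with the word products \<open>W\<close>. Solving for \<^const>\<open>density\<close> in each row replaces \<open>v\<close> by
  coefficients \<open>r\<close> of the same element \<open>z\<close> that lie in the range of the Gram matrix. Then
  \<open>cnj r\<close> is itself a coefficient function, so \<open>gram_slide\<close> can be applied to it and turns \<open>Q\<close>, the value at \<open>z\<^sup>* z\<close>,
  into the sum over the rows \<open>c\<close> of the values of the form \<^const>\<open>density\<close> at \<open>r (c, \<cdot>)\<close>.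
\<close>

lemma haar_positive:
  fixes v :: "('v1 + 'e1, 'v2 + 'e2) coef" and N :: nat
  defines "X \<equiv> ball I N \<times> ball J N"
  defines "Q \<equiv> \<Sum>p\<in>X. \<Sum>q\<in>X. cnj (case_prod v p) * case_prod v q * gram (fst p) (snd p) (fst q) (snd q)"
  shows "Q \<in> \<real>\<^sub>\<ge>\<^sub>0" and "Q = 0 \<Longrightarrow> x \<in> D \<Longrightarrow> (\<Sum>p\<in>X. case_prod v p * case_prod x p) = 0"
proof -
  let ?B = "ball I N" and ?E = "ball J N"
  define V where "V = case_prod v"
  define G where "G p q = gram (fst p) (snd p) (fst q) (snd q)" for p q
  have Gh: "cnj (G p q) = G q p" for p q by (simp add: G_def gram_hermitian[of "fst q"])
  have slide: "(\<Sum>p\<in>X. G p (c, d) * case_prod x p) = (\<Sum>n\<in>?E. x c n * density N n d)"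
    if "x \<in> D" "c \<in> ?B" for x c d
    using gram_slide[OF that, of d] by (simp add: X_def G_def sum.cartesian_product case_prod_beta)
  have "\<exists>w. \<forall>n\<in>?E. v c n = (\<Sum>d\<in>?E. w d * density N n d)" for c by (rule density_solve)
  then obtain w where w: "\<And>c n. n \<in> ?E \<Longrightarrow> v c n = (\<Sum>d\<in>?E. w c d * density N n d)" by metis
  define W where "W = case_prod w"
  define r where "r p = (\<Sum>q\<in>X. W q * G p q)" for p
  have same: "(\<Sum>p\<in>X. r p * case_prod x p) = (\<Sum>p\<in>X. V p * case_prod x p)" if x: "x \<in> D" for x
  proof -
    have "(\<Sum>p\<in>X. r p * case_prod x p) = (\<Sum>p\<in>X. \<Sum>q\<in>X. W q * (G p q * case_prod x p))"
      by (simp add: r_def sum_distrib_right mult.assoc)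
    also have "\<dots> = (\<Sum>q\<in>X. W q * (\<Sum>p\<in>X. G p q * case_prod x p))"
      unfolding sum_distrib_left by (rule sum.swap)
    also have "\<dots> = (\<Sum>c\<in>?B. \<Sum>d\<in>?E. W (c, d) * (\<Sum>p\<in>X. G p (c, d) * case_prod x p))"
      using sum_pairs[of "\<lambda>q. W q * (\<Sum>p\<in>X. G p q * case_prod x p)" ?B ?E] by (simp only: X_def)
    also have "\<dots> = (\<Sum>c\<in>?B. \<Sum>d\<in>?E. w c d * (\<Sum>n\<in>?E. x c n * density N n d))"
      by (intro sum.cong refl) (simp add: slide[OF x] W_def)
    also have "\<dots> = (\<Sum>c\<in>?B. \<Sum>n\<in>?E. (\<Sum>d\<in>?E. w c d * density N n d) * x c n)"
      unfolding sum_distrib_left sum_distrib_right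
      by (subst sum.swap[of _ ?E ?E]) (simp add: mult_ac)
    also have "\<dots> = (\<Sum>c\<in>?B. \<Sum>n\<in>?E. v c n * x c n)" using w by simp
    finally show ?thesis by (simp add: X_def V_def sum.cartesian_product case_prod_beta)
  qed
  \<comment> \<open>\<open>r\<close> and \<open>v\<close> describe the same element, so no functional tells them apart.\<close>
  have sameG: "(\<Sum>q\<in>X. r q * G p q) = (\<Sum>q\<in>X. V q * G p q)" for p
    using same[OF gram_in_D[of "fst p" "snd p"]] by (simp add: G_def case_prod_beta)
  have rD: "(\<lambda>a b. cnj (r (a, b))) \<in> D"
  proof -
    have "(\<lambda>a b. cnj (r (a, b))) = (\<lambda>a b. \<Sum>q\<in>X. cnj (W q) * gram (fst q) (snd q) a b)"
      by (intro ext) (simp add: r_def Gh, simp add: G_def)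
    moreover have "(\<lambda>a b. \<Sum>q\<in>X. cnj (W q) * gram (fst q) (snd q) a b) \<in> D"
      by (intro coefs_sum coefs_scale gram_in_D)
    ultimately show ?thesis by simp
  qed
  have "Q = (\<Sum>p\<in>X. cnj (V p) * (\<Sum>q\<in>X. V q * G p q))"
    by (simp add: Q_def V_def G_def sum_distrib_left mult.assoc)
  also have "\<dots> = (\<Sum>p\<in>X. cnj (V p) * (\<Sum>q\<in>X. r q * G p q))" by (simp add: sameG)
  also have "\<dots> = (\<Sum>q\<in>X. r q * cnj (\<Sum>p\<in>X. V p * G q p))"
    unfolding sum_distrib_left cnj_sum by (subst sum.swap) (simp add: Gh mult_ac)
  also have "\<dots> = (\<Sum>q\<in>X. r q * cnj (\<Sum>p\<in>X. r p * G q p))" by (simp add: sameG)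
  also have "\<dots> = (\<Sum>q\<in>X. r q * (\<Sum>p\<in>X. G p q * cnj (r p)))" by (simp add: Gh mult.commute)
  also have "\<dots> = (\<Sum>c\<in>?B. \<Sum>d\<in>?E. r (c, d) * (\<Sum>p\<in>X. G p (c, d) * cnj (r p)))"
    by (simp add: X_def sum.cartesian_product case_prod_beta)
  also have "\<dots> = (\<Sum>c\<in>?B. \<Sum>d\<in>?E. r (c, d) * (\<Sum>n\<in>?E. cnj (r (c, n)) * density N n d))"
    using slide[OF rD] by (intro sum.cong refl) (simp add: case_prod_beta)
  also have "\<dots> = (\<Sum>c\<in>?B. \<Sum>n\<in>?E. \<Sum>d\<in>?E. cnj (r (c, n)) * density N n d * r (c, d))"
    unfolding sum_distrib_left by (subst sum.swap[of _ ?E ?E]) (simp add: mult_ac)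
  finally have Q: "Q = (\<Sum>c\<in>?B. \<Sum>n\<in>?E. \<Sum>d\<in>?E. cnj (r (c, n)) * density N n d * r (c, d))" .
  show "Q \<in> \<real>\<^sub>\<ge>\<^sub>0" unfolding Q by (rule sum_in_nonneg_Reals) (rule density_nonneg)
  show "(\<Sum>p\<in>X. case_prod v p * case_prod x p) = 0" if "Q = 0" "x \<in> D"
  proof -
    define f where "f c = (\<Sum>n\<in>?E. \<Sum>d\<in>?E. cnj (r (c, n)) * density N n d * r (c, d))" for c
    have f: "f c \<in> \<real>\<^sub>\<ge>\<^sub>0" for c unfolding f_def by (rule density_nonneg)
    have fr: "f c = of_real (Re (f c)) \<and> Re (f c) \<ge> 0" for c
      using f[of c] by (auto simp: complex_nonneg_Reals_iff complex_eq_iff)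
    have "(\<Sum>c\<in>?B. Re (f c)) = Re Q" unfolding Q f_def by simp
    then have "(\<Sum>c\<in>?B. Re (f c)) = 0" using that(1) by simp
    then have "\<forall>c\<in>?B. Re (f c) = 0" using fr by (simp add: sum_nonneg_eq_0_iff)
    then have "f c = 0" if "c \<in> ?B" for c using fr[of c] that by simp
    then have "r (c, n) = 0" if "c \<in> ?B" "n \<in> ?E" for c n
      using density_definite[of "\<lambda>n. r (c, n)" N n] that by (simp add: f_def)
    then have "(\<Sum>p\<in>X. r p * case_prod x p) = 0" by (intro sum.neutral) (auto simp: X_def)
    then show ?thesis using same[OF that(2)] by (simp add: V_def)
  qed
qed

text \<open>
  \<open>F\<close> and \<open>F'\<close> are the finite matrices of \<open>haar (W p\<^sup>* W q)\<close> and \<open>haar (W q W p\<^sup>*)\<close>. By \<open>gram_slide\<close> and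
  unitarity, the inner products of \<open>F\<close> with itself and with \<open>F'\<close> are both the trace of \<^const>\<open>density\<close>; reversing all
  words turns \<open>F'\<close> into \<open>F\<close>, so that the norms agree. Hence \<open>F - F'\<close> has norm zero.
\<close>

lemma haar_tracial_aux:
  assumes l: "length a0 = length b0" "length c0 = length d0"
    and m: "set a0 \<subseteq> I" "set b0 \<subseteq> J" "set c0 \<subseteq> I" "set d0 \<subseteq> J"
  shows "haar (rev a0 @ c0) (rev b0 @ d0) = haar (c0 @ rev a0) (d0 @ rev b0)"
proof -
  define N where "N = length a0 + length c0"
  define swapped where "swapped a b c d = (if length a = length b then haar (c @ rev a) (d @ rev b) else 0)" for a b c d
  let ?B = "ball I N" and ?E = "ball J N"
  define X where "X = ?B \<times> ?E"
  define F where "F = (\<lambda>((a, b), (c, d)). gram a b c d)"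
  define F' where "F' = (\<lambda>((a, b), (c, d)). swapped a b c d)"
  have slide: "(\<Sum>p\<in>X. gram (fst p) (snd p) c d * y (fst p) (snd p)) = (\<Sum>n\<in>?E. y c n * density N n d)"
    if "y \<in> D" "c \<in> ?B" for y c d
    using gram_slide[OF that, of d] by (simp add: X_def sum.cartesian_product case_prod_beta)
  have key: "(\<Sum>q\<in>X. \<Sum>p\<in>X. F (p, q) * y (fst q) (snd q) (fst p) (snd p)) = (\<Sum>d\<in>?E. density N d d)"
    if yD: "\<And>c d. y c d \<in> D"
      and y1: "\<And>d n. d \<in> ?E \<Longrightarrow> n \<in> ?E \<Longrightarrow> (\<Sum>c\<in>?B. y c d c n) = (if n = d then 1 else 0)" for y
  proof -
    have "(\<Sum>q\<in>X. \<Sum>p\<in>X. F (p, q) * y (fst q) (snd q) (fst p) (snd p)) =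
        (\<Sum>c\<in>?B. \<Sum>d\<in>?E. \<Sum>p\<in>X. gram (fst p) (snd p) c d * y c d (fst p) (snd p))"
      by (simp add: X_def F_def sum_pairs)
    also have "\<dots> = (\<Sum>c\<in>?B. \<Sum>d\<in>?E. \<Sum>n\<in>?E. y c d c n * density N n d)"
      by (intro sum.cong refl slide yD)
    also have "\<dots> = (\<Sum>d\<in>?E. \<Sum>c\<in>?B. \<Sum>n\<in>?E. y c d c n * density N n d)" by (rule sum.swap)
    also have "\<dots> = (\<Sum>d\<in>?E. \<Sum>n\<in>?E. (\<Sum>c\<in>?B. y c d c n) * density N n d)"
      unfolding sum_distrib_right by (intro sum.cong refl sum.swap)
    also have "\<dots> = (\<Sum>d\<in>?E. \<Sum>n\<in>?E. if n = d then density N n d else 0)"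
      by (intro sum.cong refl) (simp add: y1)
    also have "\<dots> = (\<Sum>d\<in>?E. density N d d)" by simp
    finally show ?thesis .
  qed
  have ball_words: "(\<Sum>c\<in>?B. if length c = length d then g c else 0) = (\<Sum>c\<in>words I (length d). g c)"
    if "d \<in> ?E" for d :: "('v2 + 'e2) list" and g :: "_ \<Rightarrow> complex"
  proof -
    have "(\<Sum>c\<in>?B. if length c = length d then g c else 0) = (\<Sum>c\<in>words I (length d). if length c = length d then g c else 0)"
      using that by (intro sum_ball_words) (auto simp: ball_def)
    then show ?thesis by (simp add: words_def)
  qed
  have "(\<Sum>q\<in>X. \<Sum>p\<in>X. F (p, q) * gram (fst q) (snd q) (fst p) (snd p)) = (\<Sum>d\<in>?E. density N d d)"
  proof (rule key)
    fix d n assume d: "d \<in> ?E" "n \<in> ?E"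
    have "(\<Sum>c\<in>?B. gram c d c n) = (\<Sum>c\<in>words I (length d). haar (rev c @ c) (rev d @ n))"
      unfolding gram_def by (rule ball_words) (rule d)
    also have "\<dots> = (\<Sum>c\<in>words I (length d). haar (c @ rev c) (rev d @ n))"
      using sum_words_rev[of "\<lambda>c. haar (c @ rev c) (rev d @ n)"] by simp
    also have "\<dots> = (if n = d then 1 else 0)"
    proof (cases "length n = length d")
      case True
      then show ?thesis using coefs_unitary_col[OF haar_in_D, of "rev d" "rev n" "[]" "[]" "[]" "[]"] d
        by (auto simp: ball_def)
    next
      case False
      then show ?thesis using coefs_length[OF haar_in_D] by (auto simp: words_def intro!: sum.neutral)
    qed
    finally show "(\<Sum>c\<in>?B. gram c d c n) = (if n = d then 1 else 0)" .
  qed (rule gram_in_D)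
  moreover have "F (p, q) * gram (fst q) (snd q) (fst p) (snd p) = F (p, q) * cnj (F (p, q))" for p q
    by (simp add: F_def gram_hermitian[of "fst q"] case_prod_beta)
  ultimately have FF: "(\<Sum>q\<in>X. \<Sum>p\<in>X. F (p, q) * cnj (F (p, q))) = (\<Sum>d\<in>?E. density N d d)" by simp
  define y where "y c d = (if length c = length d then shift [] [] (rev c) (rev d) haar else (\<lambda>a b. 0))" for c d
  have "(\<Sum>q\<in>X. \<Sum>p\<in>X. F (p, q) * y (fst q) (snd q) (fst p) (snd p)) = (\<Sum>d\<in>?E. density N d d)"
  proof (rule key)
    show "y c d \<in> D" for c d
      using coefs_shift[OF haar_in_D, of "[]" "[]" "rev c" "rev d"] by (simp add: y_def coefs_0)
    fix d n assume d: "d \<in> ?E" "n \<in> ?E"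
    have "(\<Sum>c\<in>?B. y c d c n) = (\<Sum>c\<in>?B. if length c = length d then haar (c @ rev c) (n @ rev d) else 0)"
      by (intro sum.cong) (auto simp: y_def shift_def)
    also have "\<dots> = (\<Sum>c\<in>words I (length d). haar (c @ rev c) (n @ rev d))" by (rule ball_words) (rule d)
    also have "\<dots> = (if n = d then 1 else 0)"
    proof (cases "length n = length d")
      case True
      then show ?thesis using coefs_unitary_col[OF haar_in_D, of n d "[]" "[]" "[]" "[]"] d
        by (auto simp: ball_def)
    next
      case False
      then show ?thesis using coefs_length[OF haar_in_D] by (auto simp: words_def intro!: sum.neutral)
    qed
    finally show "(\<Sum>c\<in>?B. y c d c n) = (if n = d then 1 else 0)" .
  qed
  moreover have "y c d a b = cnj (swapped a b c d)" for a b c d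
  proof -
    have "haar (a @ rev c) (b @ rev d) = cnj (haar (c @ rev a) (d @ rev b))"
      using haar_hermitian[of "c @ rev a" "d @ rev b"] by simp
    then show ?thesis
      using coefs_length[OF haar_in_D, of "a @ rev c" "b @ rev d"] coefs_length[OF haar_in_D, of "c @ rev a" "d @ rev b"]
      by (cases "length a = length b"; cases "length c = length d") (auto simp: y_def swapped_def shift_def)
  qed
  then have "y (fst q) (snd q) (fst p) (snd p) = cnj (F' (p, q))" for p q
    by (simp add: F'_def case_prod_beta)
  ultimately have FF': "(\<Sum>q\<in>X. \<Sum>p\<in>X. F (p, q) * cnj (F' (p, q))) = (\<Sum>d\<in>?E. density N d d)" by simp
  have F'F': "(\<Sum>q\<in>X. \<Sum>p\<in>X. F' (p, q) * cnj (F' (p, q))) = (\<Sum>q\<in>X. \<Sum>p\<in>X. F (p, q) * cnj (F (p, q)))"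
  proof -
    define \<rho> where "\<rho> = (\<lambda>((c, d), (a, b)). ((rev a :: ('v1 + 'e1) list, rev b :: ('v2 + 'e2) list), (rev c :: ('v1 + 'e1) list, rev d :: ('v2 + 'e2) list)))"
    have FF: "F' (p, q) = F (prod.swap (\<rho> (q, p)))" for p q
    proof -
      obtain a b c d where pq: "p = (a, b)" "q = (c, d)" by (metis surj_pair)
      have "swapped a b c d = gram (rev c) (rev d) (rev a) (rev b)"
        using coefs_length[OF haar_in_D, of "c @ rev a" "d @ rev b"] by (auto simp: swapped_def gram_def)
      then show ?thesis by (simp add: pq F_def F'_def \<rho>_def)
    qed
    have "(\<Sum>s\<in>X \<times> X. F' (snd s, fst s) * cnj (F' (snd s, fst s))) = (\<Sum>s\<in>X \<times> X. F (snd s, fst s) * cnj (F (snd s, fst s)))"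
      by (rule sum.reindex_bij_witness[of _ \<rho> \<rho>])
         (auto simp: X_def \<rho>_def ball_def FF prod.swap_def)
    then show ?thesis by (simp add: sum.cartesian_product case_prod_beta)
  qed
  define s where "s = (\<Sum>d\<in>?E. density N d d)"
  have "cnj (\<Sum>q\<in>X. \<Sum>p\<in>X. F (p, q) * cnj (F (p, q))) = (\<Sum>q\<in>X. \<Sum>p\<in>X. F (p, q) * cnj (F (p, q)))"
    by (simp add: mult.commute)
  then have "cnj s = s" unfolding FF s_def[symmetric] .
  then have F'F: "(\<Sum>q\<in>X. \<Sum>p\<in>X. F' (p, q) * cnj (F (p, q))) = s"
    using arg_cong[OF FF', of cnj] unfolding s_def[symmetric] by (simp add: mult.commute)
  have "(\<Sum>q\<in>X. \<Sum>p\<in>X. cnj (F (p, q) - F' (p, q)) * (F (p, q) - F' (p, q))) =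
     (\<Sum>q\<in>X. \<Sum>p\<in>X. F (p, q) * cnj (F (p, q))) - (\<Sum>q\<in>X. \<Sum>p\<in>X. F (p, q) * cnj (F' (p, q)))
     - (\<Sum>q\<in>X. \<Sum>p\<in>X. F' (p, q) * cnj (F (p, q))) + (\<Sum>q\<in>X. \<Sum>p\<in>X. F' (p, q) * cnj (F' (p, q)))"
    by (simp add: algebra_simps sum.distrib sum_subtractf)
  also have "\<dots> = 0" using FF FF' F'F F'F' by (simp add: s_def)
  finally have z: "(\<Sum>s\<in>X \<times> X. cnj (F (snd s, fst s) - F' (snd s, fst s)) * (F (snd s, fst s) - F' (snd s, fst s))) = 0"
    by (simp add: sum.cartesian_product case_prod_beta)
  have "finite (X \<times> X)" by (simp add: X_def)
  moreover have "((c0, d0), (a0, b0)) \<in> X \<times> X" using l m by (auto simp: X_def ball_def N_def)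
  ultimately have "F ((a0, b0), (c0, d0)) - F' ((a0, b0), (c0, d0)) = 0"
    using sum_cnj_mult_zero[OF _ z] by fastforce
  then show ?thesis using l by (simp add: F_def F'_def gram_def swapped_def)
qed

lemma haar_tracial:
  assumes "length a = length b"
  shows "haar (a @ c) (b @ d) = haar (c @ a) (d @ b)"
proof (cases "length c = length d \<and> set a \<subseteq> I \<and> set b \<subseteq> J \<and> set c \<subseteq> I \<and> set d \<subseteq> J")
  case True
  then show ?thesis using haar_tracial_aux[of "rev a" "rev b" c d] assms by simp
next
  case False
  then have "\<not> matched \<Lambda>1 \<Lambda>2 (a @ c) (b @ d)" "\<not> matched \<Lambda>1 \<Lambda>2 (c @ a) (d @ b)"
    using assms matched_length[of \<Lambda>1 \<Lambda>2 "a @ c" "b @ d"] matched_length[of \<Lambda>1 \<Lambda>2 "c @ a" "d @ b"]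
    by (auto simp: matched_def)
  then show ?thesis using coefs_support[OF haar_in_D] by simp
qed

end


section \<open>Quotients of monoid algebras\<close>

subsection \<open>Linear extension of functions on a basis\<close>

abbreviation scale :: "complex \<Rightarrow> ('x \<Rightarrow>\<^sub>0 complex) \<Rightarrow> 'x \<Rightarrow>\<^sub>0 complex" where
  "scale c \<equiv> Poly_Mapping.map ((*) c)"

text \<open>
  The linear functional with prescribed values on the basis. As the values \<open>ev \<phi> f\<close> for all \<open>\<phi>\<close> determine \<open>f\<close>
  (lemma \<open>ev_eqI\<close> below), identities in a monoid algebra reduce to identities between iterated sums.
\<close>

definition ev :: "('x \<Rightarrow> complex) \<Rightarrow> ('x \<Rightarrow>\<^sub>0 complex) \<Rightarrow> complex" where
  "ev \<phi> f = (\<Sum>x\<in>Poly_Mapping.keys f. Poly_Mapping.lookup f x * \<phi> x)"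

lemma lookup_scale [simp]: "Poly_Mapping.lookup (scale c f) x = c * Poly_Mapping.lookup f x"
  by (simp add: map.rep_eq when_def)

lemma keys_scale: "Poly_Mapping.keys (scale c f) \<subseteq> Poly_Mapping.keys f"
  by (auto simp: in_keys_iff)

lemma ev_superset:
  assumes "finite A" "Poly_Mapping.keys f \<subseteq> A"
  shows "ev \<phi> f = (\<Sum>x\<in>A. Poly_Mapping.lookup f x * \<phi> x)"
  unfolding ev_def by (rule sum.mono_neutral_left) (use assms in \<open>auto simp: in_keys_iff\<close>)

lemma ev_0 [simp]: "ev \<phi> 0 = 0"
  by (simp add: ev_def)

lemma ev_add [simp]: "ev \<phi> (f + g) = ev \<phi> f + ev \<phi> g"
proof -
  let ?A = "Poly_Mapping.keys f \<union> Poly_Mapping.keys g"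
  have "ev \<phi> (f + g) = (\<Sum>x\<in>?A. Poly_Mapping.lookup (f + g) x * \<phi> x)"
    using keys_add[of f g] by (intro ev_superset) auto
  also have "\<dots> = (\<Sum>x\<in>?A. Poly_Mapping.lookup f x * \<phi> x) + (\<Sum>x\<in>?A. Poly_Mapping.lookup g x * \<phi> x)"
    by (simp add: lookup_add distrib_right sum.distrib)
  also have "\<dots> = ev \<phi> f + ev \<phi> g"
    using ev_superset[of ?A f \<phi>] ev_superset[of ?A g \<phi>] by simp
  finally show ?thesis .
qed

lemma ev_scale [simp]: "ev \<phi> (scale c f) = c * ev \<phi> f"
  using ev_superset[OF finite_keys keys_scale, of \<phi> c f] by (simp add: ev_def sum_distrib_left mult.assoc)

lemma ev_uminus [simp]: "ev \<phi> (- f) = - ev \<phi> f"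
  using ev_add[of \<phi> f "- f"] by (simp add: eq_neg_iff_add_eq_0 add.commute del: ev_add)

lemma ev_diff [simp]: "ev \<phi> (f - g) = ev \<phi> f - ev \<phi> g"
  using ev_add[of \<phi> f "- g"] by simp

lemma ev_single [simp]: "ev \<phi> (Poly_Mapping.single x c) = c * \<phi> x"
  by (simp add: ev_def)

lemma ev_sum [simp]: "ev \<phi> (sum g A) = (\<Sum>s\<in>A. ev \<phi> (g s))"
  by (induction A rule: infinite_finite_induct) auto

lemma ev_cong:
  "f = g \<Longrightarrow> (\<And>x. x \<in> Poly_Mapping.keys g \<Longrightarrow> \<phi> x = \<psi> x) \<Longrightarrow> ev \<phi> f = ev \<psi> g"
  by (simp add: ev_def)

lemma ev_fun_sum: "ev (\<lambda>x. \<Sum>s\<in>A. \<phi> s x) f = (\<Sum>s\<in>A. ev (\<phi> s) f)"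
  unfolding ev_def sum_distrib_left by (rule sum.swap)

lemma ev_fun_scale: "ev (\<lambda>x. c * \<phi> x) f = c * ev \<phi> f"
  by (simp add: ev_def sum_distrib_left mult.left_commute)

lemma ev_fun_add: "ev (\<lambda>x. \<phi> x + \<psi> x) f = ev \<phi> f + ev \<psi> f"
  by (simp add: ev_def sum.distrib distrib_left)

lemma ev_swap: "ev (\<lambda>x. ev (\<lambda>y. \<phi> x y) g) f = ev (\<lambda>y. ev (\<lambda>x. \<phi> x y) f) g"
  unfolding ev_def sum_distrib_left by (subst sum.swap) (simp add: mult.left_commute)

lemma ev_delta: "ev (\<lambda>x. if x = y then 1 else 0) f = Poly_Mapping.lookup f y"
  by (simp add: ev_def in_keys_iff if_distrib cong: if_cong)

lemma ev_eqI: "(\<And>\<phi>. ev \<phi> f = ev \<phi> g) \<Longrightarrow> f = g"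
  by (rule poly_mapping_eqI) (metis ev_delta)

lemma sum_scale_single: "(\<Sum>x\<in>Poly_Mapping.keys f. scale (Poly_Mapping.lookup f x) (Poly_Mapping.single x 1)) = f"
  by (rule ev_eqI) (simp add: ev_def[of _ f])

definition lin_ext :: "('x \<Rightarrow> ('y \<Rightarrow>\<^sub>0 complex)) \<Rightarrow> ('x \<Rightarrow>\<^sub>0 complex) \<Rightarrow> 'y \<Rightarrow>\<^sub>0 complex" where
  "lin_ext h f = (\<Sum>x\<in>Poly_Mapping.keys f. scale (Poly_Mapping.lookup f x) (h x))"

lemma ev_lin_ext [simp]: "ev \<phi> (lin_ext h f) = ev (\<lambda>x. ev \<phi> (h x)) f"
  by (simp add: lin_ext_def ev_def[of _ f])

lemma lin_ext_add: "lin_ext h (f + g) = lin_ext h f + lin_ext h g"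
  and lin_ext_scale: "lin_ext h (scale c f) = scale c (lin_ext h f)"
  and lin_ext_diff: "lin_ext h (f - g) = lin_ext h f - lin_ext h g"
  and lin_ext_single: "lin_ext h (Poly_Mapping.single x 1) = h x"
  by (rule ev_eqI; simp)+

lemma keys_lin_ext: "(\<And>x. x \<in> Poly_Mapping.keys f \<Longrightarrow> Poly_Mapping.keys (h x) \<subseteq> A) \<Longrightarrow> Poly_Mapping.keys (lin_ext h f) \<subseteq> A"
  unfolding lin_ext_def using keys_sum keys_scale by fastforce

lemma vector_space_scale: "vector_space (scale :: complex \<Rightarrow> ('x \<Rightarrow>\<^sub>0 complex) \<Rightarrow> _)"
  by unfold_locales (rule ev_eqI, simp add: algebra_simps)+

text \<open>
  Linearity is required only on functions supported in \<open>A\<close>, since functionals of interest make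
  sense only on the carrier of an algebra.
\<close>

lemma linear_eq_ev:
  assumes add: "\<And>f g. Poly_Mapping.keys f \<subseteq> A \<Longrightarrow> Poly_Mapping.keys g \<subseteq> A \<Longrightarrow> L (f + g) = L f + L g"
    and sc: "\<And>c f. Poly_Mapping.keys f \<subseteq> A \<Longrightarrow> L (scale c f) = c * L f"
    and f: "Poly_Mapping.keys f \<subseteq> A"
  shows "L f = ev (\<lambda>x. L (Poly_Mapping.single x 1)) f"
proof -
  have L0: "L 0 = 0" using sc[of 0 0] ev_eqI[of "scale 0 (0 :: 'a \<Rightarrow>\<^sub>0 complex)" 0] by simp
  have "L (\<Sum>x\<in>K. scale (Poly_Mapping.lookup f x) (Poly_Mapping.single x 1)) =
    (\<Sum>x\<in>K. Poly_Mapping.lookup f x * L (Poly_Mapping.single x 1))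
    \<and> Poly_Mapping.keys (\<Sum>x\<in>K. scale (Poly_Mapping.lookup f x) (Poly_Mapping.single x 1)) \<subseteq> A"
    if "finite K" "K \<subseteq> A" for K
    using that
  proof (induction K rule: finite_induct)
    case empty
    then show ?case using L0 by simp
  next
    case (insert k K)
    have k: "Poly_Mapping.keys (Poly_Mapping.single k (1::complex)) \<subseteq> A" using insert by simp
    have k': "Poly_Mapping.keys (scale (Poly_Mapping.lookup f k) (Poly_Mapping.single k 1)) \<subseteq> A"
      using k keys_scale by (rule subset_trans[rotated])
    let ?s = "scale (Poly_Mapping.lookup f k) (Poly_Mapping.single k 1)"
    let ?t = "\<Sum>x\<in>K. scale (Poly_Mapping.lookup f x) (Poly_Mapping.single x 1)"
    have t: "L ?t = (\<Sum>x\<in>K. Poly_Mapping.lookup f x * L (Poly_Mapping.single x 1))"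
      "Poly_Mapping.keys ?t \<subseteq> A"
      using insert by blast+
    have "Poly_Mapping.keys (?s + ?t) \<subseteq> A" using keys_add[of ?s ?t] k' t(2) by blast
    moreover have "L (?s + ?t) = L ?s + L ?t" by (rule add[OF k' t(2)])
    ultimately show ?case using insert.hyps t(1) sc[OF k, of "Poly_Mapping.lookup f k"]
      by (simp del: map_single)
  qed
  from this[OF finite_keys f] show ?thesis unfolding sum_scale_single ev_def by blast
qed

text \<open>
  Extend a basis of \<open>U\<close> by \<open>z\<close>, and take the functional that is one at \<open>z\<close> and zero on the basis of \<open>U\<close>.
\<close>

lemma separate_from_subspace:
  fixes z :: "'x \<Rightarrow>\<^sub>0 complex"
  assumes "0 \<in> U" "\<And>f g. f \<in> U \<Longrightarrow> g \<in> U \<Longrightarrow> f + g \<in> U" "\<And>c f. f \<in> U \<Longrightarrow> scale c f \<in> U"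
    and z: "z \<notin> U"
  shows "\<exists>\<phi>. (\<forall>f\<in>U. ev \<phi> f = 0) \<and> ev \<phi> z \<noteq> 0"
proof -
  interpret P: vector_space "scale :: complex \<Rightarrow> ('x \<Rightarrow>\<^sub>0 complex) \<Rightarrow> _" by (rule vector_space_scale)
  interpret C: vector_space "(*) :: complex \<Rightarrow> complex \<Rightarrow> complex" by unfold_locales (auto simp: algebra_simps)
  interpret PC: vector_space_pair "scale :: complex \<Rightarrow> ('x \<Rightarrow>\<^sub>0 complex) \<Rightarrow> _" "(*) :: complex \<Rightarrow> complex \<Rightarrow> complex"
    by unfold_locales
  obtain B where B: "B \<subseteq> U" "P.independent B" "U \<subseteq> P.span B" using P.maximal_independent_subset[of U] by blast
  have "P.subspace U" using assms(1-3) by (simp add: P.subspace_def)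
  then have "P.span B \<subseteq> U" using B(1) by (rule P.span_minimal[rotated])
  then have "z \<notin> P.span B" using z by blast
  then have "P.independent (insert z B)" using B(2) by (rule P.independent_insertI)
  then obtain g where g: "Vector_Spaces.linear scale (*) g" "\<forall>x\<in>insert z B. g x = (if x = z then 1 else 0 :: complex)"
    using PC.linear_independent_extend[of "insert z B" "\<lambda>x. if x = z then 1 else 0"] by blast
  have zB: "z \<notin> B" using B(1) z by blast
  have gB: "g x = 0" if "x \<in> B" for x
    using g(2) zB that by (cases "x = z") simp_all
  have g0: "g f = 0" if "f \<in> U" for f
    using PC.linear_eq_0_on_span[OF g(1), of B f] gB B(3) that by blast
  interpret L: Vector_Spaces.linear scale "(*)" g by (rule g(1))
  have ge: "g f = ev (\<lambda>x. g (Poly_Mapping.single x 1)) f" for f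
    by (rule linear_eq_ev[of UNIV]) (auto simp: L.add L.scale)
  have "(\<forall>f\<in>U. ev (\<lambda>x. g (Poly_Mapping.single x 1)) f = 0) \<and> ev (\<lambda>x. g (Poly_Mapping.single x 1)) z \<noteq> 0"
    using g0 g(2) by (simp flip: ge)
  then show ?thesis by blast
qed


subsection \<open>Monoid algebras are rings\<close>

locale inv_monoid = monoid M for M :: "('x, 'm) monoid_scheme" (structure) +
  fixes \<iota> :: "'x \<Rightarrow> 'x"
  assumes inv_closed [simp]: "x \<in> carrier M \<Longrightarrow> \<iota> x \<in> carrier M"
    and inv_mult: "x \<in> carrier M \<Longrightarrow> y \<in> carrier M \<Longrightarrow> \<iota> (x \<otimes> y) = \<iota> y \<otimes> \<iota> x"
    and inv_inv [simp]: "x \<in> carrier M \<Longrightarrow> \<iota> (\<iota> x) = x"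
begin

abbreviation "R \<equiv> monoid_algebra M \<iota>"

lemma inv_one [simp]: "\<iota> \<one> = \<one>"
  by (metis inv_closed inv_inv inv_mult l_one one_closed r_one)

lemma R_carrier: "f \<in> carrier R \<longleftrightarrow> Poly_Mapping.keys f \<subseteq> carrier M"
  and R_add: "f \<oplus>\<^bsub>R\<^esub> g = f + g"
  and R_zero: "\<zero>\<^bsub>R\<^esub> = 0"
  and R_one: "\<one>\<^bsub>R\<^esub> = Poly_Mapping.single \<one> 1"
  and R_smult: "c \<odot>\<^bsub>R\<^esub> f = scale c f"
  by (simp_all add: monoid_algebra_def)

lemma R_key: "f \<in> carrier R \<Longrightarrow> x \<in> Poly_Mapping.keys f \<Longrightarrow> x \<in> carrier M"
  by (auto simp: R_carrier)

lemma ev_mult: "ev \<phi> (f \<otimes>\<^bsub>R\<^esub> g) = ev (\<lambda>x. ev (\<lambda>y. \<phi> (x \<otimes> y)) g) f"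
  by (simp add: monoid_algebra_def, simp add: ev_def[of _ f] ev_def[of _ g] sum_distrib_left mult.assoc)

lemma ev_star: "ev \<phi> (star R f) = cnj (ev (\<lambda>x. cnj (\<phi> (\<iota> x))) f)"
  by (simp add: monoid_algebra_def, simp add: ev_def)

lemma single_closed [simp]: "x \<in> carrier M \<Longrightarrow> Poly_Mapping.single x c \<in> carrier R"
  by (simp add: R_carrier)

lemma R_add_closed [simp]: "f \<in> carrier R \<Longrightarrow> g \<in> carrier R \<Longrightarrow> f + g \<in> carrier R"
  using keys_add[of f g] by (auto simp: R_carrier)

lemma R_zero_closed [simp]: "0 \<in> carrier R"
  by (simp add: R_carrier)

lemma R_uminus_closed [simp]: "f \<in> carrier R \<Longrightarrow> - f \<in> carrier R"
  by (simp add: R_carrier)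

lemma R_diff_closed [simp]: "f \<in> carrier R \<Longrightarrow> g \<in> carrier R \<Longrightarrow> f - g \<in> carrier R"
  using R_add_closed[of f "- g"] by simp

lemma R_scale_closed [simp]: "f \<in> carrier R \<Longrightarrow> scale c f \<in> carrier R"
  using keys_scale[of c f] by (auto simp: R_carrier)

lemma R_sum_closed [simp]: "(\<And>s. s \<in> A \<Longrightarrow> g s \<in> carrier R) \<Longrightarrow> sum g A \<in> carrier R"
  by (induction A rule: infinite_finite_induct) auto

lemma R_mult_closed [simp]: "f \<in> carrier R \<Longrightarrow> g \<in> carrier R \<Longrightarrow> f \<otimes>\<^bsub>R\<^esub> g \<in> carrier R"
  unfolding monoid_algebra_def[of M \<iota>] monoid.simps
  by (fold monoid_algebra_def[of M \<iota>]) (auto intro!: R_sum_closed single_closed dest: R_key)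

lemma R_star_closed [simp]: "f \<in> carrier R \<Longrightarrow> star R f \<in> carrier R"
proof -
  assume f: "f \<in> carrier R"
  have "star R f = (\<Sum>x\<in>Poly_Mapping.keys f. Poly_Mapping.single (\<iota> x) (cnj (Poly_Mapping.lookup f x)))"
    by (simp add: monoid_algebra_def)
  also have "\<dots> \<in> carrier R" using f by (auto intro!: R_sum_closed dest: R_key)
  finally show ?thesis .
qed

lemma single_mult: "Poly_Mapping.single x c \<otimes>\<^bsub>R\<^esub> Poly_Mapping.single y d = Poly_Mapping.single (x \<otimes> y) (c * d)"
  by (rule ev_eqI) (simp add: ev_mult)

lemma single_star: "star R (Poly_Mapping.single x c) = Poly_Mapping.single (\<iota> x) (cnj c)"
  by (rule ev_eqI) (simp add: ev_star)

lemma R_assoc: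
  assumes "f \<in> carrier R" "g \<in> carrier R" "h \<in> carrier R"
  shows "(f \<otimes>\<^bsub>R\<^esub> g) \<otimes>\<^bsub>R\<^esub> h = f \<otimes>\<^bsub>R\<^esub> (g \<otimes>\<^bsub>R\<^esub> h)"
  by (rule ev_eqI) (auto simp: ev_mult m_assoc R_key[OF assms(1)] R_key[OF assms(2)] R_key[OF assms(3)] intro!: ev_cong)

lemma R_l_one: "f \<in> carrier R \<Longrightarrow> \<one>\<^bsub>R\<^esub> \<otimes>\<^bsub>R\<^esub> f = f"
  by (rule ev_eqI) (auto simp: ev_mult R_one R_key intro!: ev_cong)

lemma R_r_one: "f \<in> carrier R \<Longrightarrow> f \<otimes>\<^bsub>R\<^esub> \<one>\<^bsub>R\<^esub> = f"
  by (rule ev_eqI) (auto simp: ev_mult R_one R_key intro!: ev_cong)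

lemma mult_add_left: "(f + g) \<otimes>\<^bsub>R\<^esub> h = f \<otimes>\<^bsub>R\<^esub> h + g \<otimes>\<^bsub>R\<^esub> h"
  by (rule ev_eqI) (simp add: ev_mult)

lemma mult_add_right: "h \<otimes>\<^bsub>R\<^esub> (f + g) = h \<otimes>\<^bsub>R\<^esub> f + h \<otimes>\<^bsub>R\<^esub> g"
  by (rule ev_eqI) (simp add: ev_mult ev_fun_add)

lemma mult_scale_left: "scale c f \<otimes>\<^bsub>R\<^esub> g = scale c (f \<otimes>\<^bsub>R\<^esub> g)"
  by (rule ev_eqI) (simp add: ev_mult)

lemma mult_scale_right: "f \<otimes>\<^bsub>R\<^esub> scale c g = scale c (f \<otimes>\<^bsub>R\<^esub> g)"
  by (rule ev_eqI) (simp add: ev_mult ev_fun_scale)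

lemma star_add: "star R (f + g) = star R f + star R g"
  by (rule ev_eqI) (simp add: ev_star)

lemma star_scale: "star R (scale c f) = scale (cnj c) (star R f)"
  by (rule ev_eqI) (simp add: ev_star)

lemma mult_diff_left: "(f - g) \<otimes>\<^bsub>R\<^esub> k = f \<otimes>\<^bsub>R\<^esub> k - g \<otimes>\<^bsub>R\<^esub> k"
  by (rule ev_eqI) (simp add: ev_mult)

lemma star_diff: "star R (f - g) = star R f - star R g"
  by (rule ev_eqI) (simp add: ev_star)

lemma star_mult:
  assumes "f \<in> carrier R" "g \<in> carrier R"
  shows "star R (f \<otimes>\<^bsub>R\<^esub> g) = star R g \<otimes>\<^bsub>R\<^esub> star R f"
proof (rule ev_eqI)
  fix \<phi>
  have "ev \<phi> (star R g \<otimes>\<^bsub>R\<^esub> star R f) = cnj (ev (\<lambda>x. ev (\<lambda>y. cnj (\<phi> (\<iota> x \<otimes> \<iota> y))) f) g)"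
    by (simp add: ev_mult ev_star)
  also have "\<dots> = cnj (ev (\<lambda>y. ev (\<lambda>x. cnj (\<phi> (\<iota> x \<otimes> \<iota> y))) g) f)" by (subst ev_swap) (rule refl)
  also have "\<dots> = ev \<phi> (star R (f \<otimes>\<^bsub>R\<^esub> g))"
    by (auto simp: ev_mult ev_star inv_mult R_key[OF assms(1)] R_key[OF assms(2)] intro!: ev_cong)
  finally show "ev \<phi> (star R (f \<otimes>\<^bsub>R\<^esub> g)) = ev \<phi> (star R g \<otimes>\<^bsub>R\<^esub> star R f)" by simp
qed

lemma star_star: "f \<in> carrier R \<Longrightarrow> star R (star R f) = f"
  by (rule ev_eqI) (auto simp: ev_star R_key intro!: ev_cong)

lemma star_one: "star R \<one>\<^bsub>R\<^esub> = \<one>\<^bsub>R\<^esub>"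
  by (simp add: R_one single_star)

lemma ring_R: "ring R"
proof (rule ringI)
  show "abelian_group R"
    by (rule abelian_groupI) (auto simp: R_add R_zero algebra_simps intro!: bexI[of _ "- _"])
  show "monoid R"
    by (rule monoidI) (auto simp: R_assoc R_l_one R_r_one, simp add: R_one)
qed (auto simp: R_add mult_add_left mult_add_right)

lemma R_minus: "f \<in> carrier R \<Longrightarrow> g \<in> carrier R \<Longrightarrow> f \<ominus>\<^bsub>R\<^esub> g = f - g"
proof -
  assume fg: "f \<in> carrier R" "g \<in> carrier R"
  interpret ring R by (rule ring_R)
  have "\<ominus>\<^bsub>R\<^esub> g = - g" by (rule minus_equality) (use fg in \<open>auto simp: R_add R_zero\<close>)
  then show ?thesis by (simp add: a_minus_def R_add)
qed

lemma R_finsum: "finite A \<Longrightarrow> (\<And>s. s \<in> A \<Longrightarrow> g s \<in> carrier R) \<Longrightarrow> finsum R g A = sum g A"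
proof (induction A rule: finite_induct)
  case empty
  interpret ring R by (rule ring_R)
  show ?case by (simp add: R_zero)
next
  case (insert a A)
  interpret ring R by (rule ring_R)
  show ?case using insert by (subst finsum_insert) (auto simp: R_add)
qed

lemma uminus_mult_left: "(- f) \<otimes>\<^bsub>R\<^esub> g = - (f \<otimes>\<^bsub>R\<^esub> g)"
  by (rule ev_eqI) (simp add: ev_mult)

lemma one_closed' [simp]: "\<one>\<^bsub>R\<^esub> \<in> carrier R"
  by (simp add: R_one)

end


subsection \<open>Representatives of elements of the quotient\<close>

locale star_presentation = inv_monoid M \<iota> for M :: "('x, 'm) monoid_scheme" (structure) and \<iota> +
  fixes S :: "('x \<Rightarrow>\<^sub>0 complex) set"
  assumes rels: "S \<subseteq> carrier R"
begin

abbreviation "Q \<equiv> star_quotient R S"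
abbreviation "I \<equiv> star_ideal R S"
abbreviation "cl z \<equiv> I +>\<^bsub>R\<^esub> z"

lemma gens_closed: "S \<union> star R ` S \<subseteq> carrier R"
  using rels by auto

lemma ideal_I: "ideal I R"
  unfolding star_ideal_def by (rule ring.genideal_ideal[OF ring_R gens_closed])

lemma I_closed: "z \<in> I \<Longrightarrow> z \<in> carrier R"
  using ideal.Icarr[OF ideal_I] .

lemma S_in_I: "r \<in> S \<Longrightarrow> r \<in> I"
  using ring.genideal_self[OF ring_R gens_closed] by (auto simp: star_ideal_def)

lemma I_add: "z \<in> I \<Longrightarrow> w \<in> I \<Longrightarrow> z + w \<in> I"
  using additive_subgroup.a_closed[OF ideal.axioms(1)[OF ideal_I]] by (simp add: R_add)

lemma I_zero: "0 \<in> I"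
  using additive_subgroup.zero_closed[OF ideal.axioms(1)[OF ideal_I]] by (simp add: R_zero)

lemma I_mult_left: "z \<in> I \<Longrightarrow> f \<in> carrier R \<Longrightarrow> f \<otimes>\<^bsub>R\<^esub> z \<in> I"
  and I_mult_right: "z \<in> I \<Longrightarrow> f \<in> carrier R \<Longrightarrow> z \<otimes>\<^bsub>R\<^esub> f \<in> I"
  using ideal.I_l_closed[OF ideal_I] ideal.I_r_closed[OF ideal_I] by auto

lemma I_scale: "z \<in> I \<Longrightarrow> scale c z \<in> I"
  using I_mult_left[of z "scale c \<one>\<^bsub>R\<^esub>"] by (simp add: mult_scale_left R_l_one I_closed)

lemma I_uminus: "z \<in> I \<Longrightarrow> - z \<in> I"
  using I_mult_left[of z "- \<one>\<^bsub>R\<^esub>"] by (simp add: uminus_mult_left R_l_one I_closed)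

lemma I_diff: "z \<in> I \<Longrightarrow> w \<in> I \<Longrightarrow> z - w \<in> I"
  using I_add[of z "- w"] I_uminus[of w] by simp

lemma ideal_criterion:
  assumes "K \<subseteq> carrier R" "S \<subseteq> K" "star R ` S \<subseteq> K" "0 \<in> K"
    and "\<And>f g. f \<in> K \<Longrightarrow> g \<in> K \<Longrightarrow> f + g \<in> K" "\<And>f. f \<in> K \<Longrightarrow> - f \<in> K"
    and "\<And>f g. f \<in> K \<Longrightarrow> g \<in> carrier R \<Longrightarrow> f \<otimes>\<^bsub>R\<^esub> g \<in> K"
    and "\<And>f g. f \<in> K \<Longrightarrow> g \<in> carrier R \<Longrightarrow> g \<otimes>\<^bsub>R\<^esub> f \<in> K"
  shows "I \<subseteq> K"
proof -
  interpret ring R by (rule ring_R)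
  have m: "\<ominus>\<^bsub>R\<^esub> f = - f" if "f \<in> carrier R" for f
    by (rule minus_equality) (use that in \<open>auto simp: R_add R_zero\<close>)
  have "ideal K R"
  proof (rule idealI)
    show "subgroup K (add_monoid R)"
      by (rule group.subgroupI[OF a_group])
        (use assms m in \<open>auto simp: R_add subset_iff simp flip: a_inv_def\<close>)
  qed (use assms ring_R in auto)
  then show ?thesis unfolding star_ideal_def using assms(2,3) by (intro genideal_minimal) auto
qed

lemma I_star: "z \<in> I \<Longrightarrow> star R z \<in> I"
proof -
  have "I \<subseteq> {z \<in> carrier R. star R z \<in> I}"
  proof (rule ideal_criterion)
    show "star R ` S \<subseteq> {z \<in> carrier R. star R z \<in> I}"
      using rels S_in_I by (auto simp: star_star subset_iff)
    show "S \<subseteq> {z \<in> carrier R. star R z \<in> I}"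
      using rels ring.genideal_self[OF ring_R gens_closed] by (auto simp: star_ideal_def)
    have "star R 0 = 0" by (rule ev_eqI) (simp add: ev_star)
    then show "0 \<in> {z \<in> carrier R. star R z \<in> I}" by (simp add: I_zero)
    have "star R (- f) = - star R f" for f by (rule ev_eqI) (simp add: ev_star)
    then show "- f \<in> {z \<in> carrier R. star R z \<in> I}" if "f \<in> {z \<in> carrier R. star R z \<in> I}" for f
      using that by (simp add: I_uminus)
  qed (auto simp: star_add star_mult I_add I_mult_left I_mult_right)
  then show "z \<in> I \<Longrightarrow> star R z \<in> I" by blast
qed

text \<open>
  A family of functionals that is stable under translations and under the involution vanishes on the
  generated *-ideal as soon as it vanishes on the relations: its common kernel is a *-ideal.
\<close>

lemma null_family:
  assumes S: "\<And>\<phi> r. \<phi> \<in> \<F> \<Longrightarrow> r \<in> S \<Longrightarrow> ev \<phi> r = 0"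
    and left: "\<And>\<phi> x. \<phi> \<in> \<F> \<Longrightarrow> x \<in> carrier M \<Longrightarrow> (\<lambda>y. \<phi> (x \<otimes> y)) \<in> \<F>"
    and right: "\<And>\<phi> x. \<phi> \<in> \<F> \<Longrightarrow> x \<in> carrier M \<Longrightarrow> (\<lambda>y. \<phi> (y \<otimes> x)) \<in> \<F>"
    and inv: "\<And>\<phi>. \<phi> \<in> \<F> \<Longrightarrow> (\<lambda>x. cnj (\<phi> (\<iota> x))) \<in> \<F>"
    and z: "z \<in> I" and \<phi>: "\<phi> \<in> \<F>"
  shows "ev \<phi> z = 0"
proof -
  have "I \<subseteq> {z \<in> carrier R. \<forall>\<phi>\<in>\<F>. ev \<phi> z = 0}"
  proof (rule ideal_criterion)
    show "f \<otimes>\<^bsub>R\<^esub> g \<in> {z \<in> carrier R. \<forall>\<phi>\<in>\<F>. ev \<phi> z = 0}"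
      if f: "f \<in> {z \<in> carrier R. \<forall>\<phi>\<in>\<F>. ev \<phi> z = 0}" and g: "g \<in> carrier R" for f g
    proof -
      have "ev \<phi> (f \<otimes>\<^bsub>R\<^esub> g) = ev (\<lambda>y. ev (\<lambda>x. \<phi> (x \<otimes> y)) f) g" for \<phi>
        unfolding ev_mult by (rule ev_swap)
      moreover have "ev (\<lambda>y. ev (\<lambda>x. \<phi> (x \<otimes> y)) f) g = ev (\<lambda>y. 0) g" if "\<phi> \<in> \<F>" for \<phi>
        using f right[OF that R_key[OF g]] by (intro ev_cong) auto
      ultimately show ?thesis using f g by (simp add: ev_def[of "\<lambda>y. 0"])
    qed
    show "g \<otimes>\<^bsub>R\<^esub> f \<in> {z \<in> carrier R. \<forall>\<phi>\<in>\<F>. ev \<phi> z = 0}"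
      if f: "f \<in> {z \<in> carrier R. \<forall>\<phi>\<in>\<F>. ev \<phi> z = 0}" and g: "g \<in> carrier R" for f g
    proof -
      have "ev (\<lambda>x. ev (\<lambda>y. \<phi> (x \<otimes> y)) f) g = ev (\<lambda>y. 0) g" if "\<phi> \<in> \<F>" for \<phi>
        using f left[OF that R_key[OF g]] by (intro ev_cong) auto
      then show ?thesis using f g by (simp add: ev_mult ev_def[of "\<lambda>y. 0"])
    qed
  qed (use rels S inv in \<open>auto simp: ev_star\<close>)
  then show ?thesis using z \<phi> by blast
qed

lemma separation:
  assumes "z \<in> carrier R" "z \<notin> I"
  shows "\<exists>\<phi>. (\<forall>f\<in>I. ev \<phi> f = 0) \<and> ev \<phi> z \<noteq> 0"
  using assms by (intro separate_from_subspace) (auto intro: I_zero I_add I_scale)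

lemma cl_def': "cl z = (\<lambda>i. i + z) ` I"
  by (auto simp: a_r_coset_def r_coset_def R_add)

lemma cl_self: "z \<in> cl z"
  unfolding cl_def' by (rule image_eqI[of _ _ 0]) (simp_all add: I_zero)

lemma cl_eq_iff: "cl z = cl w \<longleftrightarrow> z - w \<in> I"
proof
  assume "cl z = cl w"
  then have "0 + z \<in> cl w" unfolding cl_def' using I_zero by blast
  then show "z - w \<in> I" by (auto simp: cl_def')
next
  assume a: "z - w \<in> I"
  have "i + z = (i + (z - w)) + w" "i + w = (i - (z - w)) + z" for i by simp_all
  then show "cl z = cl w" unfolding cl_def' using I_add[OF _ a] I_diff[OF _ a] by blast
qed

lemma Q_carrier: "carrier Q = cl ` carrier R"
  by (auto simp: star_quotient_def Let_def FactRing_def A_RCOSETS_def RCOSETS_def a_r_coset_def)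

lemma cl_closed [simp]: "z \<in> carrier R \<Longrightarrow> cl z \<in> carrier Q"
  by (simp add: Q_carrier)

lemma Q_cases: "X \<in> carrier Q \<Longrightarrow> (\<And>z. z \<in> carrier R \<Longrightarrow> X = cl z \<Longrightarrow> P) \<Longrightarrow> P"
  by (auto simp: Q_carrier)

lemma Q_mult: "z \<in> carrier R \<Longrightarrow> w \<in> carrier R \<Longrightarrow> cl z \<otimes>\<^bsub>Q\<^esub> cl w = cl (z \<otimes>\<^bsub>R\<^esub> w)"
  using ideal.rcoset_mult_add[OF ideal_I] by (simp add: star_quotient_def Let_def FactRing_def)

lemma Q_add: "z \<in> carrier R \<Longrightarrow> w \<in> carrier R \<Longrightarrow> cl z \<oplus>\<^bsub>Q\<^esub> cl w = cl (z + w)"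
  using ideal.a_rcos_sum[OF ideal_I] by (simp add: star_quotient_def Let_def FactRing_def R_add)

lemma Q_one: "\<one>\<^bsub>Q\<^esub> = cl \<one>\<^bsub>R\<^esub>"
  by (simp add: star_quotient_def Let_def FactRing_def)

lemma Q_zero: "\<zero>\<^bsub>Q\<^esub> = cl 0"
  by (simp add: star_quotient_def Let_def FactRing_def cl_def')

lemma Q_smult: "z \<in> carrier R \<Longrightarrow> c \<odot>\<^bsub>Q\<^esub> cl z = cl (scale c z)"
proof -
  assume z: "z \<in> carrier R"
  have "I +>\<^bsub>R\<^esub> (c \<odot>\<^bsub>R\<^esub> x) = cl (scale c z)" if "x \<in> cl z" for x
  proof -
    have "scale c x - scale c z = scale c (x - z)" by (rule ev_eqI) (simp add: algebra_simps)
    moreover have "x - z \<in> I" using that by (auto simp: cl_def')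
    ultimately show ?thesis using I_scale[of "x - z" c] by (simp add: R_smult cl_eq_iff)
  qed
  then have "(\<Union>x\<in>cl z. I +>\<^bsub>R\<^esub> (c \<odot>\<^bsub>R\<^esub> x)) = cl (scale c z)"
    by (intro UN_constant_eq[OF cl_self] ballI)
  then show ?thesis by (simp add: star_quotient_def Let_def)
qed

lemma Q_star: "z \<in> carrier R \<Longrightarrow> star Q (cl z) = cl (star R z)"
proof -
  assume z: "z \<in> carrier R"
  have "I +>\<^bsub>R\<^esub> star R x = cl (star R z)" if "x \<in> cl z" for x
  proof -
    have "star R x - star R z = star R (x - z)" by (rule ev_eqI) (simp add: ev_star)
    moreover have "x - z \<in> I" using that by (auto simp: cl_def')
    ultimately show ?thesis using I_star[of "x - z"] by (simp add: cl_eq_iff)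
  qed
  then have "(\<Union>x\<in>cl z. cl (star R x)) = cl (star R z)"
    by (intro UN_constant_eq[OF cl_self] ballI)
  then show ?thesis by (simp add: star_quotient_def Let_def)
qed

lemmas Q_simps = Q_mult Q_add Q_one Q_zero Q_smult Q_star

lemma cl_zero_iff: "cl z = \<zero>\<^bsub>Q\<^esub> \<longleftrightarrow> z \<in> I"
  by (simp add: Q_zero cl_eq_iff)

lemma abelian_group_Q: "abelian_group Q"
proof (rule abelian_groupI)
  fix X assume "X \<in> carrier Q"
  then obtain z where "z \<in> carrier R" "X = cl z" by (rule Q_cases)
  then show "\<exists>Y\<in>carrier Q. Y \<oplus>\<^bsub>Q\<^esub> X = \<zero>\<^bsub>Q\<^esub>"
    by (intro bexI[of _ "cl (- z)"]) (simp_all add: Q_simps)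
qed (auto elim!: Q_cases simp: Q_simps algebra_simps)

lemma inv_monoid_Q: "inv_monoid Q (star Q)"
proof -
  have "monoid Q"
    by (rule monoidI) (auto elim!: Q_cases simp: Q_simps R_assoc R_l_one R_r_one)
  then show ?thesis
    by (intro inv_monoid.intro inv_monoid_axioms.intro)
      (auto elim!: Q_cases simp: Q_simps star_mult star_star)
qed

lemma Q_finsum:
  assumes "finite A" "\<And>s. s \<in> A \<Longrightarrow> g s \<in> carrier R"
  shows "finsum Q (\<lambda>s. cl (g s)) A = cl (sum g A)"
  using assms
proof (induction A rule: finite_induct)
  case empty
  interpret abelian_group Q by (rule abelian_group_Q)
  show ?case by (simp add: Q_zero)
next
  case (insert a A)
  interpret abelian_group Q by (rule abelian_group_Q)
  show ?case using insert by (subst finsum_insert) (auto simp: Q_add)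
qed

definition val :: "('x \<Rightarrow> complex) \<Rightarrow> ('x \<Rightarrow>\<^sub>0 complex) set \<Rightarrow> complex" where
  "val \<phi> X = ev \<phi> (SOME z. z \<in> carrier R \<and> X = cl z)"

lemma val_cl:
  assumes "\<And>f. f \<in> I \<Longrightarrow> ev \<phi> f = 0" "z \<in> carrier R"
  shows "val \<phi> (cl z) = ev \<phi> z"
proof -
  define w where "w = (SOME w. w \<in> carrier R \<and> cl z = cl w)"
  have "w \<in> carrier R \<and> cl z = cl w"
    unfolding w_def by (rule someI[of _ z]) (simp add: assms)
  then have "z - w \<in> I" by (simp add: cl_eq_iff)
  from assms(1)[OF this] show ?thesis by (simp add: val_def w_def[symmetric])
qed

lemma Q_rules:
  "X \<in> carrier Q \<Longrightarrow> Y \<in> carrier Q \<Longrightarrow> X \<oplus>\<^bsub>Q\<^esub> Y \<in> carrier Q"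
  "X \<in> carrier Q \<Longrightarrow> Y \<in> carrier Q \<Longrightarrow> X \<otimes>\<^bsub>Q\<^esub> Y \<in> carrier Q"
  "X \<in> carrier Q \<Longrightarrow> c \<odot>\<^bsub>Q\<^esub> X \<in> carrier Q"
  "X \<in> carrier Q \<Longrightarrow> star Q X \<in> carrier Q"
  "X \<in> carrier Q \<Longrightarrow> Y \<in> carrier Q \<Longrightarrow> Z \<in> carrier Q \<Longrightarrow> (X \<oplus>\<^bsub>Q\<^esub> Y) \<otimes>\<^bsub>Q\<^esub> Z = X \<otimes>\<^bsub>Q\<^esub> Z \<oplus>\<^bsub>Q\<^esub> Y \<otimes>\<^bsub>Q\<^esub> Z"
  "X \<in> carrier Q \<Longrightarrow> Y \<in> carrier Q \<Longrightarrow> Z \<in> carrier Q \<Longrightarrow> Z \<otimes>\<^bsub>Q\<^esub> (X \<oplus>\<^bsub>Q\<^esub> Y) = Z \<otimes>\<^bsub>Q\<^esub> X \<oplus>\<^bsub>Q\<^esub> Z \<otimes>\<^bsub>Q\<^esub> Y"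
  "X \<in> carrier Q \<Longrightarrow> Y \<in> carrier Q \<Longrightarrow> (c \<odot>\<^bsub>Q\<^esub> X) \<otimes>\<^bsub>Q\<^esub> Y = c \<odot>\<^bsub>Q\<^esub> (X \<otimes>\<^bsub>Q\<^esub> Y)"
  "X \<in> carrier Q \<Longrightarrow> Y \<in> carrier Q \<Longrightarrow> X \<otimes>\<^bsub>Q\<^esub> (c \<odot>\<^bsub>Q\<^esub> Y) = c \<odot>\<^bsub>Q\<^esub> (X \<otimes>\<^bsub>Q\<^esub> Y)"
  "X \<in> carrier Q \<Longrightarrow> Y \<in> carrier Q \<Longrightarrow> star Q (X \<oplus>\<^bsub>Q\<^esub> Y) = star Q X \<oplus>\<^bsub>Q\<^esub> star Q Y"
  "X \<in> carrier Q \<Longrightarrow> star Q (c \<odot>\<^bsub>Q\<^esub> X) = cnj c \<odot>\<^bsub>Q\<^esub> star Q X"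
  "\<one>\<^bsub>Q\<^esub> \<in> carrier Q" "\<zero>\<^bsub>Q\<^esub> \<in> carrier Q"
  by (auto elim!: Q_cases simp: Q_simps mult_add_left mult_add_right mult_scale_left mult_scale_right star_add star_scale)

lemma val_add:
  assumes "\<And>f. f \<in> I \<Longrightarrow> ev \<phi> f = 0" "X \<in> carrier Q" "Y \<in> carrier Q"
  shows "val \<phi> (X \<oplus>\<^bsub>Q\<^esub> Y) = val \<phi> X + val \<phi> Y"
  using assms(2,3) by (auto elim!: Q_cases simp: Q_simps val_cl[OF assms(1)])

lemma val_smult:
  assumes "\<And>f. f \<in> I \<Longrightarrow> ev \<phi> f = 0" "X \<in> carrier Q"
  shows "val \<phi> (c \<odot>\<^bsub>Q\<^esub> X) = c * val \<phi> X"
  using assms(2) by (auto elim!: Q_cases simp: Q_simps val_cl[OF assms(1)])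

lemma val_finsum:
  assumes \<phi>: "\<And>f. f \<in> I \<Longrightarrow> ev \<phi> f = 0" and "finite A" "\<And>s. s \<in> A \<Longrightarrow> g s \<in> carrier Q"
  shows "val \<phi> (finsum Q g A) = (\<Sum>s\<in>A. val \<phi> (g s))"
  using assms(2,3)
proof (induction A rule: finite_induct)
  case empty
  interpret abelian_group Q by (rule abelian_group_Q)
  show ?case using val_cl[OF \<phi>, of 0] by (simp add: Q_zero)
next
  case (insert a A)
  interpret abelian_group Q by (rule abelian_group_Q)
  show ?case using insert by (subst finsum_insert) (auto simp: val_add[OF \<phi>] intro!: finsum_closed)
qed

end


section \<open>The quantum isomorphism space and its coefficient functions\<close>

definition word_monoid :: "'g set \<Rightarrow> ('g \<times> bool) list monoid" where
  "word_monoid G = \<lparr>carrier = lists (G \<times> UNIV), mult = (@), one = []\<rparr>"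

definition word_inv :: "('g \<times> bool) list \<Rightarrow> ('g \<times> bool) list" where
  "word_inv w = rev (map (\<lambda>(g, s). (g, \<not> s)) w)"

lemma word_monoid_simps [simp]:
  "carrier (word_monoid G) = lists (G \<times> UNIV)" "mult (word_monoid G) = (@)" "one (word_monoid G) = []"
  by (simp_all add: word_monoid_def)

lemma free_star_algebra_eq: "free_star_algebra G = monoid_algebra (word_monoid G) word_inv"
  unfolding free_star_algebra_def word_monoid_def word_inv_def[abs_def] ..

lemma inv_monoid_words: "inv_monoid (word_monoid G) word_inv"
proof (intro inv_monoid.intro inv_monoid_axioms.intro)
  show "monoid (word_monoid G)" by (rule monoidI) auto
qed (auto simp: word_inv_def rev_map comp_def case_prod_beta in_lists_conv_set)

context inv_monoid
begin

lemma magic_relations_cases: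
  assumes r: "r \<in> magic_relations R A B p" and fin: "finite A" "finite B"
    and p: "\<forall>i\<in>A. \<forall>j\<in>B. p i j \<in> carrier R"
  obtains (selfadj) i j where "i \<in> A" "j \<in> B" "r = p i j - star R (p i j)"
  | (idem) i j where "i \<in> A" "j \<in> B" "r = p i j - p i j \<otimes>\<^bsub>R\<^esub> p i j"
  | (row_sum) i where "i \<in> A" "r = (\<Sum>j\<in>B. p i j) - \<one>\<^bsub>R\<^esub>"
  | (col_sum) j where "j \<in> B" "r = (\<Sum>i\<in>A. p i j) - \<one>\<^bsub>R\<^esub>"
  | (row_orth) i j j' where "i \<in> A" "j \<in> B" "j' \<in> B" "j \<noteq> j'" "r = p i j \<otimes>\<^bsub>R\<^esub> p i j'"
  | (col_orth) i i' j where "i \<in> A" "i' \<in> A" "j \<in> B" "i \<noteq> i'" "r = p i j \<otimes>\<^bsub>R\<^esub> p i' j"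
proof -
  have 3: "finsum R (\<lambda>j. p i j) B \<ominus>\<^bsub>R\<^esub> \<one>\<^bsub>R\<^esub> = (\<Sum>j\<in>B. p i j) - \<one>\<^bsub>R\<^esub>" if "i \<in> A" for i
    using that fin p by (subst R_minus) (auto simp: R_finsum)
  have 4: "finsum R (\<lambda>i. p i j) A \<ominus>\<^bsub>R\<^esub> \<one>\<^bsub>R\<^esub> = (\<Sum>i\<in>A. p i j) - \<one>\<^bsub>R\<^esub>" if "j \<in> B" for j
    using that fin p by (subst R_minus) (auto simp: R_finsum)
  show ?thesis
    using r unfolding magic_relations_def
    by (elim UnE CollectE exE conjE) (use p 3 4 that in \<open>auto simp: R_minus\<close>)
qed

lemma magic_relations_mem:
  assumes fin: "finite A" "finite B" and p: "\<And>i j. i \<in> A \<Longrightarrow> j \<in> B \<Longrightarrow> p i j \<in> carrier R"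
  shows "i \<in> A \<Longrightarrow> j \<in> B \<Longrightarrow> p i j - star R (p i j) \<in> magic_relations R A B p"
    and "i \<in> A \<Longrightarrow> j \<in> B \<Longrightarrow> p i j - p i j \<otimes>\<^bsub>R\<^esub> p i j \<in> magic_relations R A B p"
    and "i \<in> A \<Longrightarrow> (\<Sum>j\<in>B. p i j) - \<one>\<^bsub>R\<^esub> \<in> magic_relations R A B p"
    and "j \<in> B \<Longrightarrow> (\<Sum>i\<in>A. p i j) - \<one>\<^bsub>R\<^esub> \<in> magic_relations R A B p"
    and "i \<in> A \<Longrightarrow> j \<in> B \<Longrightarrow> j' \<in> B \<Longrightarrow> j \<noteq> j' \<Longrightarrow> p i j \<otimes>\<^bsub>R\<^esub> p i j' \<in> magic_relations R A B p"
    and "i \<in> A \<Longrightarrow> i' \<in> A \<Longrightarrow> j \<in> B \<Longrightarrow> i \<noteq> i' \<Longrightarrow> p i j \<otimes>\<^bsub>R\<^esub> p i' j \<in> magic_relations R A B p"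
proof -
  show "i \<in> A \<Longrightarrow> j \<in> B \<Longrightarrow> p i j - star R (p i j) \<in> magic_relations R A B p"
  proof -
    assume "i \<in> A" "j \<in> B"
    moreover from this have "p i j \<ominus>\<^bsub>R\<^esub> star R (p i j) \<in> magic_relations R A B p"
      unfolding magic_relations_def by blast
    ultimately show ?thesis using p by (simp add: R_minus)
  qed
  show "i \<in> A \<Longrightarrow> j \<in> B \<Longrightarrow> p i j - p i j \<otimes>\<^bsub>R\<^esub> p i j \<in> magic_relations R A B p"
  proof -
    assume "i \<in> A" "j \<in> B"
    moreover from this have "p i j \<ominus>\<^bsub>R\<^esub> p i j \<otimes>\<^bsub>R\<^esub> p i j \<in> magic_relations R A B p"
      unfolding magic_relations_def by blast
    ultimately show ?thesis using p by (simp add: R_minus)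
  qed
  show "(\<Sum>j\<in>B. p i j) - \<one>\<^bsub>R\<^esub> \<in> magic_relations R A B p" if "i \<in> A"
  proof -
    have "finsum R (\<lambda>j. p i j) B \<ominus>\<^bsub>R\<^esub> \<one>\<^bsub>R\<^esub> = (\<Sum>j\<in>B. p i j) - \<one>\<^bsub>R\<^esub>"
      using that fin p by (subst R_minus) (auto simp: R_finsum)
    moreover have "finsum R (\<lambda>j. p i j) B \<ominus>\<^bsub>R\<^esub> \<one>\<^bsub>R\<^esub> \<in> magic_relations R A B p"
      using that unfolding magic_relations_def by blast
    ultimately show ?thesis by simp
  qed
  show "(\<Sum>i\<in>A. p i j) - \<one>\<^bsub>R\<^esub> \<in> magic_relations R A B p" if "j \<in> B"
  proof -
    have "finsum R (\<lambda>i. p i j) A \<ominus>\<^bsub>R\<^esub> \<one>\<^bsub>R\<^esub> = (\<Sum>i\<in>A. p i j) - \<one>\<^bsub>R\<^esub>"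
      using that fin p by (subst R_minus) (auto simp: R_finsum)
    moreover have "finsum R (\<lambda>i. p i j) A \<ominus>\<^bsub>R\<^esub> \<one>\<^bsub>R\<^esub> \<in> magic_relations R A B p"
      using that unfolding magic_relations_def by blast
    ultimately show ?thesis by simp
  qed
qed (unfold magic_relations_def, blast+)

lemma intertwiner_rewrite:
  assumes fin: "finite A" "finite B"
    and "\<And>k. k \<in> A \<Longrightarrow> q k \<in> carrier R" "\<And>k. k \<in> B \<Longrightarrow> s k \<in> carrier R"
  shows "(\<Oplus>\<^bsub>R\<^esub>k\<in>A. c k \<odot>\<^bsub>R\<^esub> q k) \<ominus>\<^bsub>R\<^esub> (\<Oplus>\<^bsub>R\<^esub>k\<in>B. d k \<odot>\<^bsub>R\<^esub> s k) =
    (\<Sum>k\<in>A. scale (c k) (q k)) - (\<Sum>k\<in>B. scale (d k) (s k))"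
proof -
  have "(\<Oplus>\<^bsub>R\<^esub>k\<in>A. c k \<odot>\<^bsub>R\<^esub> q k) = (\<Sum>k\<in>A. scale (c k) (q k))"
    "(\<Oplus>\<^bsub>R\<^esub>k\<in>B. d k \<odot>\<^bsub>R\<^esub> s k) = (\<Sum>k\<in>B. scale (d k) (s k))"
    unfolding R_smult using assms by (auto intro!: R_finsum)
  then show ?thesis using assms by (simp add: R_minus)
qed

end

fun row :: "('v1, 'v2, 'e1, 'e2) qiso_gen \<times> bool \<Rightarrow> 'v1 + 'e1" where
  "row (VGen v w, s) = Inl v" | "row (EGen e f, s) = Inr e"

fun col :: "('v1, 'v2, 'e1, 'e2) qiso_gen \<times> bool \<Rightarrow> 'v2 + 'e2" where
  "col (VGen v w, s) = Inl w" | "col (EGen e f, s) = Inr f"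

fun gen :: "('v1 + 'e1) \<times> ('v2 + 'e2) \<Rightarrow> ('v1, 'v2, 'e1, 'e2) qiso_gen \<times> bool" where
  "gen (Inl v, Inl w) = (VGen v w, False)" | "gen (Inr e, Inr f) = (EGen e f, False)"
| "gen _ = undefined"

definition gword :: "('v1 + 'e1) list \<Rightarrow> ('v2 + 'e2) list \<Rightarrow> (('v1, 'v2, 'e1, 'e2) qiso_gen \<times> bool) list" where
  "gword a b = map gen (zip a b)"

definition wval :: "('v1 + 'e1, 'v2 + 'e2) coef \<Rightarrow> (('v1, 'v2, 'e1, 'e2) qiso_gen \<times> bool) list \<Rightarrow> complex" where
  "wval x w = x (map row w) (map col w)"

lemma row_flip [simp]: "row (g, \<not> s) = row (g, s)" and col_flip [simp]: "col (g, \<not> s) = col (g, s)"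
  by (cases g; simp)+

lemma row_col_word_inv [simp]:
  "map row (word_inv w) = rev (map row w)" "map col (word_inv w) = rev (map col w)"
  by (auto simp: word_inv_def rev_map)

lemma gword_Nil [simp]: "gword [] [] = []"
  by (simp add: gword_def)

lemma gword_append: "length a = length b \<Longrightarrow> gword (a @ c) (b @ d) = gword a b @ gword c d"
  by (simp add: gword_def)

lemma gword_row_col: "gword (map row w) (map col w) = map (\<lambda>(g, s). (g, False)) w"
proof (induction w)
  case (Cons p w)
  obtain g s where "p = (g, s)" by (metis surj_pair)
  then show ?case using Cons by (cases g) (simp_all add: gword_def)
qed (simp add: gword_def)

lemma row_col_gword:
  "map isl a = map isl b \<Longrightarrow> map row (gword a b) = a \<and> map col (gword a b) = b"
proof (induction a arbitrary: b)
  case (Cons i a)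
  then obtain j b' where b: "b = j # b'" by (cases b) auto
  have "isl i = isl j" using Cons.prems b by simp
  then show ?case using Cons b by (cases i; cases j) (auto simp: gword_def)
qed (simp add: gword_def)

lemma sum_letters:
  "full_hypergraph \<Lambda> \<Longrightarrow> (\<Sum>l\<in>letters \<Lambda>. f l) = (\<Sum>v\<in>verts \<Lambda>. f (Inl v)) + (\<Sum>e\<in>edges \<Lambda>. f (Inr e))"
  unfolding letters_def full_hypergraph_def by (subst sum.union_disjoint) (auto simp: sum.reindex)

locale qiso_pair =
  fixes \<Lambda>1 :: "('v1, 'e1) hypergraph" and \<Lambda>2 :: "('v2, 'e2) hypergraph"
  assumes full1: "full_hypergraph \<Lambda>1" and full2: "full_hypergraph \<Lambda>2"
begin

abbreviation "G \<equiv> qiso_gens \<Lambda>1 \<Lambda>2"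

lemma finite_parts [simp]: "finite (verts \<Lambda>1)" "finite (edges \<Lambda>1)" "finite (verts \<Lambda>2)" "finite (edges \<Lambda>2)"
  using full1 full2 by (auto simp: full_hypergraph_def)

sublocale W: inv_monoid "word_monoid G" word_inv
  by (rule inv_monoid_words)

lemma free_gen_closed [simp]:
  "v \<in> verts \<Lambda>1 \<Longrightarrow> w \<in> verts \<Lambda>2 \<Longrightarrow> free_gen (VGen v w) \<in> carrier W.R"
  "e \<in> edges \<Lambda>1 \<Longrightarrow> f \<in> edges \<Lambda>2 \<Longrightarrow> free_gen (EGen e f) \<in> carrier W.R"
  unfolding free_gen_def by (rule W.single_closed; force simp: qiso_gens_def)+

lemma free_gen_ball:
  "\<forall>v\<in>verts \<Lambda>1. \<forall>w\<in>verts \<Lambda>2. free_gen (VGen v w) \<in> carrier W.R"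
  "\<forall>e\<in>edges \<Lambda>1. \<forall>f\<in>edges \<Lambda>2. free_gen (EGen e f) \<in> carrier W.R"
  by simp_all

lemma relations_eq:
  "qiso_relations \<Lambda>1 \<Lambda>2 =
    magic_relations W.R (verts \<Lambda>1) (verts \<Lambda>2) (\<lambda>v w. free_gen (VGen v w)) \<union>
    magic_relations W.R (edges \<Lambda>1) (edges \<Lambda>2) (\<lambda>e f. free_gen (EGen e f)) \<union>
    {(\<Sum>e\<in>edges \<Lambda>1. scale (incidence_matrix \<Lambda>1 v e) (free_gen (EGen e f))) -
     (\<Sum>w\<in>verts \<Lambda>2. scale (incidence_matrix \<Lambda>2 w f) (free_gen (VGen v w))) | v f. v \<in> verts \<Lambda>1 \<and> f \<in> edges \<Lambda>2}"
proof -
  have e: "(\<Oplus>\<^bsub>W.R\<^esub>e\<in>edges \<Lambda>1. incidence_matrix \<Lambda>1 v e \<odot>\<^bsub>W.R\<^esub> free_gen (EGen e f)) \<ominus>\<^bsub>W.R\<^esub>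
      (\<Oplus>\<^bsub>W.R\<^esub>w\<in>verts \<Lambda>2. incidence_matrix \<Lambda>2 w f \<odot>\<^bsub>W.R\<^esub> free_gen (VGen v w)) =
    (\<Sum>e\<in>edges \<Lambda>1. scale (incidence_matrix \<Lambda>1 v e) (free_gen (EGen e f))) -
     (\<Sum>w\<in>verts \<Lambda>2. scale (incidence_matrix \<Lambda>2 w f) (free_gen (VGen v w)))"
    if "v \<in> verts \<Lambda>1" "f \<in> edges \<Lambda>2" for v f
    using that by (intro W.intertwiner_rewrite) auto
  have "intertwiner_relations W.R \<Lambda>1 \<Lambda>2 (\<lambda>v w. free_gen (VGen v w)) (\<lambda>e f. free_gen (EGen e f)) =
    {(\<Sum>e\<in>edges \<Lambda>1. scale (incidence_matrix \<Lambda>1 v e) (free_gen (EGen e f))) -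
     (\<Sum>w\<in>verts \<Lambda>2. scale (incidence_matrix \<Lambda>2 w f) (free_gen (VGen v w))) | v f. v \<in> verts \<Lambda>1 \<and> f \<in> edges \<Lambda>2}"
    (is "?L = ?E")
  proof (intro subset_antisym subsetI)
    fix r assume "r \<in> ?L"
    then show "r \<in> ?E" unfolding intertwiner_relations_def
      by (elim CollectE exE conjE) (auto simp: e)
  next
    fix r assume "r \<in> ?E"
    then show "r \<in> ?L" unfolding intertwiner_relations_def
      by (elim CollectE exE conjE) (metis (mono_tags, lifting) CollectI e)
  qed
  then show ?thesis by (simp add: qiso_relations_def free_star_algebra_eq Let_def)
qed

lemma relations_closed: "qiso_relations \<Lambda>1 \<Lambda>2 \<subseteq> carrier W.R"
proof
  fix r assume "r \<in> qiso_relations \<Lambda>1 \<Lambda>2"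
  then consider
    "r \<in> magic_relations W.R (verts \<Lambda>1) (verts \<Lambda>2) (\<lambda>v w. free_gen (VGen v w))" |
    "r \<in> magic_relations W.R (edges \<Lambda>1) (edges \<Lambda>2) (\<lambda>e f. free_gen (EGen e f))" |
    v f where "v \<in> verts \<Lambda>1" "f \<in> edges \<Lambda>2" "r = (\<Sum>e\<in>edges \<Lambda>1. scale (incidence_matrix \<Lambda>1 v e) (free_gen (EGen e f))) -
     (\<Sum>w\<in>verts \<Lambda>2. scale (incidence_matrix \<Lambda>2 w f) (free_gen (VGen v w)))"
    unfolding relations_eq by blast
  then show "r \<in> carrier W.R"
  proof cases
    case 1
    from this finite_parts(1,3) free_gen_ball(1) show ?thesis
      by (cases rule: W.magic_relations_cases) auto
  next
    case 2
    from this finite_parts(2,4) free_gen_ball(2) show ?thesis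
      by (cases rule: W.magic_relations_cases) auto
  next
    case 3
    then show ?thesis by auto
  qed
qed

sublocale P: star_presentation "word_monoid G" word_inv "qiso_relations \<Lambda>1 \<Lambda>2"
  by unfold_locales (rule relations_closed)

lemma O_eq: "\<O> \<Lambda>1 \<Lambda>2 = P.Q"
  by (simp add: qiso_algebra_def free_star_algebra_eq)

lemma qiso_class_eq: "qiso_class \<Lambda>1 \<Lambda>2 g = P.cl (free_gen g)"
  by (simp add: qiso_class_def free_star_algebra_eq)


subsection \<open>Coefficient functions vanish on the relations\<close>

lemma coefs_vanish_on_relations:
  assumes x: "x \<in> coefs \<Lambda>1 \<Lambda>2" and r: "r \<in> qiso_relations \<Lambda>1 \<Lambda>2"
  shows "ev (wval x) r = 0"
proof -
  have z [simp]: "x [Inl v] [Inr f] = 0" "x [Inr e] [Inl w] = 0" for v f e w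
    using coefs_support[OF x] by (auto simp: matched_def)
  have lt [simp]: "v \<in> verts \<Lambda>1 \<Longrightarrow> Inl v \<in> letters \<Lambda>1" "w \<in> verts \<Lambda>2 \<Longrightarrow> Inl w \<in> letters \<Lambda>2"
    "e \<in> edges \<Lambda>1 \<Longrightarrow> Inr e \<in> letters \<Lambda>1" "f \<in> edges \<Lambda>2 \<Longrightarrow> Inr f \<in> letters \<Lambda>2" for v w e f
    by (auto simp: letters_def)
  note idem = coefs_idem_row[OF x, of _ _ _ "[]" "[]" "[]" "[]", simplified]
    coefs_idem_col[OF x, of _ _ _ "[]" "[]" "[]" "[]", simplified]
  note sums = coefs_row[OF x, of _ "[]" "[]" "[]" "[]", simplified]
    coefs_col[OF x, of _ "[]" "[]" "[]" "[]", simplified]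
  note sums' = sums[unfolded sum_letters[OF full1] sum_letters[OF full2]]
  from r consider
    "r \<in> magic_relations W.R (verts \<Lambda>1) (verts \<Lambda>2) (\<lambda>v w. free_gen (VGen v w))" |
    "r \<in> magic_relations W.R (edges \<Lambda>1) (edges \<Lambda>2) (\<lambda>e f. free_gen (EGen e f))" |
    v f where "v \<in> verts \<Lambda>1" "f \<in> edges \<Lambda>2" "r = (\<Sum>e\<in>edges \<Lambda>1. scale (incidence_matrix \<Lambda>1 v e) (free_gen (EGen e f))) -
     (\<Sum>w\<in>verts \<Lambda>2. scale (incidence_matrix \<Lambda>2 w f) (free_gen (VGen v w)))"
    unfolding relations_eq by blast
  then show ?thesis
  proof cases
    case 1
    from this finite_parts(1,3) free_gen_ball(1) show ?thesis
    proof (cases rule: W.magic_relations_cases)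
      case (row_sum i)
      then show ?thesis using sums'(1)[of "Inl i"] by (simp add: free_gen_def wval_def W.R_one)
    next
      case (col_sum j)
      then show ?thesis using sums'(2)[of "Inl j"] by (simp add: free_gen_def wval_def W.R_one)
    qed (simp_all add: free_gen_def W.single_star W.single_mult wval_def word_inv_def idem)
  next
    case 2
    from this finite_parts(2,4) free_gen_ball(2) show ?thesis
    proof (cases rule: W.magic_relations_cases)
      case (row_sum i)
      then show ?thesis using sums'(1)[of "Inr i"] by (simp add: free_gen_def wval_def W.R_one)
    next
      case (col_sum j)
      then show ?thesis using sums'(2)[of "Inr j"] by (simp add: free_gen_def wval_def W.R_one)
    qed (simp_all add: free_gen_def W.single_star W.single_mult wval_def word_inv_def idem)
  next
    case (3 v f)
    then show ?thesis
      using coefs_inc[OF x, of "Inl v" "Inr f" "[]" "[]" "[]" "[]"]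
      by (simp add: free_gen_def wval_def inc_def sum_letters[OF full1] sum_letters[OF full2])
  qed
qed

text \<open>
  Translating a functional by words shifts its coefficient function, and composing it with the involution
  applies \<^const>\<open>bar\<close>.
\<close>

lemma wval_vanish_on_I:
  assumes x: "x \<in> coefs \<Lambda>1 \<Lambda>2" and z: "z \<in> P.I"
  shows "ev (wval x) z = 0"
proof (rule P.null_family[where \<F> = "wval ` coefs \<Lambda>1 \<Lambda>2"])
  fix \<phi> :: "(('v1, 'v2, 'e1, 'e2) qiso_gen \<times> bool) list \<Rightarrow> complex"
  assume "\<phi> \<in> wval ` coefs \<Lambda>1 \<Lambda>2"
  then obtain y where y: "y \<in> coefs \<Lambda>1 \<Lambda>2" "\<phi> = wval y" by auto
  show "ev \<phi> r = 0" if "r \<in> qiso_relations \<Lambda>1 \<Lambda>2" for r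
    using coefs_vanish_on_relations[OF y(1) that] y(2) by simp
  show "(\<lambda>w. \<phi> (u \<otimes>\<^bsub>word_monoid G\<^esub> w)) \<in> wval ` coefs \<Lambda>1 \<Lambda>2" for u
    using coefs_shift[OF y(1), of "map row u" "map col u" "[]" "[]"]
    by (intro image_eqI[of _ _ "shift (map row u) (map col u) [] [] y"]) (auto simp: y(2) wval_def shift_def)
  show "(\<lambda>w. \<phi> (w \<otimes>\<^bsub>word_monoid G\<^esub> u)) \<in> wval ` coefs \<Lambda>1 \<Lambda>2" for u
    using coefs_shift[OF y(1), of "[]" "[]" "map row u" "map col u"]
    by (intro image_eqI[of _ _ "shift [] [] (map row u) (map col u) y"]) (auto simp: y(2) wval_def shift_def)
  show "(\<lambda>w. cnj (\<phi> (word_inv w))) \<in> wval ` coefs \<Lambda>1 \<Lambda>2"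
    using bar_in_coefs[OF y(1)] by (intro image_eqI[of _ _ "bar y"]) (auto simp: y(2) wval_def bar_def)
qed (use z x in auto)


subsection \<open>Functionals give coefficient functions\<close>

definition null :: "((('v1, 'v2, 'e1, 'e2) qiso_gen \<times> bool) list \<Rightarrow> complex) \<Rightarrow> bool" where
  "null \<phi> \<longleftrightarrow> (\<forall>z\<in>P.I. ev \<phi> z = 0)"

definition coef :: "((('v1, 'v2, 'e1, 'e2) qiso_gen \<times> bool) list \<Rightarrow> complex) \<Rightarrow> ('v1 + 'e1, 'v2 + 'e2) coef" where
  "coef \<phi> a b = (if matched \<Lambda>1 \<Lambda>2 a b then \<phi> (gword a b) else 0)"

lemma gens_cases:
  assumes "g \<in> G"
  obtains v w where "g = VGen v w" "v \<in> verts \<Lambda>1" "w \<in> verts \<Lambda>2"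
  | e f where "g = EGen e f" "e \<in> edges \<Lambda>1" "f \<in> edges \<Lambda>2"
  using assms by (auto simp: qiso_gens_def)

lemma matched_row_col:
  assumes "w \<in> lists (G \<times> UNIV)"
  shows "matched \<Lambda>1 \<Lambda>2 (map row w) (map col w)"
  using assms
proof (induction w rule: list.induct)
  case (Cons p w)
  then show ?case by (cases p) (auto elim!: gens_cases simp: matched_def letters_def)
qed (simp add: matched_def)

lemma gword_closed:
  assumes "matched \<Lambda>1 \<Lambda>2 a b" shows "gword a b \<in> lists (G \<times> UNIV)"
  using assms
proof (induction a arbitrary: b)
  case (Cons i a)
  then obtain j b' where b: "b = j # b'" by (cases b) (auto simp: matched_def)
  have "matched \<Lambda>1 \<Lambda>2 a b'" "isl i = isl j" "i \<in> letters \<Lambda>1" "j \<in> letters \<Lambda>2"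
    using Cons.prems b by (auto simp: matched_def)
  then show ?case using Cons.IH[of b'] b
    by (cases i; cases j) (auto simp: gword_def qiso_gens_def letters_def)
qed (auto simp: gword_def)

lemma null_translate:
  assumes "null \<phi>" "u \<in> lists (G \<times> UNIV)" "v \<in> lists (G \<times> UNIV)"
  shows "null (\<lambda>w. \<phi> (u @ w @ v))"
  unfolding null_def
proof
  fix z assume z: "z \<in> P.I"
  have "Poly_Mapping.single u 1 \<otimes>\<^bsub>W.R\<^esub> (z \<otimes>\<^bsub>W.R\<^esub> Poly_Mapping.single v 1) \<in> P.I"
    using assms z by (intro P.I_mult_left P.I_mult_right) auto
  then show "ev (\<lambda>w. \<phi> (u @ w @ v)) z = 0" using assms(1) by (force simp: null_def W.ev_mult)
qed

lemma null_magic: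
  assumes n: "null \<phi>" and pq: "finite A" "finite B" "\<And>i j. i \<in> A \<Longrightarrow> j \<in> B \<Longrightarrow> free_gen (g i j) \<in> carrier W.R"
    and sub: "magic_relations W.R A B (\<lambda>i j. free_gen (g i j)) \<subseteq> qiso_relations \<Lambda>1 \<Lambda>2"
  shows "i \<in> A \<Longrightarrow> j \<in> B \<Longrightarrow> \<phi> [(g i j, True)] = \<phi> [(g i j, False)]"
    and "i \<in> A \<Longrightarrow> j \<in> B \<Longrightarrow> j' \<in> B \<Longrightarrow> \<phi> [(g i j, False), (g i j', False)] = (if j = j' then \<phi> [(g i j, False)] else 0)"
    and "i \<in> A \<Longrightarrow> i' \<in> A \<Longrightarrow> j \<in> B \<Longrightarrow> \<phi> [(g i j, False), (g i' j, False)] = (if i = i' then \<phi> [(g i j, False)] else 0)"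
    and "i \<in> A \<Longrightarrow> (\<Sum>j\<in>B. \<phi> [(g i j, False)]) = \<phi> []"
    and "j \<in> B \<Longrightarrow> (\<Sum>i\<in>A. \<phi> [(g i j, False)]) = \<phi> []"
proof -
  have N: "ev \<phi> r = 0" if "r \<in> magic_relations W.R A B (\<lambda>i j. free_gen (g i j))" for r
    using n P.S_in_I sub that by (auto simp: null_def)
  note m = W.magic_relations_mem[OF pq, THEN N]
  show "i \<in> A \<Longrightarrow> j \<in> B \<Longrightarrow> \<phi> [(g i j, True)] = \<phi> [(g i j, False)]"
    using m(1)[of i j] by (simp add: free_gen_def W.single_star word_inv_def)
  show "i \<in> A \<Longrightarrow> j \<in> B \<Longrightarrow> j' \<in> B \<Longrightarrow> \<phi> [(g i j, False), (g i j', False)] = (if j = j' then \<phi> [(g i j, False)] else 0)"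
    using m(2)[of i j] m(5)[of i j j'] by (auto simp: free_gen_def W.single_mult)
  show "i \<in> A \<Longrightarrow> i' \<in> A \<Longrightarrow> j \<in> B \<Longrightarrow> \<phi> [(g i j, False), (g i' j, False)] = (if i = i' then \<phi> [(g i j, False)] else 0)"
    using m(2)[of i j] m(6)[of i i' j] by (auto simp: free_gen_def W.single_mult)
  show "i \<in> A \<Longrightarrow> (\<Sum>j\<in>B. \<phi> [(g i j, False)]) = \<phi> []"
    using m(3)[of i] by (simp add: free_gen_def W.R_one)
  show "j \<in> B \<Longrightarrow> (\<Sum>i\<in>A. \<phi> [(g i j, False)]) = \<phi> []"
    using m(4)[of j] by (simp add: free_gen_def W.R_one)
qed

lemmas null_verts = null_magic[where A = "verts \<Lambda>1" and B = "verts \<Lambda>2" and g = VGen, OF _ finite_parts(1,3)]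
lemmas null_edges = null_magic[where A = "edges \<Lambda>1" and B = "edges \<Lambda>2" and g = EGen, OF _ finite_parts(2,4)]

lemma rels_verts: "magic_relations W.R (verts \<Lambda>1) (verts \<Lambda>2) (\<lambda>v w. free_gen (VGen v w)) \<subseteq> qiso_relations \<Lambda>1 \<Lambda>2"
  and rels_edges: "magic_relations W.R (edges \<Lambda>1) (edges \<Lambda>2) (\<lambda>v w. free_gen (EGen v w)) \<subseteq> qiso_relations \<Lambda>1 \<Lambda>2"
  unfolding relations_eq by auto

lemma local_rels_coef:
  assumes n: "null \<phi>"
  shows "local_rels \<Lambda>1 \<Lambda>2 (coef \<phi>)"
proof -
  note V = null_verts[OF n free_gen_closed(1) rels_verts]
  note E = null_edges[OF n free_gen_closed(2) rels_edges]
  have c: "coef \<phi> [] [] = \<phi> []"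
    "v \<in> verts \<Lambda>1 \<Longrightarrow> w \<in> verts \<Lambda>2 \<Longrightarrow> coef \<phi> [Inl v] [Inl w] = \<phi> [(VGen v w, False)]"
    "e \<in> edges \<Lambda>1 \<Longrightarrow> f \<in> edges \<Lambda>2 \<Longrightarrow> coef \<phi> [Inr e] [Inr f] = \<phi> [(EGen e f, False)]"
    "coef \<phi> [Inl v] [Inr f] = 0" "coef \<phi> [Inr e] [Inl w] = 0" for v w e f
    by (auto simp: coef_def matched_def letters_def gword_def)
  have c2: "coef \<phi> [i, i'] [j, j'] = (if matched \<Lambda>1 \<Lambda>2 [i, i'] [j, j'] then \<phi> [gen (i, j), gen (i', j')] else 0)" for i i' j j'
    by (simp add: coef_def gword_def)
  have int: "(\<Sum>e\<in>edges \<Lambda>1. incidence_matrix \<Lambda>1 v e * \<phi> [(EGen e f, False)]) =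
      (\<Sum>w\<in>verts \<Lambda>2. incidence_matrix \<Lambda>2 w f * \<phi> [(VGen v w, False)])" if "v \<in> verts \<Lambda>1" "f \<in> edges \<Lambda>2" for v f
  proof -
    have "(\<Sum>e\<in>edges \<Lambda>1. scale (incidence_matrix \<Lambda>1 v e) (free_gen (EGen e f))) -
     (\<Sum>w\<in>verts \<Lambda>2. scale (incidence_matrix \<Lambda>2 w f) (free_gen (VGen v w))) \<in> P.I"
      using that by (intro P.S_in_I) (auto simp: relations_eq)
    with n have "ev \<phi> ((\<Sum>e\<in>edges \<Lambda>1. scale (incidence_matrix \<Lambda>1 v e) (free_gen (EGen e f))) -
     (\<Sum>w\<in>verts \<Lambda>2. scale (incidence_matrix \<Lambda>2 w f) (free_gen (VGen v w)))) = 0" by (auto simp: null_def)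
    then show ?thesis by (simp only: ev_diff ev_sum ev_scale free_gen_def ev_single) simp
  qed
  show ?thesis
    unfolding local_rels_def
  proof (intro conjI ballI)
    fix i j j' assume "i \<in> letters \<Lambda>1" "j \<in> letters \<Lambda>2" "j' \<in> letters \<Lambda>2"
    then show "coef \<phi> [i, i] [j, j'] = (if j = j' then coef \<phi> [i] [j] else 0)"
      unfolding c2 by (cases i; cases j; cases j') (auto simp: letters_def matched_def c V(2) E(2))
  next
    fix i i' j assume "i \<in> letters \<Lambda>1" "i' \<in> letters \<Lambda>1" "j \<in> letters \<Lambda>2"
    then show "coef \<phi> [i, i'] [j, j] = (if i = i' then coef \<phi> [i] [j] else 0)"
      unfolding c2 by (cases i; cases j; cases i') (auto simp: letters_def matched_def c V(3) E(3))
  next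
    fix i assume "i \<in> letters \<Lambda>1"
    then show "(\<Sum>j\<in>letters \<Lambda>2. coef \<phi> [i] [j]) = coef \<phi> [] []"
      unfolding sum_letters[OF full2] by (auto simp: letters_def c V(4) E(4))
  next
    fix j assume "j \<in> letters \<Lambda>2"
    then show "(\<Sum>i\<in>letters \<Lambda>1. coef \<phi> [i] [j]) = coef \<phi> [] []"
      unfolding sum_letters[OF full1] by (auto simp: letters_def c V(5) E(5))
  next
    fix i j assume "i \<in> letters \<Lambda>1" "j \<in> letters \<Lambda>2"
    then show "(\<Sum>k\<in>letters \<Lambda>1. inc \<Lambda>1 i k * coef \<phi> [k] [j]) = (\<Sum>l\<in>letters \<Lambda>2. inc \<Lambda>2 l j * coef \<phi> [i] [l])"
      unfolding sum_letters[OF full1] sum_letters[OF full2]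
      by (auto simp: letters_def inc_def c int)
  qed
qed

text \<open>
  Every context \<open>u, u', v, v'\<close> is absorbed into the functional, by multiplying its argument on
  both sides by the corresponding words; the relations then have to be checked only for the empty context.
\<close>

lemma coef_in_coefs:
  assumes n: "null \<phi>"
  shows "coef \<phi> \<in> coefs \<Lambda>1 \<Lambda>2"
  unfolding coefs_def
proof (intro CollectI conjI allI impI)
  show "coef \<phi> a b \<noteq> 0 \<Longrightarrow> matched \<Lambda>1 \<Lambda>2 a b" for a b
    by (auto simp: coef_def split: if_splits)
  fix u v :: "('v1 + 'e1) list" and u' v' :: "('v2 + 'e2) list"
  assume l: "length u = length u'" "length v = length v'"
  have m: "matched \<Lambda>1 \<Lambda>2 (u @ a @ v) (u' @ b @ v') \<longleftrightarrow> matched \<Lambda>1 \<Lambda>2 u u' \<and> matched \<Lambda>1 \<Lambda>2 v v' \<and> matched \<Lambda>1 \<Lambda>2 a b" for a b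
  proof (cases "length a = length b")
    case True
    then show ?thesis using l by (auto simp: matched_append)
  next
    case False
    then show ?thesis using l matched_length[of \<Lambda>1 \<Lambda>2 "u @ a @ v" "u' @ b @ v'"] matched_length[of \<Lambda>1 \<Lambda>2 a b] by auto
  qed
  show "local_rels \<Lambda>1 \<Lambda>2 (shift u u' v v' (coef \<phi>))"
  proof (cases "matched \<Lambda>1 \<Lambda>2 u u' \<and> matched \<Lambda>1 \<Lambda>2 v v'")
    case True
    have "shift u u' v v' (coef \<phi>) = coef (\<lambda>w. \<phi> (gword u u' @ w @ gword v v'))"
    proof (intro ext)
      fix a b show "shift u u' v v' (coef \<phi>) a b = coef (\<lambda>w. \<phi> (gword u u' @ w @ gword v v')) a b"
        using True l matched_length[of \<Lambda>1 \<Lambda>2 a b] by (auto simp: shift_def coef_def m gword_append)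
    qed
    then show ?thesis
      using local_rels_coef[OF null_translate[OF n, of "gword u u'" "gword v v'"]] True gword_closed by auto
  next
    case False
    then have "shift u u' v v' (coef \<phi>) = (\<lambda>a b. 0)" by (intro ext) (auto simp: shift_def coef_def m)
    then show ?thesis by (simp add: local_rels_0)
  qed
qed

text \<open>
  Modulo the ideal, a starred letter equals the unstarred one; one letter is changed at a time.
\<close>

lemma wval_coef:
  assumes n: "null \<phi>" and w: "w \<in> lists (G \<times> UNIV)"
  shows "wval (coef \<phi>) w = \<phi> w"
proof -
  have m: "matched \<Lambda>1 \<Lambda>2 (map row w) (map col w)"
    by (rule matched_row_col[OF w])
  have "\<phi> (u @ w) = \<phi> (u @ map (\<lambda>(g, s). (g, False)) w)" if "u \<in> lists (G \<times> UNIV)" for u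
    using w that
  proof (induction w arbitrary: u rule: list.induct)
    case (Cons p w)
    then obtain g s where p: "p = (g, s)" "g \<in> G" by (cases p) auto
    have w: "w \<in> lists (G \<times> UNIV)" using Cons.prems by simp
    have n': "null (\<lambda>y. \<phi> (u @ y @ w))" by (rule null_translate[OF n Cons.prems(2) w])
    have "\<phi> (u @ [(g, s)] @ w) = \<phi> (u @ [(g, False)] @ w)"
      using p(2)
    proof (cases rule: gens_cases)
      case (1 v v')
      then show ?thesis using null_verts(1)[OF n' free_gen_closed(1) rels_verts, of v v'] by (cases s) auto
    next
      case (2 v v')
      then show ?thesis using null_edges(1)[OF n' free_gen_closed(2) rels_edges, of v v'] by (cases s) auto
    qed
    then show ?case using Cons.IH[OF w, of "u @ [(g, False)]"] Cons.prems p by simp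
  qed simp
  from this[of "[]"] show ?thesis using m by (simp add: wval_def coef_def gword_row_col)
qed

text \<open>
  A functional that vanishes on the ideal takes the values of its coefficient function, and such functionals
  separate any other element from the ideal.
\<close>

lemma in_I_iff:
  assumes "z \<in> carrier W.R"
  shows "z \<in> P.I \<longleftrightarrow> (\<forall>x\<in>coefs \<Lambda>1 \<Lambda>2. ev (wval x) z = 0)"
proof
  assume a: "\<forall>x\<in>coefs \<Lambda>1 \<Lambda>2. ev (wval x) z = 0"
  show "z \<in> P.I"
  proof (rule ccontr)
    assume "z \<notin> P.I"
    then obtain \<phi> where \<phi>: "null \<phi>" "ev \<phi> z \<noteq> 0" using P.separation[OF assms] by (auto simp: null_def)
    have "ev \<phi> z = ev (wval (coef \<phi>)) z"
      using assms W.R_key[OF assms] by (intro ev_cong refl wval_coef[OF \<phi>(1), symmetric]) simp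
    then show False using a coef_in_coefs[OF \<phi>(1)] \<phi>(2) by auto
  qed
qed (simp add: wval_vanish_on_I)

lemma cl_eqI:
  assumes "z \<in> carrier W.R" "w \<in> carrier W.R" "\<And>x. x \<in> coefs \<Lambda>1 \<Lambda>2 \<Longrightarrow> ev (wval x) z = ev (wval x) w"
  shows "P.cl z = P.cl w"
  using assms by (simp add: P.cl_eq_iff in_I_iff)

lemma val_wval: "x \<in> coefs \<Lambda>1 \<Lambda>2 \<Longrightarrow> z \<in> carrier W.R \<Longrightarrow> P.val (wval x) (P.cl z) = ev (wval x) z"
  by (rule P.val_cl) (auto intro: wval_vanish_on_I)

lemma Q_eqI:
  assumes "X \<in> carrier P.Q" "Y \<in> carrier P.Q" "\<And>x. x \<in> coefs \<Lambda>1 \<Lambda>2 \<Longrightarrow> P.val (wval x) X = P.val (wval x) Y"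
  shows "X = Y"
proof -
  obtain z w where "z \<in> carrier W.R" "X = P.cl z" "w \<in> carrier W.R" "Y = P.cl w"
    using assms(1,2) P.Q_cases by metis
  moreover from this have "P.cl z = P.cl w" using assms(3) by (intro cl_eqI) (simp_all add: val_wval)
  ultimately show ?thesis by simp
qed

definition gcl :: "('v1 + 'e1) list \<Rightarrow> ('v2 + 'e2) list \<Rightarrow> ('v1, 'v2, 'e1, 'e2) qiso_elem" where
  "gcl a b = P.cl (Poly_Mapping.single (gword a b) 1)"

lemma gcl_closed: "matched \<Lambda>1 \<Lambda>2 a b \<Longrightarrow> gcl a b \<in> carrier P.Q"
  unfolding gcl_def using gword_closed by (intro P.cl_closed W.single_closed) simp

lemma gcl_append:
  assumes "matched \<Lambda>1 \<Lambda>2 a b" "matched \<Lambda>1 \<Lambda>2 c d"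
  shows "gcl (a @ c) (b @ d) = gcl a b \<otimes>\<^bsub>P.Q\<^esub> gcl c d"
  unfolding gcl_def gword_append[OF matched_length[OF assms(1)]] using assms gword_closed
  by (subst P.Q_mult) (simp_all add: W.single_mult del: in_lists_conv_set)

lemma gcl_star:
  assumes "matched \<Lambda>1 \<Lambda>2 a b"
  shows "star P.Q (gcl a b) = gcl (rev a) (rev b)"
proof -
  have m: "matched \<Lambda>1 \<Lambda>2 (rev a) (rev b)" using assms by (simp add: matched_rev)
  have w: "gword a b \<in> carrier (word_monoid G)" "gword (rev a) (rev b) \<in> carrier (word_monoid G)"
    using gword_closed assms m by (simp_all del: in_lists_conv_set)
  have "star P.Q (gcl a b) = P.cl (Poly_Mapping.single (word_inv (gword a b)) 1)"
    unfolding gcl_def using w by (subst P.Q_star) (simp_all add: W.single_star del: word_monoid_simps)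
  also have "\<dots> = gcl (rev a) (rev b)"
    unfolding gcl_def
    by (rule cl_eqI) (use assms m w row_col_gword[of a b] row_col_gword[of "rev a" "rev b"] in \<open>auto simp: wval_def matched_def simp del: word_monoid_simps\<close>)
  finally show ?thesis .
qed

lemma val_gcl:
  assumes "x \<in> coefs \<Lambda>1 \<Lambda>2" "matched \<Lambda>1 \<Lambda>2 a b"
  shows "P.val (wval x) (gcl a b) = x a b"
  unfolding gcl_def using assms gword_closed[OF assms(2)] row_col_gword[of a b]
  by (subst val_wval) (auto simp: wval_def matched_def simp del: in_lists_conv_set)

lemma genV_eq: "genV \<Lambda>1 \<Lambda>2 v w = gcl [Inl v] [Inl w]"
  and genE_eq: "genE \<Lambda>1 \<Lambda>2 e f = gcl [Inr e] [Inr f]"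
  by (simp_all add: genV_def genE_def qiso_class_eq gcl_def gword_def free_gen_def)

lemma functional_in_coefs:
  assumes "\<And>X Y. X \<in> carrier P.Q \<Longrightarrow> Y \<in> carrier P.Q \<Longrightarrow> L (X \<oplus>\<^bsub>P.Q\<^esub> Y) = L X + L Y"
    and "\<And>c X. X \<in> carrier P.Q \<Longrightarrow> L (c \<odot>\<^bsub>P.Q\<^esub> X) = c * L X"
  shows "(\<lambda>a b. if matched \<Lambda>1 \<Lambda>2 a b then L (gcl a b) else 0 :: complex) \<in> coefs \<Lambda>1 \<Lambda>2"
proof -
  define \<phi> where "\<phi> w = L (P.cl (Poly_Mapping.single w 1))" for w
  have e: "L (P.cl z) = ev \<phi> z" if "z \<in> carrier W.R" for z
    unfolding \<phi>_def
    by (rule linear_eq_ev[where A = "carrier (word_monoid G)" and L = "\<lambda>z. L (P.cl z)"])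
      (use assms that in \<open>auto simp: P.Q_add[symmetric] P.Q_smult[symmetric] W.R_carrier[symmetric] simp del: word_monoid_simps\<close>)
  have L0: "L \<zero>\<^bsub>P.Q\<^esub> = 0"
    using e[of 0] by (simp add: P.Q_zero)
  have "null \<phi>"
    unfolding null_def
  proof
    fix z assume z: "z \<in> P.I"
    then have "P.cl z = \<zero>\<^bsub>P.Q\<^esub>" by (simp add: P.cl_zero_iff)
    then show "ev \<phi> z = 0" using e[OF P.I_closed[OF z]] L0 by simp
  qed
  then have "coef \<phi> \<in> coefs \<Lambda>1 \<Lambda>2" by (rule coef_in_coefs)
  moreover have "coef \<phi> = (\<lambda>a b. if matched \<Lambda>1 \<Lambda>2 a b then L (gcl a b) else 0)"
    by (intro ext) (simp add: coef_def \<phi>_def gcl_def)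
  ultimately show ?thesis by simp
qed

end


section \<open>Tensor products and coactions\<close>

locale qiso_triple =
  fixes \<Lambda>1 :: "('v1, 'e1) hypergraph" and \<Lambda>2 :: "('v2, 'e2) hypergraph" and \<Lambda>3 :: "('v3, 'e3) hypergraph"
  assumes full1: "full_hypergraph \<Lambda>1" and full2: "full_hypergraph \<Lambda>2" and full3: "full_hypergraph \<Lambda>3"
begin

sublocale A: qiso_pair \<Lambda>1 \<Lambda>2 by unfold_locales (rule full1, rule full2)
sublocale B: qiso_pair \<Lambda>2 \<Lambda>3 by unfold_locales (rule full2, rule full3)
sublocale C: qiso_pair \<Lambda>1 \<Lambda>3 by unfold_locales (rule full1, rule full3)

abbreviation "OA \<equiv> A.P.Q"
abbreviation "OB \<equiv> B.P.Q"
abbreviation "OC \<equiv> C.P.Q"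
abbreviation "MT \<equiv> OA \<times>\<times> OB"
abbreviation "iT \<equiv> map_prod (star OA) (star OB)"

sublocale T0: inv_monoid MT iT
proof -
  interpret a: inv_monoid OA "star OA" by (rule A.P.inv_monoid_Q)
  interpret b: inv_monoid OB "star OB" by (rule B.P.inv_monoid_Q)
  show "inv_monoid MT iT"
    by (intro inv_monoid.intro inv_monoid_axioms.intro DirProd_monoid a.monoid_axioms b.monoid_axioms)
      (auto simp: DirProd_def a.inv_mult b.inv_mult)
qed

lemma MT_simps [simp]:
  "(X, Y) \<in> carrier MT \<longleftrightarrow> X \<in> carrier OA \<and> Y \<in> carrier OB"
  "(X, Y) \<otimes>\<^bsub>MT\<^esub> (X', Y') = (X \<otimes>\<^bsub>OA\<^esub> X', Y \<otimes>\<^bsub>OB\<^esub> Y')"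
  "\<one>\<^bsub>MT\<^esub> = (\<one>\<^bsub>OA\<^esub>, \<one>\<^bsub>OB\<^esub>)"
  by (auto simp: DirProd_def)

lemma bilinear_relations_closed: "bilinear_relations OA OB \<subseteq> carrier T0.R"
  unfolding bilinear_relations_def Let_def
  by (auto intro!: T0.R_diff_closed T0.single_closed simp: A.P.Q_rules B.P.Q_rules)

sublocale T: star_presentation MT iT "bilinear_relations OA OB"
  by unfold_locales (rule bilinear_relations_closed)

lemma tensor_algebra_eq: "tensor_algebra OA OB = T.Q"
  by (simp add: tensor_algebra_def pre_tensor_algebra_def)

lemma tensor_elem_eq: "tensor_elem OA OB X Y = T.cl (Poly_Mapping.single (X, Y) 1)"
  by (simp add: tensor_elem_def pre_tensor_algebra_def)

definition bilinear where
  "bilinear \<psi> \<longleftrightarrow>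
     (\<forall>X\<in>carrier OA. \<forall>X'\<in>carrier OA. \<forall>Y\<in>carrier OB. \<psi> (X \<oplus>\<^bsub>OA\<^esub> X', Y) = \<psi> (X, Y) + \<psi> (X', Y)) \<and>
     (\<forall>X\<in>carrier OA. \<forall>Y\<in>carrier OB. \<forall>Y'\<in>carrier OB. \<psi> (X, Y \<oplus>\<^bsub>OB\<^esub> Y') = \<psi> (X, Y) + \<psi> (X, Y')) \<and>
     (\<forall>c. \<forall>X\<in>carrier OA. \<forall>Y\<in>carrier OB. \<psi> (c \<odot>\<^bsub>OA\<^esub> X, Y) = c * \<psi> (X, Y)) \<and>
     (\<forall>c. \<forall>X\<in>carrier OA. \<forall>Y\<in>carrier OB. \<psi> (X, c \<odot>\<^bsub>OB\<^esub> Y) = (c :: complex) * \<psi> (X, Y))"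

text \<open>
  Functionals on the tensor product are exactly the bilinear forms. This direction uses that the bilinear
  forms are stable under translations and under the involution.
\<close>

lemma bilinear_null:
  assumes "bilinear \<psi>" "z \<in> T.I"
  shows "ev \<psi> z = 0"
proof (rule T.null_family[where \<F> = "Collect bilinear"])
  fix \<psi> assume "\<psi> \<in> Collect bilinear"
  then have b: "bilinear \<psi>" by simp
  show "ev \<psi> r = 0" if "r \<in> bilinear_relations OA OB" for r
    using that b unfolding bilinear_relations_def Let_def bilinear_def by auto
  show "(\<lambda>y. \<psi> (x \<otimes>\<^bsub>MT\<^esub> y)) \<in> Collect bilinear" if "x \<in> carrier MT" for x
    using that b by (cases x) (auto simp: bilinear_def A.P.Q_rules B.P.Q_rules)
  show "(\<lambda>y. \<psi> (y \<otimes>\<^bsub>MT\<^esub> x)) \<in> Collect bilinear" if "x \<in> carrier MT" for x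
    using that b by (cases x) (auto simp: bilinear_def A.P.Q_rules B.P.Q_rules)
  show "(\<lambda>x. cnj (\<psi> (iT x))) \<in> Collect bilinear"
    using b by (auto simp: bilinear_def A.P.Q_rules B.P.Q_rules)
qed (use assms in auto)

lemma null_bilinear:
  assumes n: "\<And>f. f \<in> T.I \<Longrightarrow> ev \<psi> f = 0"
  shows "bilinear \<psi>"
proof -
  have r: "ev \<psi> r = 0" if "r \<in> bilinear_relations OA OB" for r
    using n T.S_in_I that by auto
  show ?thesis
    unfolding bilinear_def
  proof (intro conjI ballI allI)
    fix X X' Y assume "X \<in> carrier OA" "X' \<in> carrier OA" "Y \<in> carrier OB"
    then have "Poly_Mapping.single (X \<oplus>\<^bsub>OA\<^esub> X', Y) 1 - Poly_Mapping.single (X, Y) 1 - Poly_Mapping.single (X', Y) 1 \<in> bilinear_relations OA OB"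
      unfolding bilinear_relations_def Let_def by blast
    from r[OF this] show "\<psi> (X \<oplus>\<^bsub>OA\<^esub> X', Y) = \<psi> (X, Y) + \<psi> (X', Y)" by (simp add: algebra_simps)
  next
    fix X Y Y' assume "X \<in> carrier OA" "Y \<in> carrier OB" "Y' \<in> carrier OB"
    then have "Poly_Mapping.single (X, Y \<oplus>\<^bsub>OB\<^esub> Y') 1 - Poly_Mapping.single (X, Y) 1 - Poly_Mapping.single (X, Y') 1 \<in> bilinear_relations OA OB"
      unfolding bilinear_relations_def Let_def by blast
    from r[OF this] show "\<psi> (X, Y \<oplus>\<^bsub>OB\<^esub> Y') = \<psi> (X, Y) + \<psi> (X, Y')" by (simp add: algebra_simps)
  next
    fix c X Y assume "X \<in> carrier OA" "Y \<in> carrier OB"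
    then have "Poly_Mapping.single (c \<odot>\<^bsub>OA\<^esub> X, Y) 1 - Poly_Mapping.single (X, Y) c \<in> bilinear_relations OA OB"
      unfolding bilinear_relations_def Let_def by blast
    from r[OF this] show "\<psi> (c \<odot>\<^bsub>OA\<^esub> X, Y) = c * \<psi> (X, Y)" by simp
  next
    fix c X Y assume "X \<in> carrier OA" "Y \<in> carrier OB"
    then have "Poly_Mapping.single (X, c \<odot>\<^bsub>OB\<^esub> Y) 1 - Poly_Mapping.single (X, Y) c \<in> bilinear_relations OA OB"
      unfolding bilinear_relations_def Let_def by blast
    from r[OF this] show "\<psi> (X, c \<odot>\<^bsub>OB\<^esub> Y) = c * \<psi> (X, Y)" by simp
  qed
qed


subsection \<open>Slice maps\<close>

text \<open>
  The slice of a representative is determined by its values under the functionals of \<open>\<O> \<Lambda>1 \<Lambda>2\<close>. Each of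
  them, combined with \<open>\<tau>\<close>, is a bilinear form, hence insensitive to the choice of the representative.
\<close>

lemma slice_right_cl:
  assumes \<tau>: "linear_functional OB \<tau>" and f: "f \<in> carrier T0.R"
  shows "slice_right OA \<tau> (T.cl f) \<in> carrier OA"
    and "x \<in> coefs \<Lambda>1 \<Lambda>2 \<Longrightarrow>
      A.P.val (wval x) (slice_right OA \<tau> (T.cl f)) = ev (\<lambda>p. A.P.val (wval x) (fst p) * \<tau> (snd p)) f"
proof -
  interpret a: abelian_group OA by (rule A.P.abelian_group_Q)
  define s where "s f = (\<Oplus>\<^bsub>OA\<^esub>p\<in>Poly_Mapping.keys f. (Poly_Mapping.lookup f p * \<tau> (snd p)) \<odot>\<^bsub>OA\<^esub> fst p)" for f
  have k: "fst p \<in> carrier OA" if "g \<in> carrier T0.R" "p \<in> Poly_Mapping.keys g" for g p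
    using T0.R_key[OF that] by (cases p) auto
  have sc: "s g \<in> carrier OA" if "g \<in> carrier T0.R" for g
    unfolding s_def using k[OF that] by (intro a.finsum_closed) (auto simp: A.P.Q_rules)
  have sv: "A.P.val (wval x) (s g) = ev (\<lambda>p. A.P.val (wval x) (fst p) * \<tau> (snd p)) g"
    if "g \<in> carrier T0.R" "x \<in> coefs \<Lambda>1 \<Lambda>2" for g x
    unfolding s_def ev_def using k[OF that(1)] A.wval_vanish_on_I[OF that(2)]
    by (subst A.P.val_finsum) (auto simp: A.P.Q_rules A.P.val_smult mult_ac)
  have same: "s g = s f" if g: "g \<in> T.cl f" for g
  proof -
    obtain i where i: "i \<in> T.I" "g = i + f" using g by (auto simp: T.cl_def')
    have gc: "g \<in> carrier T0.R" using i f T.I_closed by simp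
    show ?thesis
    proof (rule A.Q_eqI[OF sc[OF gc] sc[OF f]])
      fix x assume x: "x \<in> coefs \<Lambda>1 \<Lambda>2"
      have "bilinear (\<lambda>p. A.P.val (wval x) (fst p) * \<tau> (snd p))"
        using \<tau> A.wval_vanish_on_I[OF x] by (auto simp: bilinear_def linear_functional_def A.P.val_add A.P.val_smult algebra_simps)
      from bilinear_null[OF this i(1)]
      show "A.P.val (wval x) (s g) = A.P.val (wval x) (s f)" unfolding sv[OF gc x] sv[OF f x] unfolding i(2) by simp
    qed
  qed
  have "s ` T.cl f = {s f}"
  proof (intro subset_antisym subsetI)
    show "y \<in> {s f}" if "y \<in> s ` T.cl f" for y using that same by (elim imageE) simp
    show "y \<in> s ` T.cl f" if "y \<in> {s f}" for y
      using that imageI[OF T.cl_self[of f], of s] by (simp only: singleton_iff)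
  qed
  moreover have "slice_right OA \<tau> (T.cl f) = the_elem (s ` T.cl f)"
    unfolding slice_right_def s_def[abs_def] by (rule refl)
  ultimately have "slice_right OA \<tau> (T.cl f) = s f" by (simp only: the_elem_eq)
  then show "slice_right OA \<tau> (T.cl f) \<in> carrier OA"
    and "x \<in> coefs \<Lambda>1 \<Lambda>2 \<Longrightarrow>
      A.P.val (wval x) (slice_right OA \<tau> (T.cl f)) = ev (\<lambda>p. A.P.val (wval x) (fst p) * \<tau> (snd p)) f"
    using sc[OF f] sv[OF f] by simp_all
qed

lemma slice_left_cl:
  assumes \<tau>: "linear_functional OA \<tau>" and f: "f \<in> carrier T0.R"
  shows "slice_left OB \<tau> (T.cl f) \<in> carrier OB"
    and "x \<in> coefs \<Lambda>2 \<Lambda>3 \<Longrightarrow>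
      B.P.val (wval x) (slice_left OB \<tau> (T.cl f)) = ev (\<lambda>p. \<tau> (fst p) * B.P.val (wval x) (snd p)) f"
proof -
  interpret b: abelian_group OB by (rule B.P.abelian_group_Q)
  define s where "s f = (\<Oplus>\<^bsub>OB\<^esub>p\<in>Poly_Mapping.keys f. (Poly_Mapping.lookup f p * \<tau> (fst p)) \<odot>\<^bsub>OB\<^esub> snd p)" for f
  have k: "snd p \<in> carrier OB" if "g \<in> carrier T0.R" "p \<in> Poly_Mapping.keys g" for g p
    using T0.R_key[OF that] by (cases p) auto
  have sc: "s g \<in> carrier OB" if "g \<in> carrier T0.R" for g
    unfolding s_def using k[OF that] by (intro b.finsum_closed) (auto simp: B.P.Q_rules)
  have sv: "B.P.val (wval x) (s g) = ev (\<lambda>p. \<tau> (fst p) * B.P.val (wval x) (snd p)) g"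
    if "g \<in> carrier T0.R" "x \<in> coefs \<Lambda>2 \<Lambda>3" for g x
    unfolding s_def ev_def using k[OF that(1)] B.wval_vanish_on_I[OF that(2)]
    by (subst B.P.val_finsum) (auto simp: B.P.Q_rules B.P.val_smult mult_ac)
  have same: "s g = s f" if g: "g \<in> T.cl f" for g
  proof -
    obtain i where i: "i \<in> T.I" "g = i + f" using g by (auto simp: T.cl_def')
    have gc: "g \<in> carrier T0.R" using i f T.I_closed by simp
    show ?thesis
    proof (rule B.Q_eqI[OF sc[OF gc] sc[OF f]])
      fix x assume x: "x \<in> coefs \<Lambda>2 \<Lambda>3"
      have "bilinear (\<lambda>p. \<tau> (fst p) * B.P.val (wval x) (snd p))"
        using \<tau> B.wval_vanish_on_I[OF x] by (auto simp: bilinear_def linear_functional_def B.P.val_add B.P.val_smult algebra_simps)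
      from bilinear_null[OF this i(1)]
      show "B.P.val (wval x) (s g) = B.P.val (wval x) (s f)" unfolding sv[OF gc x] sv[OF f x] unfolding i(2) by simp
    qed
  qed
  have "s ` T.cl f = {s f}"
  proof (intro subset_antisym subsetI)
    show "y \<in> {s f}" if "y \<in> s ` T.cl f" for y using that same by (elim imageE) simp
    show "y \<in> s ` T.cl f" if "y \<in> {s f}" for y
      using that imageI[OF T.cl_self[of f], of s] by (simp only: singleton_iff)
  qed
  moreover have "slice_left OB \<tau> (T.cl f) = the_elem (s ` T.cl f)"
    unfolding slice_left_def s_def[abs_def] by (rule refl)
  ultimately have "slice_left OB \<tau> (T.cl f) = s f" by (simp only: the_elem_eq)
  then show "slice_left OB \<tau> (T.cl f) \<in> carrier OB"
    and "x \<in> coefs \<Lambda>2 \<Lambda>3 \<Longrightarrow>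
      B.P.val (wval x) (slice_left OB \<tau> (T.cl f)) = ev (\<lambda>p. \<tau> (fst p) * B.P.val (wval x) (snd p)) f"
    using sc[OF f] sv[OF f] by simp_all
qed


subsection \<open>The comultiplication\<close>

text \<open>
  One summand of the comultiplication of the word product \<open>p(a, b)\<close>. The coefficient
  removes words \<open>c\<close> that do not match.
\<close>

definition pairing where
  "pairing a b c = Poly_Mapping.single (A.gcl a c, B.gcl c b) (if map isl c = map isl a then 1 else 0 :: complex)"

definition comult_word where
  "comult_word w = (\<Sum>c\<in>words (letters \<Lambda>2) (length w). pairing (map row w) (map col w) c)"

text \<open>
  The homomorphism \<open>\<O> \<Lambda>1 \<Lambda>3 \<rightarrow> \<O> \<Lambda>1 \<Lambda>2 \<otimes> \<O> \<Lambda>2 \<Lambda>3\<close>; its cases \<open>\<Lambda>2 = \<Lambda>1\<close> and \<open>\<Lambda>2 = \<Lambda>3\<close> are the two coactions.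
\<close>

definition comult where
  "comult X = T.cl (lin_ext comult_word (SOME z. z \<in> carrier C.W.R \<and> X = C.P.cl z))"

lemma matched_middle:
  assumes "matched \<Lambda>1 \<Lambda>3 a b" "c \<in> words (letters \<Lambda>2) n" "map isl c = map isl a"
  shows "matched \<Lambda>1 \<Lambda>2 a c" "matched \<Lambda>2 \<Lambda>3 c b"
  using assms by (auto simp: matched_def words_def)

lemma pairing_closed:
  assumes "matched \<Lambda>1 \<Lambda>3 a b" "c \<in> words (letters \<Lambda>2) n"
  shows "pairing a b c \<in> carrier T0.R"
  using matched_middle[OF assms] by (auto simp: pairing_def A.gcl_closed B.gcl_closed)

lemma comult_word_closed: "w \<in> lists (C.G \<times> UNIV) \<Longrightarrow> comult_word w \<in> carrier T0.R"
  unfolding comult_word_def by (intro T0.R_sum_closed pairing_closed C.matched_row_col)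

lemma lin_ext_comult_closed: "z \<in> carrier C.W.R \<Longrightarrow> lin_ext comult_word z \<in> carrier T0.R"
  unfolding T0.R_carrier using comult_word_closed C.W.R_key
  by (intro keys_lin_ext) (simp add: T0.R_carrier del: in_lists_conv_set)

lemma comult_word_append:
  assumes u: "u \<in> lists (C.G \<times> UNIV)" and v: "v \<in> lists (C.G \<times> UNIV)"
  shows "comult_word (u @ v) = comult_word u \<otimes>\<^bsub>T0.R\<^esub> comult_word v"
proof (rule ev_eqI)
  fix \<psi>
  have p: "ev \<psi> (pairing (map row (u @ v)) (map col (u @ v)) (c @ d)) =
    ev (\<lambda>p. ev (\<lambda>q. \<psi> (p \<otimes>\<^bsub>MT\<^esub> q)) (pairing (map row v) (map col v) d)) (pairing (map row u) (map col u) c)"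
    if c: "c \<in> words (letters \<Lambda>2) (length u)" and d: "d \<in> words (letters \<Lambda>2) (length v)" for c d
  proof (cases "map isl c = map isl (map row u) \<and> map isl d = map isl (map row v)")
    case True
    then show ?thesis
      using matched_middle[OF C.matched_row_col[OF u] c] matched_middle[OF C.matched_row_col[OF v] d]
      by (simp add: pairing_def A.gcl_append B.gcl_append)
  next
    case False
    then have "map isl (c @ d) \<noteq> map isl (map row (u @ v))" using c by (auto simp: words_def)
    then show ?thesis using False by (auto simp: pairing_def)
  qed
  have "ev \<psi> (comult_word (u @ v)) = (\<Sum>c\<in>words (letters \<Lambda>2) (length u). \<Sum>d\<in>words (letters \<Lambda>2) (length v).
     ev \<psi> (pairing (map row (u @ v)) (map col (u @ v)) (c @ d)))"
    unfolding comult_word_def length_append sum_words_append by simp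
  also have "\<dots> = (\<Sum>c\<in>words (letters \<Lambda>2) (length u). \<Sum>d\<in>words (letters \<Lambda>2) (length v).
     ev (\<lambda>p. ev (\<lambda>q. \<psi> (p \<otimes>\<^bsub>MT\<^esub> q)) (pairing (map row v) (map col v) d)) (pairing (map row u) (map col u) c))"
    by (intro sum.cong refl p)
  also have "\<dots> = ev \<psi> (comult_word u \<otimes>\<^bsub>T0.R\<^esub> comult_word v)"
    unfolding T0.ev_mult by (simp add: comult_word_def ev_fun_sum) (rule sum.swap)
  finally show "ev \<psi> (comult_word (u @ v)) = ev \<psi> (comult_word u \<otimes>\<^bsub>T0.R\<^esub> comult_word v)" .
qed

lemma comult_word_inv:
  assumes w: "w \<in> lists (C.G \<times> UNIV)"
  shows "comult_word (word_inv w) = star T0.R (comult_word w)"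
proof (rule ev_eqI)
  fix \<psi>
  have len: "length (word_inv w) = length w" by (simp add: word_inv_def)
  have p: "ev \<psi> (pairing (rev (map row w)) (rev (map col w)) (rev c)) =
      cnj (ev (\<lambda>x. cnj (\<psi> (iT x))) (pairing (map row w) (map col w) c))"
    if c: "c \<in> words (letters \<Lambda>2) (length w)" for c
  proof (cases "map isl c = map isl (map row w)")
    case True
    then have "map isl (rev c) = map isl (rev (map row w))" by (simp add: rev_map[symmetric])
    then show ?thesis
      using matched_middle[OF C.matched_row_col[OF w] c True] True by (simp add: pairing_def A.gcl_star B.gcl_star)
  next
    case False
    then have "map isl (rev c) \<noteq> map isl (rev (map row w))" by (simp add: rev_map[symmetric])
    then show ?thesis using False by (simp add: pairing_def)
  qed
  have "ev \<psi> (comult_word (word_inv w)) = (\<Sum>c\<in>words (letters \<Lambda>2) (length w). ev \<psi> (pairing (rev (map row w)) (rev (map col w)) (rev c)))"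
    unfolding comult_word_def row_col_word_inv len using sum_words_rev[of "pairing (rev (map row w)) (rev (map col w))" "letters \<Lambda>2" "length w"]
    by (simp flip: ev_sum)
  also have "\<dots> = cnj (ev (\<lambda>x. cnj (\<psi> (iT x))) (comult_word w))"
    unfolding comult_word_def ev_sum cnj_sum by (intro sum.cong refl p)
  finally show "ev \<psi> (comult_word (word_inv w)) = ev \<psi> (star T0.R (comult_word w))" by (simp add: T0.ev_star)
qed

lemma lin_ext_comult_mult:
  assumes f: "f \<in> carrier C.W.R" and g: "g \<in> carrier C.W.R"
  shows "lin_ext comult_word (f \<otimes>\<^bsub>C.W.R\<^esub> g) = lin_ext comult_word f \<otimes>\<^bsub>T0.R\<^esub> lin_ext comult_word g"
proof (rule ev_eqI)
  fix \<psi>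
  have "ev \<psi> (lin_ext comult_word (f \<otimes>\<^bsub>C.W.R\<^esub> g)) = ev (\<lambda>u. ev (\<lambda>v. ev \<psi> (comult_word (u @ v))) g) f"
    by (simp add: C.W.ev_mult)
  also have "\<dots> = ev (\<lambda>u. ev (\<lambda>v. ev (\<lambda>p. ev (\<lambda>q. \<psi> (p \<otimes>\<^bsub>MT\<^esub> q)) (comult_word v)) (comult_word u)) g) f"
    by (rule ev_cong[OF refl], rule ev_cong[OF refl])
      (use C.W.R_key[OF f] C.W.R_key[OF g] in \<open>simp add: comult_word_append T0.ev_mult del: in_lists_conv_set\<close>)
  also have "\<dots> = ev (\<lambda>u. ev (\<lambda>p. ev (\<lambda>v. ev (\<lambda>q. \<psi> (p \<otimes>\<^bsub>MT\<^esub> q)) (comult_word v)) g) (comult_word u)) f"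
    by (rule ev_cong[OF refl], rule ev_swap)
  also have "\<dots> = ev \<psi> (lin_ext comult_word f \<otimes>\<^bsub>T0.R\<^esub> lin_ext comult_word g)"
    by (simp add: T0.ev_mult)
  finally show "ev \<psi> (lin_ext comult_word (f \<otimes>\<^bsub>C.W.R\<^esub> g)) = ev \<psi> (lin_ext comult_word f \<otimes>\<^bsub>T0.R\<^esub> lin_ext comult_word g)" .
qed

lemma lin_ext_comult_star:
  assumes f: "f \<in> carrier C.W.R"
  shows "lin_ext comult_word (star C.W.R f) = star T0.R (lin_ext comult_word f)"
proof (rule ev_eqI)
  fix \<psi>
  have "ev \<psi> (lin_ext comult_word (star C.W.R f)) = cnj (ev (\<lambda>w. cnj (ev \<psi> (comult_word (word_inv w)))) f)"
    by (simp add: C.W.ev_star)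
  also have "ev (\<lambda>w. cnj (ev \<psi> (comult_word (word_inv w)))) f = ev (\<lambda>w. ev (\<lambda>x. cnj (\<psi> (iT x))) (comult_word w)) f"
    using C.W.R_key[OF f]
    by (intro ev_cong refl) (simp add: comult_word_inv T0.ev_star del: in_lists_conv_set)
  finally show "ev \<psi> (lin_ext comult_word (star C.W.R f)) = ev \<psi> (star T0.R (lin_ext comult_word f))"
    by (simp add: T0.ev_star)
qed

lemma ev_comult_word:
  assumes w: "w \<in> lists (C.G \<times> UNIV)"
    and \<Phi>: "\<And>a c c' b. matched \<Lambda>1 \<Lambda>2 a c \<Longrightarrow> matched \<Lambda>2 \<Lambda>3 c' b \<Longrightarrow> \<psi> (A.gcl a c, B.gcl c' b) = \<Phi> a c c' b"
    and z: "\<And>a c c' b. \<not> matched \<Lambda>1 \<Lambda>2 a c \<Longrightarrow> \<Phi> a c c' b = 0"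
  shows "ev \<psi> (comult_word w) = wval (convolve \<Lambda>2 \<Phi>) w"
proof -
  have "ev \<psi> (pairing (map row w) (map col w) c) = \<Phi> (map row w) c c (map col w)"
    if c: "c \<in> words (letters \<Lambda>2) (length w)" for c
  proof (cases "map isl c = map isl (map row w)")
    case True
    then show ?thesis using matched_middle[OF C.matched_row_col[OF w] c True] \<Phi> by (simp add: pairing_def)
  next
    case False
    then have "\<not> matched \<Lambda>1 \<Lambda>2 (map row w) c" by (auto simp: matched_def)
    then show ?thesis using z False by (auto simp: pairing_def)
  qed
  then show ?thesis by (simp add: comult_word_def wval_def convolve_def)
qed

text \<open>
  A functional on the tensor product is a bilinear form, and its composition with the comultiplication of words
  is the coefficient function \<^const>\<open>convolve\<close> of this form, which vanishes on the ideal. As functionals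
  separate the points of the tensor product, the ideal is mapped to zero.
\<close>

lemma lin_ext_comult_I:
  assumes z: "z \<in> C.P.I"
  shows "lin_ext comult_word z \<in> T.I"
proof (rule ccontr)
  assume "lin_ext comult_word z \<notin> T.I"
  then obtain \<psi> where n: "\<And>f. f \<in> T.I \<Longrightarrow> ev \<psi> f = 0" and nz: "ev \<psi> (lin_ext comult_word z) \<noteq> 0"
    using T.separation[OF lin_ext_comult_closed[OF C.P.I_closed[OF z]]] by blast
  have bil: "bilinear \<psi>" by (rule null_bilinear) (rule n)
  define \<Phi> where "\<Phi> a c c' b = (if matched \<Lambda>1 \<Lambda>2 a c \<and> matched \<Lambda>2 \<Lambda>3 c' b then \<psi> (A.gcl a c, B.gcl c' b) else 0)" for a c c' b
  have "convolve \<Lambda>2 \<Phi> \<in> coefs \<Lambda>1 \<Lambda>3"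
  proof (rule convolve_in_coefs)
    show "(\<lambda>a c. \<Phi> a c c' b) \<in> coefs \<Lambda>1 \<Lambda>2" for c' b
    proof (cases "matched \<Lambda>2 \<Lambda>3 c' b")
      case True
      then show ?thesis
        using A.functional_in_coefs[of "\<lambda>X. \<psi> (X, B.gcl c' b)"] bil B.gcl_closed[OF True]
        by (simp add: \<Phi>_def bilinear_def)
    qed (simp add: \<Phi>_def coefs_0)
    show "(\<lambda>c' b. \<Phi> a c c' b) \<in> coefs \<Lambda>2 \<Lambda>3" for a c
    proof (cases "matched \<Lambda>1 \<Lambda>2 a c")
      case True
      then show ?thesis
        using B.functional_in_coefs[of "\<lambda>Y. \<psi> (A.gcl a c, Y)"] bil A.gcl_closed[OF True]
        by (simp add: \<Phi>_def bilinear_def)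
    qed (simp add: \<Phi>_def coefs_0)
  qed (simp add: full2)
  then have "ev (wval (convolve \<Lambda>2 \<Phi>)) z = 0" by (rule C.wval_vanish_on_I) (rule z)
  moreover have "ev \<psi> (lin_ext comult_word z) = ev (wval (convolve \<Lambda>2 \<Phi>)) z"
    unfolding ev_lin_ext using C.W.R_key[OF C.P.I_closed[OF z]]
    by (intro ev_cong refl ev_comult_word) (simp_all add: \<Phi>_def del: in_lists_conv_set)
  ultimately show False using nz by simp
qed

lemma comult_cl:
  assumes z: "z \<in> carrier C.W.R"
  shows "comult (C.P.cl z) = T.cl (lin_ext comult_word z)"
proof -
  define w where "w = (SOME w. w \<in> carrier C.W.R \<and> C.P.cl z = C.P.cl w)"
  have "w \<in> carrier C.W.R \<and> C.P.cl z = C.P.cl w"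
    unfolding w_def by (rule someI[of _ z]) (simp add: z)
  then have "w - z \<in> C.P.I" by (metis C.P.cl_eq_iff)
  from lin_ext_comult_I[OF this] have "T.cl (lin_ext comult_word w) = T.cl (lin_ext comult_word z)"
    by (simp add: T.cl_eq_iff lin_ext_diff)
  then show ?thesis by (simp add: comult_def w_def[symmetric])
qed

lemma comult_hom: "unital_star_hom OC T.Q comult"
proof -
  have one: "lin_ext comult_word \<one>\<^bsub>C.W.R\<^esub> = \<one>\<^bsub>T0.R\<^esub>"
    unfolding C.W.R_one lin_ext_single
    by (simp add: comult_word_def pairing_def T0.R_one A.P.Q_one B.P.Q_one A.gcl_def B.gcl_def A.W.R_one B.W.R_one)
  show ?thesis
    unfolding unital_star_hom_def
  proof (intro conjI allI ballI ring_hom_memI)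
    fix X assume "X \<in> carrier OC"
    then show "comult X \<in> carrier T.Q"
      by (elim C.P.Q_cases) (simp add: comult_cl lin_ext_comult_closed)
    show "comult (c \<odot>\<^bsub>OC\<^esub> X) = c \<odot>\<^bsub>T.Q\<^esub> comult X" for c
      using \<open>X \<in> carrier OC\<close>
      by (elim C.P.Q_cases) (simp add: C.P.Q_smult comult_cl lin_ext_scale T.Q_smult lin_ext_comult_closed)
    show "comult (star OC X) = star T.Q (comult X)"
      using \<open>X \<in> carrier OC\<close>
      by (elim C.P.Q_cases) (simp add: C.P.Q_star comult_cl lin_ext_comult_star T.Q_star lin_ext_comult_closed)
    fix Y assume "Y \<in> carrier OC"
    show "comult (X \<otimes>\<^bsub>OC\<^esub> Y) = comult X \<otimes>\<^bsub>T.Q\<^esub> comult Y"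
      using \<open>X \<in> carrier OC\<close> \<open>Y \<in> carrier OC\<close>
      by (elim C.P.Q_cases) (simp add: C.P.Q_mult comult_cl lin_ext_comult_mult T.Q_mult lin_ext_comult_closed)
    show "comult (X \<oplus>\<^bsub>OC\<^esub> Y) = comult X \<oplus>\<^bsub>T.Q\<^esub> comult Y"
      using \<open>X \<in> carrier OC\<close> \<open>Y \<in> carrier OC\<close>
      by (elim C.P.Q_cases) (simp add: C.P.Q_add comult_cl lin_ext_add T.Q_add lin_ext_comult_closed)
  next
    show "comult \<one>\<^bsub>OC\<^esub> = \<one>\<^bsub>T.Q\<^esub>"
      by (simp add: C.P.Q_one comult_cl one T.Q_one)
  qed
qed

lemma comult_genV:
  assumes "i \<in> verts \<Lambda>1" "j \<in> verts \<Lambda>3"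
  shows "comult (genV \<Lambda>1 \<Lambda>3 i j) = (\<Oplus>\<^bsub>T.Q\<^esub>k\<in>verts \<Lambda>2. tensor_elem OA OB (genV \<Lambda>1 \<Lambda>2 i k) (genV \<Lambda>2 \<Lambda>3 k j))"
proof -
  have w: "[(VGen i j, False)] \<in> lists (C.G \<times> UNIV)" using assms by (auto simp: qiso_gens_def)
  have "comult (genV \<Lambda>1 \<Lambda>3 i j) = T.cl (comult_word [(VGen i j, False)])"
    using w by (simp add: genV_def C.qiso_class_eq free_gen_def comult_cl lin_ext_single del: in_lists_conv_set)
  also have "comult_word [(VGen i j, False)] = (\<Sum>k\<in>verts \<Lambda>2. Poly_Mapping.single (genV \<Lambda>1 \<Lambda>2 i k, genV \<Lambda>2 \<Lambda>3 k j) 1)"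
    by (simp add: comult_word_def sum_letters[OF full2] pairing_def A.genV_eq B.genV_eq)
  finally show ?thesis
    unfolding tensor_elem_eq using assms
    by (subst T.Q_finsum) (auto simp: A.genV_eq B.genV_eq matched_def letters_def intro!: T0.single_closed A.gcl_closed B.gcl_closed)
qed

lemma comult_genE:
  assumes "i \<in> edges \<Lambda>1" "j \<in> edges \<Lambda>3"
  shows "comult (genE \<Lambda>1 \<Lambda>3 i j) = (\<Oplus>\<^bsub>T.Q\<^esub>k\<in>edges \<Lambda>2. tensor_elem OA OB (genE \<Lambda>1 \<Lambda>2 i k) (genE \<Lambda>2 \<Lambda>3 k j))"
proof -
  have w: "[(EGen i j, False)] \<in> lists (C.G \<times> UNIV)" using assms by (auto simp: qiso_gens_def)
  have "comult (genE \<Lambda>1 \<Lambda>3 i j) = T.cl (comult_word [(EGen i j, False)])"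
    using w by (simp add: genE_def C.qiso_class_eq free_gen_def comult_cl lin_ext_single del: in_lists_conv_set)
  also have "comult_word [(EGen i j, False)] = (\<Sum>k\<in>edges \<Lambda>2. Poly_Mapping.single (genE \<Lambda>1 \<Lambda>2 i k, genE \<Lambda>2 \<Lambda>3 k j) 1)"
    by (simp add: comult_word_def sum_letters[OF full2] pairing_def A.genE_eq B.genE_eq)
  finally show ?thesis
    unfolding tensor_elem_eq using assms
    by (subst T.Q_finsum) (auto simp: A.genE_eq B.genE_eq matched_def letters_def intro!: T0.single_closed A.gcl_closed B.gcl_closed)
qed

lemma ev_comult_product:
  assumes x: "x \<in> coefs \<Lambda>1 \<Lambda>2" and y: "y \<in> coefs \<Lambda>2 \<Lambda>3" and z: "z \<in> carrier C.W.R"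
  shows "ev (\<lambda>p. A.P.val (wval x) (fst p) * B.P.val (wval y) (snd p)) (lin_ext comult_word z) = ev (wval (conv \<Lambda>2 x y)) z"
  unfolding ev_lin_ext conv_def using C.W.R_key[OF z] coefs_support[OF x]
  by (intro ev_cong refl ev_comult_word)
    (simp_all add: A.val_gcl[OF x] B.val_gcl[OF y] del: in_lists_conv_set)

end


section \<open>The bi-invariant tracial state\<close>

locale qiso_nonzero = qiso_pair \<Lambda>1 \<Lambda>2
  for \<Lambda>1 :: "('v1, 'e1) hypergraph" and \<Lambda>2 :: "('v2, 'e2) hypergraph" +
  assumes nonzero: "carrier (\<O> \<Lambda>1 \<Lambda>2) \<noteq> {\<zero>\<^bsub>\<O> \<Lambda>1 \<Lambda>2\<^esub>}"
begin

lemma one_notin_I: "\<one>\<^bsub>W.R\<^esub> \<notin> P.I"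
proof
  assume 1: "\<one>\<^bsub>W.R\<^esub> \<in> P.I"
  have z: "P.cl z = \<zero>\<^bsub>P.Q\<^esub>" if "z \<in> carrier W.R" for z
    using P.I_mult_left[OF 1 that] that by (simp add: P.cl_zero_iff W.R_r_one)
  have "X = \<zero>\<^bsub>P.Q\<^esub>" if "X \<in> carrier P.Q" for X
    using that by (elim P.Q_cases) (simp add: z)
  then have "carrier P.Q = {\<zero>\<^bsub>P.Q\<^esub>}" using P.Q_rules(12) by blast
  then show False using nonzero by (simp add: O_eq)
qed

sublocale L: linked \<Lambda>1 \<Lambda>2
proof
  obtain x where "x \<in> coefs \<Lambda>1 \<Lambda>2" "ev (wval x) \<one>\<^bsub>W.R\<^esub> \<noteq> 0"
    using one_notin_I in_I_iff by auto
  then show "\<exists>x\<in>coefs \<Lambda>1 \<Lambda>2. x [] [] \<noteq> 0" by (auto simp: W.R_one wval_def)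
qed (rule full1, rule full2)

abbreviation "h \<equiv> wval L.haar"

definition \<tau> :: "('v1, 'v2, 'e1, 'e2) qiso_elem \<Rightarrow> complex" where
  "\<tau> = P.val h"

lemma \<tau>_cl: "z \<in> carrier W.R \<Longrightarrow> \<tau> (P.cl z) = ev h z"
  unfolding \<tau>_def by (rule val_wval[OF L.haar_in_D])

definition ip where
  "ip z w = ev h (star W.R z \<otimes>\<^bsub>W.R\<^esub> w)"

lemma ip_eq: "ip z w = (\<Sum>u\<in>Poly_Mapping.keys z. \<Sum>v\<in>Poly_Mapping.keys w.
    cnj (Poly_Mapping.lookup z u) * Poly_Mapping.lookup w v * L.gram (map row u) (map col u) (map row v) (map col v))"
proof -
  have g: "h (word_inv u @ v) = L.gram (map row u) (map col u) (map row v) (map col v)" for u v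
    by (simp add: wval_def L.gram_def)
  have "ip z w = cnj (ev (\<lambda>u. cnj (ev (\<lambda>v. h (word_inv u @ v)) w)) z)"
    by (simp add: ip_def W.ev_mult W.ev_star)
  then show ?thesis by (simp add: ev_def g sum_distrib_left mult.assoc)
qed

text \<open>
  Distinct words of the free algebra can have the same row and column words, because of starred letters;
  their coefficients are added up.
\<close>

lemma collect_coefficients:
  assumes "z \<in> carrier W.R"
  shows "\<exists>N v. \<forall>g. (\<Sum>u\<in>Poly_Mapping.keys z. Poly_Mapping.lookup z u * g (map row u, map col u)) =
    (\<Sum>p\<in>ball L.I N \<times> ball L.J N. case_prod v p * (g p :: complex))"
proof -
  let ?K = "Poly_Mapping.keys z"
  define rc where "rc u = (map row u, map col u)" for u :: "(('v1, 'v2, 'e1, 'e2) qiso_gen \<times> bool) list"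
  define N where "N = Max (insert 0 (length ` ?K))"
  define v where "v a b = (\<Sum>u\<in>{u\<in>?K. rc u = (a, b)}. Poly_Mapping.lookup z u)" for a b
  have sub: "rc ` ?K \<subseteq> ball L.I N \<times> ball L.J N"
  proof
    fix p assume "p \<in> rc ` ?K"
    then obtain u where u: "u \<in> ?K" "p = rc u" by auto
    have "length u \<le> N" unfolding N_def using u(1) by (intro Max_ge) auto
    moreover have "set (map row u) \<subseteq> L.I \<and> set (map col u) \<subseteq> L.J"
      using matched_row_col[of u] W.R_key[OF assms u(1)] by (simp only: word_monoid_simps matched_def)
    ultimately show "p \<in> ball L.I N \<times> ball L.J N" using u(2) by (auto simp: rc_def ball_def)
  qed
  have "(\<Sum>u\<in>?K. Poly_Mapping.lookup z u * g (map row u, map col u)) =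
    (\<Sum>p\<in>ball L.I N \<times> ball L.J N. case_prod v p * g p)" for g
  proof -
    have "(\<Sum>u\<in>?K. Poly_Mapping.lookup z u * g (rc u)) =
      (\<Sum>p\<in>ball L.I N \<times> ball L.J N. \<Sum>u\<in>{u\<in>?K. rc u = p}. Poly_Mapping.lookup z u * g (rc u))"
      by (rule sum.group[OF _ _ sub, symmetric]) auto
    also have "\<dots> = (\<Sum>p\<in>ball L.I N \<times> ball L.J N. case_prod v p * g p)"
      by (intro sum.cong refl) (auto simp: v_def sum_distrib_right)
    finally show ?thesis by (simp add: rc_def)
  qed
  then show ?thesis by blast
qed

lemma ip_positive:
  assumes z: "z \<in> carrier W.R"
  shows "ip z z \<in> \<real>\<^sub>\<ge>\<^sub>0" and "ip z z = 0 \<Longrightarrow> z \<in> P.I"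
proof -
  obtain N v where v: "\<And>g. (\<Sum>u\<in>Poly_Mapping.keys z. Poly_Mapping.lookup z u * g (map row u, map col u)) =
    (\<Sum>p\<in>ball L.I N \<times> ball L.J N. case_prod v p * g p)"
    using collect_coefficients[OF z] by blast
  let ?X = "ball L.I N \<times> ball L.J N"
  define G where "G p q = L.gram (fst p) (snd p) (fst q) (snd q)" for p q
  have v': "(\<Sum>u\<in>Poly_Mapping.keys z. cnj (Poly_Mapping.lookup z u) * g (map row u, map col u)) =
    (\<Sum>p\<in>?X. cnj (case_prod v p) * g p)" for g
    using arg_cong[OF v[of "\<lambda>p. cnj (g p)"], of cnj] by simp
  have "ip z z = (\<Sum>u\<in>Poly_Mapping.keys z. cnj (Poly_Mapping.lookup z u) *
      (\<Sum>w\<in>Poly_Mapping.keys z. Poly_Mapping.lookup z w * G (map row u, map col u) (map row w, map col w)))"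
    by (simp add: ip_eq G_def sum_distrib_left mult.assoc)
  also have "\<dots> = (\<Sum>p\<in>?X. cnj (case_prod v p) * (\<Sum>q\<in>?X. case_prod v q * G p q))"
    unfolding v by (rule v')
  also have "\<dots> = (\<Sum>p\<in>?X. \<Sum>q\<in>?X. cnj (case_prod v p) * case_prod v q * L.gram (fst p) (snd p) (fst q) (snd q))"
    by (simp add: G_def sum_distrib_left mult.assoc)
  finally have e: "ip z z = \<dots>" .
  show "ip z z \<in> \<real>\<^sub>\<ge>\<^sub>0" unfolding e by (rule L.haar_positive(1))
  assume 0: "ip z z = 0"
  show "z \<in> P.I"
    unfolding in_I_iff[OF z]
  proof
    fix x assume x: "x \<in> coefs \<Lambda>1 \<Lambda>2"
    have "(\<Sum>p\<in>?X. case_prod v p * case_prod x p) = 0"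
      by (rule L.haar_positive(2)[OF _ x]) (use 0 in \<open>simp add: e\<close>)
    then show "ev (wval x) z = 0" using v[of "case_prod x"] by (simp add: ev_def wval_def)
  qed
qed

lemma \<tau>_star_mult: "z \<in> carrier W.R \<Longrightarrow> w \<in> carrier W.R \<Longrightarrow> \<tau> (star P.Q (P.cl z) \<otimes>\<^bsub>P.Q\<^esub> P.cl w) = ip z w"
  by (simp add: P.Q_star P.Q_mult \<tau>_cl ip_def)

lemma \<tau>_linear: "linear_functional P.Q \<tau>"
  unfolding linear_functional_def \<tau>_def
  using P.val_add[OF wval_vanish_on_I[OF L.haar_in_D]] P.val_smult[OF wval_vanish_on_I[OF L.haar_in_D]] by blast

lemma \<tau>_state: "state P.Q \<tau>"
  unfolding state_def
proof (intro conjI ballI)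
  show "\<tau> (star P.Q X \<otimes>\<^bsub>P.Q\<^esub> X) \<in> \<real>\<^sub>\<ge>\<^sub>0" if "X \<in> carrier P.Q" for X
    using that by (elim P.Q_cases) (simp add: \<tau>_star_mult ip_positive)
  show "\<tau> \<one>\<^bsub>P.Q\<^esub> = 1"
    by (simp add: P.Q_one \<tau>_cl) (simp add: W.R_one wval_def)
qed (rule \<tau>_linear)

lemma \<tau>_faithful: "faithful P.Q \<tau>"
  unfolding faithful_def
proof (intro ballI impI)
  fix X assume X: "X \<in> carrier P.Q" and 0: "\<tau> (star P.Q X \<otimes>\<^bsub>P.Q\<^esub> X) = 0"
  obtain z where z: "z \<in> carrier W.R" "X = P.cl z" using X by (rule P.Q_cases)
  then have "z \<in> P.I" using 0 ip_positive(2)[OF z(1)] by (simp add: \<tau>_star_mult)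
  then show "X = \<zero>\<^bsub>P.Q\<^esub>" using z by (simp add: P.cl_zero_iff)
qed

lemma ev_h_trace: "ev h (z \<otimes>\<^bsub>W.R\<^esub> w) = ev h (w \<otimes>\<^bsub>W.R\<^esub> z)"
proof -
  have "h (u @ v) = h (v @ u)" for u v by (simp add: wval_def L.haar_tracial)
  then have "ev (\<lambda>u. ev (\<lambda>v. h (u @ v)) w) z = ev (\<lambda>u. ev (\<lambda>v. h (v @ u)) w) z"
    by (intro ev_cong refl)
  also have "\<dots> = ev (\<lambda>v. ev (\<lambda>u. h (v @ u)) z) w" by (rule ev_swap)
  finally show ?thesis by (simp add: W.ev_mult)
qed

lemma \<tau>_tracial: "tracial P.Q \<tau>"
  unfolding tracial_def by (auto elim!: P.Q_cases simp: P.Q_mult \<tau>_cl ev_h_trace)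

lemma \<tau>_bi_invariant: "bi_invariant \<Lambda>1 \<Lambda>2 \<tau>"
proof -
  interpret T1: qiso_triple \<Lambda>1 \<Lambda>1 \<Lambda>2 by (intro qiso_triple.intro full1 full2)
  interpret T2: qiso_triple \<Lambda>1 \<Lambda>2 \<Lambda>2 by (intro qiso_triple.intro full1 full2)
  have l: "left_coaction \<Lambda>1 \<Lambda>2 T1.comult"
    unfolding left_coaction_def Let_def T1.A.O_eq O_eq T1.tensor_algebra_eq
    using T1.comult_hom T1.comult_genV T1.comult_genE by blast
  have r: "right_coaction \<Lambda>1 \<Lambda>2 T2.comult"
    unfolding right_coaction_def Let_def O_eq T2.B.O_eq T2.tensor_algebra_eq
    using T2.comult_hom T2.comult_genV T2.comult_genE by blast
  have sr: "slice_right T1.OA \<tau> (T1.comult X) = \<tau> X \<odot>\<^bsub>T1.OA\<^esub> \<one>\<^bsub>T1.OA\<^esub>" if X: "X \<in> carrier P.Q" for X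
  proof -
    obtain z where z: "z \<in> carrier W.R" "X = P.cl z" using X by (rule P.Q_cases)
    note f = T1.lin_ext_comult_closed[OF z(1)]
    show ?thesis
      unfolding z(2) T1.comult_cl[OF z(1)]
    proof (rule T1.A.Q_eqI)
      fix x assume x: "x \<in> coefs \<Lambda>1 \<Lambda>1"
      have "T1.A.P.val (wval x) (slice_right T1.OA \<tau> (T1.T.cl (lin_ext T1.comult_word z))) = ev (wval (conv \<Lambda>1 x L.haar)) z"
        using T1.slice_right_cl(2)[OF \<tau>_linear f x] T1.ev_comult_product[OF x L.haar_in_D z(1)]
        by (simp add: \<tau>_def)
      also have "\<dots> = x [] [] * ev h z"
        by (simp add: ev_fun_scale[symmetric] wval_def[abs_def] L.haar_left[OF x])
      also have "\<dots> = T1.A.P.val (wval x) (\<tau> (P.cl z) \<odot>\<^bsub>T1.OA\<^esub> \<one>\<^bsub>T1.OA\<^esub>)"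
        using T1.A.P.val_smult[OF T1.A.wval_vanish_on_I[OF x] T1.A.P.Q_rules(11)]
          T1.A.val_wval[OF x T1.A.W.one_closed']
        by (simp add: \<tau>_cl[OF z(1)] T1.A.P.Q_one) (simp add: T1.A.W.R_one wval_def)
      finally show "T1.A.P.val (wval x) (slice_right T1.OA \<tau> (T1.T.cl (lin_ext T1.comult_word z))) =
        T1.A.P.val (wval x) (\<tau> (P.cl z) \<odot>\<^bsub>T1.OA\<^esub> \<one>\<^bsub>T1.OA\<^esub>)" .
    qed (use T1.slice_right_cl(1)[OF \<tau>_linear f] T1.A.P.Q_rules in auto)
  qed
  have sl: "slice_left T2.OB \<tau> (T2.comult X) = \<tau> X \<odot>\<^bsub>T2.OB\<^esub> \<one>\<^bsub>T2.OB\<^esub>" if X: "X \<in> carrier P.Q" for X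
  proof -
    obtain z where z: "z \<in> carrier W.R" "X = P.cl z" using X by (rule P.Q_cases)
    note f = T2.lin_ext_comult_closed[OF z(1)]
    show ?thesis
      unfolding z(2) T2.comult_cl[OF z(1)]
    proof (rule T2.B.Q_eqI)
      fix x assume x: "x \<in> coefs \<Lambda>2 \<Lambda>2"
      have "T2.B.P.val (wval x) (slice_left T2.OB \<tau> (T2.T.cl (lin_ext T2.comult_word z))) = ev (wval (conv \<Lambda>2 L.haar x)) z"
        using T2.slice_left_cl(2)[OF \<tau>_linear f x] T2.ev_comult_product[OF L.haar_in_D x z(1)]
        by (simp add: \<tau>_def)
      also have "\<dots> = x [] [] * ev h z"
        by (simp add: ev_fun_scale[symmetric] wval_def[abs_def] L.haar_right[OF x])
      also have "\<dots> = T2.B.P.val (wval x) (\<tau> (P.cl z) \<odot>\<^bsub>T2.OB\<^esub> \<one>\<^bsub>T2.OB\<^esub>)"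
        using T2.B.P.val_smult[OF T2.B.wval_vanish_on_I[OF x] T2.B.P.Q_rules(11)]
          T2.B.val_wval[OF x T2.B.W.one_closed']
        by (simp add: \<tau>_cl[OF z(1)] T2.B.P.Q_one) (simp add: T2.B.W.R_one wval_def)
      finally show "T2.B.P.val (wval x) (slice_left T2.OB \<tau> (T2.T.cl (lin_ext T2.comult_word z))) =
        T2.B.P.val (wval x) (\<tau> (P.cl z) \<odot>\<^bsub>T2.OB\<^esub> \<one>\<^bsub>T2.OB\<^esub>)" .
    qed (use T2.slice_left_cl(1)[OF \<tau>_linear f] T2.B.P.Q_rules in auto)
  qed
  show ?thesis
    unfolding bi_invariant_def
  proof (intro exI[of _ T1.comult] exI[of _ T2.comult] conjI ballI l r)
    fix z assume "z \<in> carrier (\<O> \<Lambda>1 \<Lambda>2)"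
    then have "z \<in> carrier P.Q" by (simp add: O_eq)
    then show "slice_right (\<O> \<Lambda>1 \<Lambda>1) \<tau> (T1.comult z) = \<tau> z \<odot>\<^bsub>\<O> \<Lambda>1 \<Lambda>1\<^esub> \<one>\<^bsub>\<O> \<Lambda>1 \<Lambda>1\<^esub>"
      "slice_left (\<O> \<Lambda>2 \<Lambda>2) \<tau> (T2.comult z) = \<tau> z \<odot>\<^bsub>\<O> \<Lambda>2 \<Lambda>2\<^esub> \<one>\<^bsub>\<O> \<Lambda>2 \<Lambda>2\<^esub>"
      using sr sl by (simp_all add: T1.A.O_eq T2.B.O_eq)
  qed
qed

end


section \<open>Square-summable sequences\<close>

abbreviation square_summable :: "(nat \<Rightarrow> complex) \<Rightarrow> bool" where
  "square_summable f \<equiv> summable (\<lambda>n. (cmod (f n))\<^sup>2)"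

definition sqnorm :: "(nat \<Rightarrow> complex) \<Rightarrow> real" where
  "sqnorm f = (suminf (\<lambda>n. (cmod (f n))\<^sup>2))"

definition l2 :: "nat set \<Rightarrow> (nat \<Rightarrow> complex) inner_product_space" where
  "l2 N = \<lparr>carrier = {f. square_summable f \<and> (\<forall>n. n \<notin> N \<longrightarrow> f n = 0)},
     mult = (\<lambda>f g. f), one = (\<lambda>n. 0), zero = (\<lambda>n. 0), add = (\<lambda>f g n. f n + g n),
     smult = (\<lambda>c f n. c * f n), inner_prod = (\<lambda>f g. suminf (\<lambda>n. cnj (f n) * g n))\<rparr>"

lemma l2_simps [simp]:
  "f \<in> carrier (l2 N) \<longleftrightarrow> square_summable f \<and> (\<forall>n. n \<notin> N \<longrightarrow> f n = 0)"
  "\<zero>\<^bsub>l2 N\<^esub> = (\<lambda>n. 0)" "f \<oplus>\<^bsub>l2 N\<^esub> g = (\<lambda>n. f n + g n)" "c \<odot>\<^bsub>l2 N\<^esub> f = (\<lambda>n. c * f n)"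
  by (simp_all add: l2_def)

abbreviation l2_inner :: "(nat \<Rightarrow> complex) \<Rightarrow> (nat \<Rightarrow> complex) \<Rightarrow> complex" where
  "l2_inner f g \<equiv> suminf (\<lambda>n. cnj (f n) * g n)"

lemma inner_prod_l2: "inner_prod (l2 N) f g = l2_inner f g"
  by (simp add: l2_def)

lemma square_summable_add:
  assumes "square_summable f" "square_summable g"
  shows "square_summable (\<lambda>n. f n + g n)"
proof (rule summable_comparison_test')
  show "summable (\<lambda>n. 2 * (cmod (f n))\<^sup>2 + 2 * (cmod (g n))\<^sup>2)"
    using assms by (intro summable_add summable_mult)
  fix n
  have "(cmod (f n + g n))\<^sup>2 \<le> (cmod (f n) + cmod (g n))\<^sup>2"
    by (intro power_mono norm_triangle_ineq) simp
  also have "\<dots> \<le> 2 * (cmod (f n))\<^sup>2 + 2 * (cmod (g n))\<^sup>2"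
    using zero_le_power2[of "cmod (f n) - cmod (g n)"] by (simp add: power2_eq_square algebra_simps)
  finally show "norm ((cmod (f n + g n))\<^sup>2) \<le> 2 * (cmod (f n))\<^sup>2 + 2 * (cmod (g n))\<^sup>2" by simp
qed

lemma square_summable_scale: "square_summable f \<Longrightarrow> square_summable (\<lambda>n. c * f n)"
  by (simp add: norm_mult power_mult_distrib summable_mult)

lemma square_summable_diff:
  "square_summable f \<Longrightarrow> square_summable g \<Longrightarrow> square_summable (\<lambda>n. f n - g n)"
  using square_summable_add[of f "\<lambda>n. - g n"] by simp

text \<open>
  With the weight \<open>t\<close> at hand, this replaces the Cauchy-Schwarz inequality.
\<close>

lemma l2_inner_bound_term:
  assumes "t > 0"
  shows "cmod (cnj a * b) \<le> (t * (cmod a)\<^sup>2 + (cmod b)\<^sup>2 / t) / 2"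
proof -
  have "0 \<le> (t * cmod a - cmod b)\<^sup>2" by simp
  then have "2 * t * cmod a * cmod b \<le> t * (t * (cmod a)\<^sup>2 + (cmod b)\<^sup>2 / t)"
    using assms by (simp add: power2_eq_square algebra_simps)
  then have "t * (2 * cmod a * cmod b) \<le> t * (t * (cmod a)\<^sup>2 + (cmod b)\<^sup>2 / t)" by (simp add: mult_ac)
  then have "2 * cmod a * cmod b \<le> t * (cmod a)\<^sup>2 + (cmod b)\<^sup>2 / t"
    using assms by (simp only: mult_le_cancel_left_pos)
  then show ?thesis by (simp add: norm_mult)
qed

lemma
  assumes f: "square_summable f" and g: "square_summable g"
  shows l2_inner_summable: "summable (\<lambda>n. cnj (f n) * g n)"
    and l2_inner_bound: "t > 0 \<Longrightarrow> cmod (l2_inner f g) \<le> (t * sqnorm f + sqnorm g / t) / 2"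
proof -
  have s: "summable (\<lambda>n. (t * (cmod (f n))\<^sup>2 + (cmod (g n))\<^sup>2 / t) / 2)" for t
    using f g by (intro summable_divide summable_add summable_mult)
  have sn: "summable (\<lambda>n. cmod (cnj (f n) * g n))"
  proof (rule summable_comparison_test'[OF s[of 1]])
    show "norm (cmod (cnj (f n) * g n)) \<le> (1 * (cmod (f n))\<^sup>2 + (cmod (g n))\<^sup>2 / 1) / 2" for n
      using l2_inner_bound_term[of 1 "f n" "g n"] by simp
  qed
  then show "summable (\<lambda>n. cnj (f n) * g n)" by (rule summable_norm_cancel)
  assume t: "t > 0"
  have "cmod (l2_inner f g) \<le> (suminf (\<lambda>n. cmod (cnj (f n) * g n)))" by (rule summable_norm[OF sn])
  also have "\<dots> \<le> (suminf (\<lambda>n. (t * (cmod (f n))\<^sup>2 + (cmod (g n))\<^sup>2 / t) / 2))"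
    by (rule suminf_le[OF l2_inner_bound_term[OF t] sn s])
  also have "\<dots> = (t * sqnorm f + sqnorm g / t) / 2"
    unfolding sqnorm_def
    using f g by (simp add: suminf_divide summable_add summable_mult summable_divide suminf_add[symmetric] suminf_mult)
  finally show "cmod (l2_inner f g) \<le> (t * sqnorm f + sqnorm g / t) / 2" .
qed

lemma l2_inner_add_right:
  "square_summable f \<Longrightarrow> square_summable g \<Longrightarrow> square_summable k \<Longrightarrow>
    l2_inner f (\<lambda>n. g n + k n) = l2_inner f g + l2_inner f k"
  by (simp add: distrib_left suminf_add l2_inner_summable)

lemma l2_inner_diff_left:
  "square_summable f \<Longrightarrow> square_summable g \<Longrightarrow> square_summable k \<Longrightarrow>
    l2_inner (\<lambda>n. f n - g n) k = l2_inner f k - l2_inner g k"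
  by (simp add: left_diff_distrib suminf_diff l2_inner_summable)

lemma l2_inner_scale_right:
  "square_summable f \<Longrightarrow> square_summable g \<Longrightarrow> l2_inner f (\<lambda>n. c * g n) = c * l2_inner f g"
  by (simp add: mult.left_commute suminf_mult l2_inner_summable)

lemma l2_inner_add_left:
  "square_summable f \<Longrightarrow> square_summable g \<Longrightarrow> square_summable k \<Longrightarrow>
    l2_inner (\<lambda>n. f n + g n) k = l2_inner f k + l2_inner g k"
  by (simp add: distrib_right suminf_add l2_inner_summable)

lemma l2_inner_scale_left:
  "square_summable f \<Longrightarrow> square_summable g \<Longrightarrow> l2_inner (\<lambda>n. c * f n) g = cnj c * l2_inner f g"
  by (simp add: mult.assoc suminf_mult l2_inner_summable)

lemma l2_inner_cnj:
  "square_summable f \<Longrightarrow> square_summable g \<Longrightarrow> l2_inner g f = cnj (l2_inner f g)"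
  using bounded_linear.suminf[OF bounded_linear_cnj l2_inner_summable[of f g]] by (simp add: mult.commute)

lemma l2_inner_self: "square_summable f \<Longrightarrow> l2_inner f f = of_real (sqnorm f)"
  unfolding sqnorm_def
  by (subst suminf_of_real) (simp_all add: complex_norm_square mult.commute del: of_real_power)

lemma sqnorm_nonneg: "square_summable f \<Longrightarrow> 0 \<le> sqnorm f"
  unfolding sqnorm_def by (rule suminf_nonneg) auto

lemma sqnorm_zero: "square_summable f \<Longrightarrow> sqnorm f = 0 \<Longrightarrow> f = (\<lambda>n. 0)"
  unfolding sqnorm_def by (subst (asm) suminf_eq_zero_iff) auto

lemma hnorm_l2: "square_summable f \<Longrightarrow> hnorm (l2 N) f = sqrt (sqnorm f)"
  by (simp add: hnorm_def inner_prod_l2 l2_inner_self)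

lemma finite_support_square_summable: "(\<And>n. n \<ge> k \<Longrightarrow> f n = 0) \<Longrightarrow> square_summable f"
  by (rule summable_finite[of "{..<k}"]) auto

lemma abelian_group_l2: "abelian_group (l2 N)"
proof (rule abelian_groupI)
  show "\<exists>y\<in>carrier (l2 N). y \<oplus>\<^bsub>l2 N\<^esub> x = \<zero>\<^bsub>l2 N\<^esub>" if "x \<in> carrier (l2 N)" for x
    using that by (intro bexI[of _ "\<lambda>n. - x n"]) auto
qed (auto simp: square_summable_add algebra_simps)

lemma l2_minus: "f \<in> carrier (l2 N) \<Longrightarrow> g \<in> carrier (l2 N) \<Longrightarrow> f \<ominus>\<^bsub>l2 N\<^esub> g = (\<lambda>n. f n - g n)"
proof -
  assume fg: "f \<in> carrier (l2 N)" "g \<in> carrier (l2 N)"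
  interpret abelian_group "l2 N" by (rule abelian_group_l2)
  have "\<ominus>\<^bsub>l2 N\<^esub> g = (\<lambda>n. - g n)" by (rule minus_equality) (use fg in auto)
  then show ?thesis by (simp add: a_minus_def)
qed

lemma module_l2: "module complex_field (l2 N)"
proof -
  have ag: "abelian_group complex_field"
    by (rule abelian_groupI) (auto simp: complex_field_def intro: exI[of _ "- _"] ab_left_minus)
  have cm: "comm_monoid complex_field"
    by (rule comm_monoidI) (auto simp: complex_field_def)
  have "cring complex_field"
    by (rule cringI[OF ag cm]) (simp add: complex_field_def distrib_right)
  then show ?thesis
    by (rule moduleI[OF _ abelian_group_l2])
      (auto simp: complex_field_def square_summable_scale algebra_simps)
qed

text \<open>
  The limit is taken pointwise; the Cauchy estimate passes to it first on finitely many coordinates.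
\<close>

lemma l2_complete:
  assumes s: "\<And>k. s k \<in> carrier (l2 N)"
    and cauchy: "\<And>e. e > 0 \<Longrightarrow> \<exists>K. \<forall>m\<ge>K. \<forall>n\<ge>K. hnorm (l2 N) (s m \<ominus>\<^bsub>l2 N\<^esub> s n) < e"
  shows "\<exists>l\<in>carrier (l2 N). (\<lambda>n. hnorm (l2 N) (s n \<ominus>\<^bsub>l2 N\<^esub> l)) \<longlonglongrightarrow> 0"
proof -
  have sq: "square_summable (\<lambda>i. s m i - s n i)" for m n
    using s by (intro square_summable_diff) auto
  have c: "\<exists>K. \<forall>m\<ge>K. \<forall>n\<ge>K. sqnorm (\<lambda>i. s m i - s n i) < e\<^sup>2" if e: "e > 0" for e
  proof -
    obtain K where K: "\<forall>m\<ge>K. \<forall>n\<ge>K. hnorm (l2 N) (s m \<ominus>\<^bsub>l2 N\<^esub> s n) < e" using cauchy[OF e] by blast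
    have "sqnorm (\<lambda>i. s m i - s n i) < e\<^sup>2" if "m \<ge> K" "n \<ge> K" for m n
    proof -
      have "sqrt (sqnorm (\<lambda>i. s m i - s n i)) < e"
        using K that l2_minus[OF s s] hnorm_l2[OF sq] by simp
      then show ?thesis using e by (metis real_sqrt_less_iff real_sqrt_unique less_imp_le)
    qed
    then show ?thesis by blast
  qed
  have partial: "(\<Sum>i<k. (cmod (s m i - s n i))\<^sup>2) \<le> sqnorm (\<lambda>i. s m i - s n i)" for k m n
    unfolding sqnorm_def by (rule sum_le_suminf[OF sq]) auto
  have "Cauchy (\<lambda>m. s m i)" for i
  proof (rule CauchyI)
    fix e :: real assume e: "e > 0"
    obtain K where K: "\<forall>m\<ge>K. \<forall>n\<ge>K. sqnorm (\<lambda>i. s m i - s n i) < e\<^sup>2" using c[OF e] by blast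
    have "cmod (s m i - s n i) < e" if "m \<ge> K" "n \<ge> K" for m n
    proof -
      have "(cmod (s m i - s n i))\<^sup>2 \<le> (\<Sum>j<Suc i. (cmod (s m j - s n j))\<^sup>2)"
        by (simp add: sum_nonneg)
      also have "\<dots> < e\<^sup>2" using partial[of m n "Suc i"] K that by (meson le_less_trans)
      finally show ?thesis using e by (simp add: power_less_imp_less_base)
    qed
    then show "\<exists>M. \<forall>m\<ge>M. \<forall>n\<ge>M. cmod (s m i - s n i) < e" by blast
  qed
  then have "\<exists>l. (\<lambda>m. s m i) \<longlonglongrightarrow> l" for i
    using Cauchy_convergent convergent_def by blast
  then obtain l where l: "\<And>i. (\<lambda>m. s m i) \<longlonglongrightarrow> l i" by metis
  have near: "\<exists>K. \<forall>m\<ge>K. square_summable (\<lambda>i. s m i - l i) \<and> sqnorm (\<lambda>i. s m i - l i) \<le> e\<^sup>2" if e: "e > 0" for e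
  proof -
    obtain K where K: "\<forall>m\<ge>K. \<forall>n\<ge>K. sqnorm (\<lambda>i. s m i - s n i) < e\<^sup>2" using c[OF e] by blast
    have "square_summable (\<lambda>i. s m i - l i) \<and> sqnorm (\<lambda>i. s m i - l i) \<le> e\<^sup>2" if m: "m \<ge> K" for m
    proof -
      have p: "(\<Sum>i<k. (cmod (s m i - l i))\<^sup>2) \<le> e\<^sup>2" for k
      proof (rule LIMSEQ_le_const2)
        show "(\<lambda>n. \<Sum>i<k. (cmod (s m i - s n i))\<^sup>2) \<longlonglongrightarrow> (\<Sum>i<k. (cmod (s m i - l i))\<^sup>2)"
          by (intro tendsto_sum tendsto_power tendsto_norm tendsto_diff tendsto_const l)
        show "\<exists>N. \<forall>n\<ge>N. (\<Sum>i<k. (cmod (s m i - s n i))\<^sup>2) \<le> e\<^sup>2"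
          using K m partial by (meson le_less_trans less_imp_le)
      qed
      have ss: "square_summable (\<lambda>i. s m i - l i)"
        by (rule summableI_nonneg_bounded[of _ "e\<^sup>2"]) (auto simp: p)
      then show ?thesis unfolding sqnorm_def using p by (auto intro: suminf_le_const)
    qed
    then show ?thesis by blast
  qed
  obtain m where m: "square_summable (\<lambda>i. s m i - l i)" using near[of 1] by auto
  have "square_summable l" using square_summable_diff[of "s m" "\<lambda>i. s m i - l i"] s[of m] m by simp
  moreover have "l i = 0" if "i \<notin> N" for i
    using l[of i] s that by (simp add: LIMSEQ_const_iff)
  ultimately have lc: "l \<in> carrier (l2 N)" by simp
  have "(\<lambda>n. hnorm (l2 N) (s n \<ominus>\<^bsub>l2 N\<^esub> l)) \<longlonglongrightarrow> 0"
  proof (rule LIMSEQ_I)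
    fix e :: real assume e: "e > 0"
    obtain K where K: "\<forall>m\<ge>K. square_summable (\<lambda>i. s m i - l i) \<and> sqnorm (\<lambda>i. s m i - l i) \<le> (e / 2)\<^sup>2"
      using near[of "e / 2"] e by auto
    have "norm (hnorm (l2 N) (s n \<ominus>\<^bsub>l2 N\<^esub> l) - 0) < e" if n: "n \<ge> K" for n
    proof -
      have "sqrt (sqnorm (\<lambda>i. s n i - l i)) \<le> e / 2"
        using K n e by (intro real_le_lsqrt) auto
      moreover have "0 \<le> sqrt (sqnorm (\<lambda>i. s n i - l i))" using K n sqnorm_nonneg by auto
      ultimately show ?thesis using K n e by (simp add: l2_minus[OF s lc] hnorm_l2)
    qed
    then show "\<exists>no. \<forall>n\<ge>no. norm (hnorm (l2 N) (s n \<ominus>\<^bsub>l2 N\<^esub> l) - 0) < e" by blast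
  qed
  then show ?thesis using lc by blast
qed

lemma hilbert_space_l2: "hilbert_space (l2 N)"
  unfolding hilbert_space_def
proof (intro conjI ballI allI impI module_l2)
  fix f g k assume "f \<in> carrier (l2 N)" "g \<in> carrier (l2 N)" "k \<in> carrier (l2 N)"
  then show "inner_prod (l2 N) f (g \<oplus>\<^bsub>l2 N\<^esub> k) = inner_prod (l2 N) f g + inner_prod (l2 N) f k"
    by (simp add: inner_prod_l2 l2_inner_add_right)
next
  fix c f g assume "f \<in> carrier (l2 N)" "g \<in> carrier (l2 N)"
  then show "inner_prod (l2 N) f (c \<odot>\<^bsub>l2 N\<^esub> g) = c * inner_prod (l2 N) f g"
    by (simp add: inner_prod_l2 l2_inner_scale_right)
next
  fix f g assume "f \<in> carrier (l2 N)" "g \<in> carrier (l2 N)"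
  then show "inner_prod (l2 N) g f = cnj (inner_prod (l2 N) f g)"
    unfolding inner_prod_l2 by (intro l2_inner_cnj) auto
next
  fix f assume f: "f \<in> carrier (l2 N)"
  then show "inner_prod (l2 N) f f \<in> \<real>\<^sub>\<ge>\<^sub>0"
    by (simp add: inner_prod_l2 l2_inner_self sqnorm_nonneg)
  show "f = \<zero>\<^bsub>l2 N\<^esub>" if "inner_prod (l2 N) f f = 0"
    using that f by (simp add: inner_prod_l2 l2_inner_self sqnorm_zero)
next
  fix s :: "nat \<Rightarrow> nat \<Rightarrow> complex"
  assume "(\<forall>n. s n \<in> carrier (l2 N)) \<and>
    (\<forall>e>0. \<exists>K. \<forall>m\<ge>K. \<forall>n\<ge>K. hnorm (l2 N) (s m \<ominus>\<^bsub>l2 N\<^esub> s n) < e)"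
  then show "\<exists>l\<in>carrier (l2 N). (\<lambda>n. hnorm (l2 N) (s n \<ominus>\<^bsub>l2 N\<^esub> l)) \<longlonglongrightarrow> 0"
    by (intro l2_complete) blast+
qed


section \<open>Extending operators from a countably spanned semi-inner product space\<close>

lemma half_sum_less: "(a::real) \<le> (b + c) / 2 \<Longrightarrow> b < e \<Longrightarrow> c < e \<Longrightarrow> a < e"
  by (simp add: field_simps)

locale semi_inner =
  fixes V :: "('x \<Rightarrow>\<^sub>0 complex) set"
    and ip :: "('x \<Rightarrow>\<^sub>0 complex) \<Rightarrow> ('x \<Rightarrow>\<^sub>0 complex) \<Rightarrow> complex"
    and w :: "nat \<Rightarrow> 'x \<Rightarrow>\<^sub>0 complex"
  assumes V_zero [simp]: "0 \<in> V"
    and V_add [simp]: "u \<in> V \<Longrightarrow> v \<in> V \<Longrightarrow> u + v \<in> V"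
    and V_scale [simp]: "u \<in> V \<Longrightarrow> scale c u \<in> V"
    and ip_add_right: "u \<in> V \<Longrightarrow> v \<in> V \<Longrightarrow> v' \<in> V \<Longrightarrow> ip u (v + v') = ip u v + ip u v'"
    and ip_scale_right: "u \<in> V \<Longrightarrow> v \<in> V \<Longrightarrow> ip u (scale c v) = c * ip u v"
    and ip_hermitian: "u \<in> V \<Longrightarrow> v \<in> V \<Longrightarrow> ip v u = cnj (ip u v)"
    and ip_nonneg: "u \<in> V \<Longrightarrow> ip u u \<in> \<real>\<^sub>\<ge>\<^sub>0"
    and ip_null: "u \<in> V \<Longrightarrow> v \<in> V \<Longrightarrow> ip v v = 0 \<Longrightarrow> ip u v = 0"
    and w_in [simp]: "w n \<in> V"
    and spanning: "v \<in> V \<Longrightarrow> \<exists>k c. v = (\<Sum>n<k. scale (c n) (w n))"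
begin

lemma V_sum [simp]: "(\<And>s. s \<in> A \<Longrightarrow> g s \<in> V) \<Longrightarrow> sum g A \<in> V"
  by (induction A rule: infinite_finite_induct) auto

lemma V_diff [simp]: "u \<in> V \<Longrightarrow> v \<in> V \<Longrightarrow> u - v \<in> V"
proof -
  have e: "u - v = u + scale (-1) v" by (rule ev_eqI) simp
  show "u \<in> V \<Longrightarrow> v \<in> V \<Longrightarrow> u - v \<in> V" unfolding e by (intro V_add V_scale)
qed

lemma ip_zero_right: "u \<in> V \<Longrightarrow> ip u 0 = 0"
  using ip_add_right[of u 0 0] by simp

lemma ip_zero_left: "u \<in> V \<Longrightarrow> ip 0 u = 0"
  using ip_hermitian[of u 0] by (simp add: ip_zero_right)

lemma ip_sum_right: "u \<in> V \<Longrightarrow> (\<And>s. s \<in> A \<Longrightarrow> g s \<in> V) \<Longrightarrow> ip u (sum g A) = (\<Sum>s\<in>A. ip u (g s))"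
  by (induction A rule: infinite_finite_induct) (auto simp: ip_add_right ip_zero_right)

lemma ip_scale_left: "u \<in> V \<Longrightarrow> v \<in> V \<Longrightarrow> ip (scale c u) v = cnj c * ip u v"
  using ip_hermitian[of v "scale c u"] ip_hermitian[of v u] by (simp add: ip_scale_right)

lemma ip_diff_right: "u \<in> V \<Longrightarrow> v \<in> V \<Longrightarrow> v' \<in> V \<Longrightarrow> ip u (v - v') = ip u v - ip u v'"
  using ip_add_right[of u "v - v'" v'] by simp

lemma ip_self: "u \<in> V \<Longrightarrow> ip u u = of_real (Re (ip u u)) \<and> 0 \<le> Re (ip u u)"
  using ip_nonneg[of u] by (auto simp: complex_nonneg_Reals_iff complex_eq_iff)

lemma ip_add_left: "u \<in> V \<Longrightarrow> u' \<in> V \<Longrightarrow> v \<in> V \<Longrightarrow> ip (u + u') v = ip u v + ip u' v"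
  using ip_hermitian[of v "u + u'"] ip_hermitian[of v u] ip_hermitian[of v u'] by (simp add: ip_add_right)

lemma ip_diff_left: "u \<in> V \<Longrightarrow> u' \<in> V \<Longrightarrow> v \<in> V \<Longrightarrow> ip (u - u') v = ip u v - ip u' v"
  using ip_add_left[of "u - u'" u' v] by simp

lemma ip_parallelogram:
  assumes "a \<in> V" "b \<in> V"
  shows "Re (ip (a + b) (a + b)) \<le> 2 * Re (ip a a) + 2 * Re (ip b b)"
proof -
  have "0 \<le> Re (ip (a - b) (a - b))" using ip_self[of "a - b"] assms by simp
  moreover have "ip (a + b) (a + b) + ip (a - b) (a - b) = 2 * ip a a + 2 * ip b b"
    using assms by (simp add: ip_add_left ip_add_right ip_diff_left ip_diff_right)
  then have "Re (ip (a + b) (a + b)) + Re (ip (a - b) (a - b)) = 2 * Re (ip a a) + 2 * Re (ip b b)"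
    by (metis Re_complex_of_real complex_Re_numeral mult_2 plus_complex.sel(1))
  ultimately show ?thesis by simp
qed


subsection \<open>Orthonormalisation\<close>

text \<open>
  Gram-Schmidt. If the residual \<open>r\<close> has length zero, then \<open>1 / 0 = 0\<close> makes the new vector zero, so the sequence
  consists of orthonormal vectors and zeros.
\<close>

function gs :: "nat \<Rightarrow> 'x \<Rightarrow>\<^sub>0 complex" where
  "gs n = (let r = w n - (\<Sum>m<n. scale (ip (gs m) (w n)) (gs m))
           in scale (of_real (1 / sqrt (Re (ip r r)))) r)"
  by pat_completeness auto
termination by (relation "measure id") auto

declare gs.simps [simp del]

definition res :: "nat \<Rightarrow> 'x \<Rightarrow>\<^sub>0 complex" where
  "res n = w n - (\<Sum>m<n. scale (ip (gs m) (w n)) (gs m))"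

lemma gs_res: "gs n = scale (of_real (1 / sqrt (Re (ip (res n) (res n))))) (res n)"
  by (subst gs.simps) (simp add: res_def Let_def)

lemma gs_in [simp]: "gs n \<in> V"
proof (induction n rule: less_induct)
  case (less n)
  then have "res n \<in> V" unfolding res_def by (intro V_diff V_sum V_scale) auto
  then show ?case unfolding gs_res[of n] by simp
qed

lemma res_in [simp]: "res n \<in> V"
  unfolding res_def by (intro V_diff V_sum V_scale) auto

lemma gs_null: "ip (res n) (res n) = 0 \<Longrightarrow> gs n = 0"
  unfolding gs_res[of n] by (rule ev_eqI) simp

lemma gs_norm_res:
  assumes "ip (res n) (res n) \<noteq> 0"
  shows "ip (gs n) (gs n) = 1" "res n = scale (of_real (sqrt (Re (ip (res n) (res n))))) (gs n)"
proof -
  define c where "c = sqrt (Re (ip (res n) (res n)))"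
  have r: "ip (res n) (res n) = of_real (Re (ip (res n) (res n)))" "0 \<le> Re (ip (res n) (res n))"
    using ip_self[of "res n"] by auto
  then have ne: "Re (ip (res n) (res n)) \<noteq> 0" using assms by (metis of_real_0)
  then have c: "c > 0" "c * c = Re (ip (res n) (res n))"
    using r(2) by (simp_all add: c_def less_eq_real_def)
  have g: "gs n = scale (of_real (1 / c)) (res n)" by (simp add: gs_res c_def)
  have "ip (gs n) (gs n) = of_real (1 / c) * (of_real (1 / c) * of_real (c * c))"
    unfolding g using r(1) c(2) by (simp add: ip_scale_left ip_scale_right)
  also have "\<dots> = of_real (1 / c * (1 / c * (c * c)))" by (simp only: of_real_mult)
  also have "\<dots> = 1" using c(1) by simp
  finally show "ip (gs n) (gs n) = 1" .
  show "res n = scale (of_real (sqrt (Re (ip (res n) (res n))))) (gs n)"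
    unfolding c_def[symmetric] g by (rule ev_eqI) (use c(1) ne in simp)
qed

lemma gs_norm: "gs n \<noteq> 0 \<Longrightarrow> ip (gs n) (gs n) = 1"
  using gs_null gs_norm_res by blast

lemma gs_orthogonal_less: "m < n \<Longrightarrow> ip (gs m) (gs n) = 0"
proof (induction n arbitrary: m rule: less_induct)
  case (less n)
  have orth: "ip (gs m) (gs i) = 0" if "i < n" "i \<noteq> m" for i
  proof (cases "i < m")
    case True
    then have "ip (gs i) (gs m) = 0" using less.IH[of m i] less.prems by simp
    then show ?thesis using ip_hermitian[of "gs i" "gs m"] by simp
  next
    case False
    then show ?thesis using less.IH[of i m] that by simp
  qed
  have "ip (gs m) (res n) = ip (gs m) (w n) - (\<Sum>i<n. ip (gs i) (w n) * ip (gs m) (gs i))"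
    by (simp add: res_def ip_diff_right ip_sum_right ip_scale_right)
  also have "(\<Sum>i<n. ip (gs i) (w n) * ip (gs m) (gs i)) = (\<Sum>i<n. if i = m then ip (gs m) (w n) * ip (gs m) (gs m) else 0)"
    by (intro sum.cong refl) (simp add: orth)
  also have "\<dots> = ip (gs m) (w n) * ip (gs m) (gs m)" using less.prems by simp
  finally have "ip (gs m) (res n) = 0"
    by (cases "gs m = 0") (simp_all add: gs_norm ip_zero_left)
  then show ?case unfolding gs_res[of n] by (simp add: ip_scale_right)
qed

lemma gs_orthonormal: "ip (gs m) (gs n) = (if m = n \<and> gs n \<noteq> 0 then 1 else 0)"
proof (cases "m < n")
  case True
  then show ?thesis by (simp add: gs_orthogonal_less)
next
  case False
  then show ?thesis using gs_orthogonal_less[of n m] ip_hermitian[of "gs n" "gs m"]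
    by (cases "m = n") (auto simp: gs_norm ip_zero_left)
qed

text \<open>
  If the residual is a null vector, \<open>ip_null\<close> makes it invisible to the form; otherwise it is a multiple of \<open>gs j\<close>.
\<close>

lemma ip_w:
  assumes u: "u \<in> V"
  shows "ip u (w j) = (\<Sum>m<Suc j. ip u (gs m) * ip (gs m) (w j))"
proof -
  have wj: "w j = res j + (\<Sum>m<j. scale (ip (gs m) (w j)) (gs m))" by (simp add: res_def)
  have e: "ip v (w j) = ip v (res j) + (\<Sum>m<j. ip v (gs m) * ip (gs m) (w j))" if v: "v \<in> V" for v
  proof -
    have "ip v (w j) = ip v (res j + (\<Sum>m<j. scale (ip (gs m) (w j)) (gs m)))" using wj by simp
    also have "\<dots> = ip v (res j) + (\<Sum>m<j. ip v (gs m) * ip (gs m) (w j))"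
      using v by (simp add: ip_add_right ip_sum_right ip_scale_right mult.commute)
    finally show ?thesis .
  qed
  have "ip u (res j) = ip u (gs j) * ip (gs j) (w j)"
  proof (cases "ip (res j) (res j) = 0")
    case True
    then show ?thesis using ip_null[OF u _ True] gs_null u by (simp add: ip_zero_right)
  next
    case False
    define c where "c = complex_of_real (sqrt (Re (ip (res j) (res j))))"
    have r: "res j = scale c (gs j)" unfolding c_def by (rule gs_norm_res(2)[OF False])
    have "(\<Sum>m<j. ip (gs j) (gs m) * ip (gs m) (w j)) = 0" by (intro sum.neutral) (auto simp: gs_orthonormal)
    moreover have "ip (gs j) (res j) = c" by (simp add: r ip_scale_right gs_norm_res(1)[OF False])
    ultimately have "ip (gs j) (w j) = c" by (subst e) simp_all
    then show ?thesis using u by (simp add: r ip_scale_right)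
  qed
  then show ?thesis using e[OF u] by simp
qed

lemma expansion:
  assumes "v \<in> V"
  shows "\<exists>k. (\<forall>n\<ge>k. ip (gs n) v = 0) \<and> (\<forall>u\<in>V. ip u v = (\<Sum>n<k. ip u (gs n) * ip (gs n) v))"
proof -
  obtain k c where v: "v = (\<Sum>j<k. scale (c j) (w j))" using spanning[OF assms] by blast
  have e: "ip u v = (\<Sum>j<k. c j * ip u (w j))" if "u \<in> V" for u
    using that by (simp add: v ip_sum_right ip_scale_right)
  have 0: "ip (gs n) (w j) = 0" if "j < n" for j n
    using that by (subst ip_w) (auto simp: gs_orthonormal intro!: sum.neutral)
  have "ip u v = (\<Sum>n<k. ip u (gs n) * ip (gs n) v)" if u: "u \<in> V" for u
  proof -
    have "ip u (w j) = (\<Sum>n<k. ip u (gs n) * ip (gs n) (w j))" if "j < k" for j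
      unfolding ip_w[OF u] using that by (intro sum.mono_neutral_left) (auto simp: 0)
    then have "ip u v = (\<Sum>j<k. \<Sum>n<k. ip u (gs n) * (c j * ip (gs n) (w j)))"
      unfolding e[OF u] by (intro sum.cong refl) (simp add: sum_distrib_left mult_ac)
    also have "\<dots> = (\<Sum>n<k. ip u (gs n) * ip (gs n) v)"
      unfolding e[OF gs_in] sum_distrib_left by (rule sum.swap)
    finally show ?thesis .
  qed
  moreover have "ip (gs n) v = 0" if "n \<ge> k" for n
    unfolding e[OF gs_in] using that by (intro sum.neutral) (auto simp: 0)
  ultimately show ?thesis by blast
qed

definition supp :: "nat set" where
  "supp = {n. gs n \<noteq> 0}"

definition coord :: "('x \<Rightarrow>\<^sub>0 complex) \<Rightarrow> nat \<Rightarrow> complex" where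
  "coord v n = ip (gs n) v"

lemma coord_finite_support:
  assumes "v \<in> V" obtains k where "\<And>n. n \<ge> k \<Longrightarrow> coord v n = 0"
  using expansion[OF assms] by (auto simp: coord_def)

lemma coord_square_summable: "v \<in> V \<Longrightarrow> square_summable (coord v)"
  using coord_finite_support finite_support_square_summable by metis

lemma coord_in_l2: "v \<in> V \<Longrightarrow> coord v \<in> carrier (l2 supp)"
  by (simp add: coord_square_summable) (simp add: supp_def coord_def ip_zero_left)

lemma coord_inner:
  assumes u: "u \<in> V" and v: "v \<in> V"
  shows "l2_inner (coord u) (coord v) = ip u v"
proof -
  obtain k where k: "\<forall>n\<ge>k. ip (gs n) v = 0" "\<forall>u\<in>V. ip u v = (\<Sum>n<k. ip u (gs n) * ip (gs n) v)"
    using expansion[OF v] by blast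
  have "l2_inner (coord u) (coord v) = (\<Sum>n<k. cnj (coord u n) * coord v n)"
    using k(1) by (intro suminf_finite) (auto simp: coord_def)
  also have "\<dots> = ip u v"
    using k(2) u ip_hermitian[OF gs_in u] by (simp add: coord_def)
  finally show ?thesis .
qed

lemma coord_sqnorm: "v \<in> V \<Longrightarrow> sqnorm (coord v) = Re (ip v v)"
  using coord_inner[of v v] l2_inner_self[OF coord_square_summable[of v]] by (metis Re_complex_of_real)

lemma coord_combination:
  assumes f: "\<And>n. n \<notin> supp \<Longrightarrow> f n = 0"
  shows "coord (\<Sum>m<M. scale (f m) (gs m)) n = (if n < M then f n else 0)"
proof -
  have "coord (\<Sum>m<M. scale (f m) (gs m)) n = (\<Sum>m<M. f m * ip (gs n) (gs m))"
    by (simp add: coord_def ip_sum_right ip_scale_right)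
  also have "\<dots> = (\<Sum>m<M. if m = n then f n else 0)"
    using f[of n] by (intro sum.cong refl) (auto simp: gs_orthonormal supp_def)
  also have "\<dots> = (if n < M then f n else 0)" by simp
  finally show ?thesis .
qed

definition bounded_on :: "(('x \<Rightarrow>\<^sub>0 complex) \<Rightarrow> 'x \<Rightarrow>\<^sub>0 complex) \<Rightarrow> real \<Rightarrow> bool" where
  "bounded_on S K \<longleftrightarrow> K > 0 \<and> (\<forall>u\<in>V. S u \<in> V \<and> Re (ip (S u) (S u)) \<le> K * Re (ip u u)) \<and>
     (\<forall>u\<in>V. \<forall>v\<in>V. S (u + v) = S u + S v) \<and> (\<forall>c. \<forall>u\<in>V. S (scale c u) = scale c (S u))"

lemma bounded_on_simps:
  assumes "bounded_on S K"
  shows "u \<in> V \<Longrightarrow> S u \<in> V" "u \<in> V \<Longrightarrow> v \<in> V \<Longrightarrow> S (u + v) = S u + S v"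
    "u \<in> V \<Longrightarrow> S (scale c u) = scale c (S u)" "S 0 = 0"
proof -
  have "S (0 + 0) = S 0 + S 0" using assms unfolding bounded_on_def by (metis V_zero)
  then show "S 0 = 0" by simp
qed (use assms in \<open>auto simp: bounded_on_def\<close>)

lemma l2_inner_combination:
  assumes "bounded_on S K" and g: "square_summable g"
  shows "l2_inner (coord (S (\<Sum>m<M. scale (f m) (gs m)))) g = (\<Sum>m<M. cnj (f m) * l2_inner (coord (S (gs m))) g)"
proof -
  note S = bounded_on_simps[OF assms(1)]
  have Ss: "S (\<Sum>m<M. scale (f m) (gs m)) = (\<Sum>m<M. scale (f m) (S (gs m)))"
  proof (induction M)
    case (Suc M)
    have "(\<Sum>m<M. scale (f m) (gs m)) \<in> V" by (intro V_sum) simp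
    then show ?case using Suc by (simp add: S(2,3))
  qed (simp add: S(4))
  have c: "coord (S (\<Sum>m<M. scale (f m) (gs m))) n = (\<Sum>m<M. f m * coord (S (gs m)) n)" for n
    unfolding Ss by (simp add: coord_def ip_sum_right ip_scale_right S(1))
  have s: "summable (\<lambda>n. cnj (f m) * (cnj (coord (S (gs m)) n) * g n))" for m
    by (intro summable_mult l2_inner_summable coord_square_summable S(1) gs_in g)
  have "l2_inner (coord (S (\<Sum>m<M. scale (f m) (gs m)))) g =
      suminf (\<lambda>n. \<Sum>m<M. cnj (f m) * (cnj (coord (S (gs m)) n) * g n))"
    unfolding c by (simp add: sum_distrib_right mult.assoc)
  also have "\<dots> = (\<Sum>m<M. suminf (\<lambda>n. cnj (f m) * (cnj (coord (S (gs m)) n) * g n)))"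
    by (rule suminf_sum) (rule s)
  also have "\<dots> = (\<Sum>m<M. cnj (f m) * l2_inner (coord (S (gs m))) g)"
    by (intro sum.cong refl suminf_mult l2_inner_summable coord_square_summable S(1) gs_in g)
  finally show ?thesis .
qed


subsection \<open>Bounded operators\<close>

text \<open>The adjoint of the operator on coordinates induced by \<open>S\<close>; row \<open>m\<close> of its matrix has finite
  support because it is the conjugate of the coordinate sequence of \<open>S (gs m)\<close>.\<close>

definition adj_op :: "(('x \<Rightarrow>\<^sub>0 complex) \<Rightarrow> 'x \<Rightarrow>\<^sub>0 complex) \<Rightarrow> (nat \<Rightarrow> complex) \<Rightarrow> nat \<Rightarrow> complex" where
  "adj_op S f m = l2_inner (coord (S (gs m))) f"

text \<open>
  Let \<open>g\<close> be the image of \<open>f\<close> and \<open>y\<close> the vector with coordinates \<open>g\<close> up to index \<open>M\<close>. Then the partial sum \<open>s\<close> of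
  \<open>\<bar>g\<bar>\<^sup>2\<close> equals \<open>\<langle>S y, f\<rangle>\<close>, which is at most \<open>(\<parallel>S y\<parallel>\<^sup>2 / K + K \<parallel>f\<parallel>\<^sup>2) / 2\<close>. As \<open>\<parallel>S y\<parallel>\<^sup>2 \<le> K s\<close>, this gives
  \<open>s \<le> K \<parallel>f\<parallel>\<^sup>2\<close>.
\<close>

lemma adj_op_bounded:
  assumes S: "bounded_on S K" and f: "f \<in> carrier (l2 supp)"
  shows "adj_op S f \<in> carrier (l2 supp)" "sqnorm (adj_op S f) \<le> K * sqnorm f"
proof -
  note Sr = bounded_on_simps[OF S]
  have K: "K > 0" using S by (simp add: bounded_on_def)
  have fs: "square_summable f" using f by simp
  define g where "g = adj_op S f"
  have g0: "g n = 0" if "n \<notin> supp" for n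
    using that Sr(4) by (simp add: g_def adj_op_def supp_def coord_def ip_zero_right)
  have p: "(\<Sum>m<M. (cmod (g m))\<^sup>2) \<le> K * sqnorm f" for M
  proof -
    define y where "y = (\<Sum>m<M. scale (g m) (gs m))"
    have y: "y \<in> V" unfolding y_def by (intro V_sum) simp
    define s where "s = (\<Sum>m<M. (cmod (g m))\<^sup>2)"
    have "complex_of_real s = (\<Sum>m<M. cnj (g m) * g m)"
      unfolding s_def of_real_sum
      by (intro sum.cong refl) (simp add: complex_norm_square mult.commute del: of_real_power)
    also have "\<dots> = l2_inner (coord (S y)) f"
      unfolding y_def l2_inner_combination[OF S fs] by (simp add: g_def adj_op_def)
    finally have s1: "complex_of_real s = l2_inner (coord (S y)) f" .
    have cy: "coord y n = (if n < M then g n else 0)" for n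
      unfolding y_def by (rule coord_combination) (rule g0)
    have "sqnorm (coord y) = (\<Sum>n<M. (cmod (coord y n))\<^sup>2)"
      unfolding sqnorm_def by (rule suminf_finite) (auto simp: cy)
    then have s2: "Re (ip y y) = s" using coord_sqnorm[OF y] by (simp add: cy s_def)
    have "s \<le> cmod (l2_inner (coord (S y)) f)" unfolding s1[symmetric] by simp
    also have "\<dots> \<le> (1 / K * sqnorm (coord (S y)) + sqnorm f / (1 / K)) / 2"
      using K by (intro l2_inner_bound coord_square_summable Sr(1) y fs) simp
    also have "sqnorm (coord (S y)) \<le> K * s"
      using S y by (simp add: coord_sqnorm Sr(1) bounded_on_def s2[symmetric])
    finally have "s \<le> (1 / K * (K * s) + sqnorm f / (1 / K)) / 2"
      using K by (simp add: divide_right_mono)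
    then show ?thesis using K unfolding s_def[symmetric] by (simp add: mult.commute)
  qed
  have gs: "square_summable g" by (rule summableI_nonneg_bounded[OF _ p]) simp
  then show "adj_op S f \<in> carrier (l2 supp)" using g0 by (simp add: g_def)
  show "sqnorm (adj_op S f) \<le> K * sqnorm f"
    unfolding g_def[symmetric] sqnorm_def[of g] by (rule suminf_le_const[OF gs p])
qed

lemma adj_op_add:
  assumes "bounded_on S K" "f \<in> carrier (l2 supp)" "g \<in> carrier (l2 supp)"
  shows "adj_op S (\<lambda>n. f n + g n) = (\<lambda>n. adj_op S f n + adj_op S g n)"
  unfolding adj_op_def using assms
  by (intro ext l2_inner_add_right coord_square_summable bounded_on_simps(1)[OF assms(1)]) auto

lemma adj_op_scale:
  assumes "bounded_on S K" "f \<in> carrier (l2 supp)"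
  shows "adj_op S (\<lambda>n. c * f n) = (\<lambda>n. c * adj_op S f n)"
  unfolding adj_op_def using assms
  by (intro ext l2_inner_scale_right coord_square_summable bounded_on_simps(1)[OF assms(1)]) auto

lemma adj_op_coord:
  assumes S: "bounded_on S K" and adj: "\<And>u v. u \<in> V \<Longrightarrow> v \<in> V \<Longrightarrow> ip (S u) v = ip u (S' v)" and u: "u \<in> V"
  shows "adj_op S (coord u) = coord (S' u)"
proof
  fix m
  have "adj_op S (coord u) m = ip (S (gs m)) u"
    unfolding adj_op_def by (intro coord_inner bounded_on_simps(1)[OF S] gs_in u)
  then show "adj_op S (coord u) m = coord (S' u) m" using adj[OF gs_in u] by (simp add: coord_def)
qed

text \<open>
  For a finite sequence in place of \<open>f\<close> both sides are finite sums and agree by \<open>adj_op_coord\<close>. The truncations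
  \<open>t M\<close> of \<open>f\<close> converge to \<open>f\<close> in norm, and \<open>adj_op S\<close> is bounded.
\<close>

lemma adj_op_adjoint:
  assumes S: "bounded_on S K" and S': "bounded_on S' K'"
    and adj: "\<And>u v. u \<in> V \<Longrightarrow> v \<in> V \<Longrightarrow> ip (S u) v = ip u (S' v)"
    and f: "f \<in> carrier (l2 supp)" and g: "g \<in> carrier (l2 supp)"
  shows "l2_inner (adj_op S f) g = l2_inner f (adj_op S' g)"
proof -
  have fs: "square_summable f" "square_summable g" using f g by auto
  define t where "t M = (\<lambda>n. if n < M then f n else 0)" for M
  have tsq: "square_summable (t M)" for M
    by (rule finite_support_square_summable[of M]) (simp add: t_def)
  have tl: "t M \<in> carrier (l2 supp)" for M using f tsq[of M] by (auto simp: t_def)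
  have ag: "square_summable (adj_op S' g)" and af: "square_summable (adj_op S x)" if "x \<in> carrier (l2 supp)" for x
    using adj_op_bounded(1)[OF S' g] adj_op_bounded(1)[OF S that] by auto
  note ag = ag[OF f]
  have fin: "l2_inner (adj_op S (t M)) g = (\<Sum>n<M. cnj (f n) * adj_op S' g n)" for M
  proof -
    define y where "y = (\<Sum>m<M. scale (f m) (gs m))"
    have y: "y \<in> V" unfolding y_def by (intro V_sum) simp
    have "coord y = t M" unfolding y_def t_def
      by (intro ext coord_combination) (use f in simp)
    then have "adj_op S (t M) = coord (S' y)" using adj_op_coord[OF S adj y] by simp
    then show ?thesis
      unfolding y_def by (simp add: l2_inner_combination[OF S' fs(2)] adj_op_def)
  qed
  have lim1: "(\<lambda>M. l2_inner (adj_op S (t M)) g) \<longlonglongrightarrow> l2_inner f (adj_op S' g)"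
    unfolding fin by (rule summable_LIMSEQ) (rule l2_inner_summable[OF fs(1) ag])
  have tail: "(\<lambda>M. sqnorm (\<lambda>n. f n - t M n)) \<longlonglongrightarrow> 0"
  proof -
    have "sqnorm (\<lambda>n. f n - t M n) = sqnorm f - (\<Sum>n<M. (cmod (f n))\<^sup>2)" for M
    proof -
      have "sqnorm (\<lambda>n. f n - t M n) = suminf (\<lambda>n. (cmod (f n))\<^sup>2 - (cmod (t M n))\<^sup>2)"
        unfolding sqnorm_def by (intro arg_cong[of _ _ suminf] ext) (simp add: t_def)
      also have "\<dots> = sqnorm f - sqnorm (t M)" unfolding sqnorm_def using fs(1) tsq by (rule suminf_diff[symmetric])
      also have "sqnorm (t M) = (\<Sum>n<M. (cmod (t M n))\<^sup>2)"
        unfolding sqnorm_def by (rule suminf_finite) (auto simp: t_def)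
      finally show ?thesis by (simp add: t_def)
    qed
    moreover have "(\<lambda>M. sqnorm f - (\<Sum>n<M. (cmod (f n))\<^sup>2)) \<longlonglongrightarrow> sqnorm f - sqnorm f"
      unfolding sqnorm_def by (intro tendsto_diff tendsto_const summable_LIMSEQ fs(1))
    ultimately show ?thesis by simp
  qed
  have "(\<lambda>M. l2_inner (adj_op S (t M)) g) \<longlonglongrightarrow> l2_inner (adj_op S f) g"
  proof (rule LIMSEQ_I)
    fix e :: real assume e: "e > 0"
    have gn: "sqnorm g \<ge> 0" by (rule sqnorm_nonneg[OF fs(2)])
    have K: "K > 0" using S by (simp add: bounded_on_def)
    \<comment> \<open>The weight in \<open>l2_inner_bound\<close>; it makes the contribution of \<open>g\<close> smaller than \<open>e\<close>.\<close>
    define r where "r = (sqnorm g + 1) / e"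
    have r: "r > 0" "sqnorm g / r < e" using e gn by (auto simp: r_def field_simps)
    have "e / (r * K) > 0" using e r K by simp
    then obtain M0 where M0: "\<And>M. M \<ge> M0 \<Longrightarrow> norm (sqnorm (\<lambda>n. f n - t M n) - 0) < e / (r * K)"
      using LIMSEQ_D[OF tail] by blast
    have "norm (l2_inner (adj_op S (t M)) g - l2_inner (adj_op S f) g) < e" if M: "M \<ge> M0" for M
    proof -
      define d where "d = (\<lambda>n. t M n + (-1) * f n)"
      have f': "(\<lambda>n. (-1) * f n) \<in> carrier (l2 supp)" using f by simp
      have dl: "d \<in> carrier (l2 supp)" unfolding d_def
        using square_summable_add[of "t M" "\<lambda>n. (-1) * f n"] tl[of M] f' by auto
      have "adj_op S d = (\<lambda>n. adj_op S (t M) n + (-1) * adj_op S f n)"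
        unfolding d_def adj_op_add[OF S tl f'] adj_op_scale[OF S f] ..
      then have "l2_inner (adj_op S (t M)) g - l2_inner (adj_op S f) g = l2_inner (adj_op S d) g"
        using l2_inner_diff_left[OF af[OF tl] af[OF f] fs(2)] by simp
      then have "norm (l2_inner (adj_op S (t M)) g - l2_inner (adj_op S f) g) \<le> (r * sqnorm (adj_op S d) + sqnorm g / r) / 2"
        using l2_inner_bound[OF af[OF dl] fs(2) r(1)] by simp
      moreover have "sqnorm d = sqnorm (\<lambda>n. f n - t M n)"
        unfolding sqnorm_def by (intro arg_cong[of _ _ suminf] ext) (simp add: d_def norm_minus_commute)
      then have "r * sqnorm (adj_op S d) < e"
      proof -
        assume a: "sqnorm d = sqnorm (\<lambda>n. f n - t M n)"
        have "r * sqnorm (adj_op S d) \<le> r * (K * sqnorm d)"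
          using adj_op_bounded(2)[OF S dl] r(1) by (simp add: mult_left_mono)
        also have "\<dots> < r * (K * (e / (r * K)))"
          using M0[OF M] a r(1) K by (intro mult_strict_left_mono) auto
        also have "\<dots> = e" using r(1) K by simp
        finally show ?thesis .
      qed
      ultimately show ?thesis using r(2) by (rule half_sum_less)
    qed
    then show "\<exists>no. \<forall>M\<ge>no. norm (l2_inner (adj_op S (t M)) g - l2_inner (adj_op S f) g) < e" by blast
  qed
  then show ?thesis using lim1 LIMSEQ_unique by blast
qed

end


section \<open>The GNS representation\<close>

context qiso_nonzero
begin

lemma ev_h_star: "ev h (star W.R f) = cnj (ev h f)"
proof -
  have "h (word_inv w) = cnj (h w)" for w by (simp add: wval_def L.haar_hermitian)
  then show ?thesis by (simp add: W.ev_star)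
qed

lemma ip_right_null: "u \<in> carrier W.R \<Longrightarrow> v \<in> P.I \<Longrightarrow> ip u v = 0"
  unfolding ip_def by (intro wval_vanish_on_I[OF L.haar_in_D] P.I_mult_left) simp_all

lemma ip_right_cong: "u \<in> carrier W.R \<Longrightarrow> v - v' \<in> P.I \<Longrightarrow> ip u v = ip u v'"
  using ip_right_null[of u "v - v'"] W.mult_add_right[of "star W.R u" v' "v - v'"] by (simp add: ip_def)

definition word_seq :: "nat \<Rightarrow> (('v1, 'v2, 'e1, 'e2) qiso_gen \<times> bool) list \<Rightarrow>\<^sub>0 complex" where
  "word_seq n = Poly_Mapping.single (from_nat_into (lists (G \<times> UNIV)) n) 1"

lemma word_seq_spans:
  assumes z: "z \<in> carrier W.R"
  shows "\<exists>k c. z = (\<Sum>n<k. scale (c n) (word_seq n))"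
proof -
  let ?A = "lists (G \<times> UNIV) :: (('v1, 'v2, 'e1, 'e2) qiso_gen \<times> bool) list set"
  let ?K = "Poly_Mapping.keys z"
  have "finite G"
    unfolding qiso_gens_def by (intro finite_UnI finite_image_set2) (use finite_parts in auto)
  then have A: "countable ?A" by (intro countable_lists) (simp add: countable_finite)
  define t where "t = to_nat_on ?A"
  have KA: "?K \<subseteq> ?A" using z by (simp add: W.R_carrier)
  have ft: "from_nat_into ?A (t u) = u" if "u \<in> ?K" for u
    unfolding t_def using A KA that by (intro from_nat_into_to_nat_on) auto
  then have inj: "inj_on t ?K" by (metis inj_onI)
  obtain k where k: "t ` ?K \<subseteq> {..<k}" using finite_nat_iff_bounded[of "t ` ?K"] by auto
  define c where "c n = (if n \<in> t ` ?K then Poly_Mapping.lookup z (from_nat_into ?A n) else 0)" for n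
  have "(\<Sum>n<k. scale (c n) (word_seq n)) = (\<Sum>n\<in>t ` ?K. scale (c n) (word_seq n))"
  proof (rule sum.mono_neutral_right)
    have "scale 0 (word_seq n) = 0" for n by (rule ev_eqI) simp
    then show "\<forall>n\<in>{..<k} - t ` ?K. scale (c n) (word_seq n) = 0" by (simp add: c_def)
  qed (use k in auto)
  also have "\<dots> = (\<Sum>u\<in>?K. scale (c (t u)) (word_seq (t u)))"
    by (rule sum.reindex_cong[OF inj refl refl])
  also have "\<dots> = (\<Sum>u\<in>?K. scale (Poly_Mapping.lookup z u) (Poly_Mapping.single u 1))"
    by (intro sum.cong refl) (simp only: c_def word_seq_def ft imageI if_True)
  also have "\<dots> = z" by (rule sum_scale_single)
  finally show ?thesis by metis
qed

sublocale N: semi_inner "carrier W.R" ip word_seq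
proof
  fix u v v' :: "(('v1, 'v2, 'e1, 'e2) qiso_gen \<times> bool) list \<Rightarrow>\<^sub>0 complex"
  assume u: "u \<in> carrier W.R"
  show "ip u (v + v') = ip u v + ip u v'" by (simp add: ip_def W.mult_add_right)
  show "ip u (scale c v) = c * ip u v" for c by (simp add: ip_def W.mult_scale_right)
  show "ip u u \<in> \<real>\<^sub>\<ge>\<^sub>0" by (rule ip_positive(1)[OF u])
  assume v: "v \<in> carrier W.R"
  have "star W.R (star W.R u \<otimes>\<^bsub>W.R\<^esub> v) = star W.R v \<otimes>\<^bsub>W.R\<^esub> u"
    using u v by (simp add: W.star_mult W.star_star)
  then show "ip v u = cnj (ip u v)" unfolding ip_def by (metis ev_h_star)
  show "ip u v = 0" if "ip v v = 0" by (rule ip_right_null[OF u ip_positive(2)[OF v that]])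
next
  have "[] \<in> lists (G \<times> UNIV)" by simp
  then have "from_nat_into (lists (G \<times> UNIV)) n \<in> lists (G \<times> UNIV)" for n :: nat
    by (intro from_nat_into) blast
  then show "word_seq n \<in> carrier W.R" for n
    unfolding word_seq_def by (intro W.single_closed) simp
qed (auto intro: word_seq_spans)

lemma ip_mult_left:
  assumes "f \<in> carrier W.R" "u \<in> carrier W.R" "v \<in> carrier W.R"
  shows "ip (f \<otimes>\<^bsub>W.R\<^esub> u) v = ip u (star W.R f \<otimes>\<^bsub>W.R\<^esub> v)"
  using assms by (simp add: ip_def W.star_mult W.R_assoc)

abbreviation "dominated f K \<equiv> \<forall>v\<in>carrier W.R. Re (ip (f \<otimes>\<^bsub>W.R\<^esub> v) (f \<otimes>\<^bsub>W.R\<^esub> v)) \<le> K * Re (ip v v)"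

lemma letter_projection:
  assumes q: "q \<in> G \<times> UNIV"
  defines "p \<equiv> Poly_Mapping.single [q] (1::complex)"
  shows "star W.R p - p \<in> P.I" "p \<otimes>\<^bsub>W.R\<^esub> p - p \<in> P.I"
proof -
  obtain g s where g: "q = (g, s)" "g \<in> G" using q by auto
  have l: "row q \<in> letters \<Lambda>1" "col q \<in> letters \<Lambda>2"
    using g(2) unfolding g(1) by (auto elim!: gens_cases simp: letters_def)
  have p: "p \<in> carrier W.R" "star W.R p \<in> carrier W.R" using q unfolding p_def by (auto intro!: W.R_star_closed W.single_closed)
  have "ev (wval x) (star W.R p - p) = 0" for x
    by (simp add: p_def W.single_star wval_def word_inv_def g(1))
  then show "star W.R p - p \<in> P.I" by (subst in_I_iff) (use p in auto)
  have "ev (wval x) (p \<otimes>\<^bsub>W.R\<^esub> p - p) = 0" if x: "x \<in> coefs \<Lambda>1 \<Lambda>2" for x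
    using coefs_idem_row[OF x l l(2), of "[]" "[]" "[]" "[]"] by (simp add: p_def W.single_mult wval_def)
  then show "p \<otimes>\<^bsub>W.R\<^esub> p - p \<in> P.I" by (subst in_I_iff) (use p in auto)
qed

text \<open>
  \<open>p\<close> is a projection modulo the ideal, so \<open>\<parallel>v\<parallel>\<^sup>2 = \<parallel>p v\<parallel>\<^sup>2 + \<parallel>v - p v\<parallel>\<^sup>2\<close>.
\<close>

lemma letter_dominated:
  assumes q: "q \<in> G \<times> UNIV"
  shows "dominated (Poly_Mapping.single [q] 1) 1"
proof
  fix v assume v: "v \<in> carrier W.R"
  define p where "p = Poly_Mapping.single [q] (1::complex)"
  have p: "p \<in> carrier W.R" using q unfolding p_def by (intro W.single_closed) simp
  have s: "star W.R p - p \<in> P.I" and i: "p \<otimes>\<^bsub>W.R\<^esub> p - p \<in> P.I"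
    using letter_projection[OF q] by (simp_all add: p_def)
  define r where "r = ip v (p \<otimes>\<^bsub>W.R\<^esub> v)"
  have "star W.R p \<otimes>\<^bsub>W.R\<^esub> v - p \<otimes>\<^bsub>W.R\<^esub> v \<in> P.I"
    using P.I_mult_right[OF s v] by (simp add: W.mult_diff_left)
  then have r1: "ip (p \<otimes>\<^bsub>W.R\<^esub> v) v = r"
    unfolding ip_mult_left[OF p v v] r_def by (rule ip_right_cong[OF v])
  have "(star W.R p - p) \<otimes>\<^bsub>W.R\<^esub> (p \<otimes>\<^bsub>W.R\<^esub> v) + (p \<otimes>\<^bsub>W.R\<^esub> p - p) \<otimes>\<^bsub>W.R\<^esub> v \<in> P.I"
    using p v s i by (intro P.I_add P.I_mult_right) simp_all
  then have "star W.R p \<otimes>\<^bsub>W.R\<^esub> (p \<otimes>\<^bsub>W.R\<^esub> v) - p \<otimes>\<^bsub>W.R\<^esub> v \<in> P.I"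
    using p v by (simp add: W.mult_diff_left W.R_assoc)
  then have r2: "ip (p \<otimes>\<^bsub>W.R\<^esub> v) (p \<otimes>\<^bsub>W.R\<^esub> v) = r"
    unfolding ip_mult_left[OF p v W.R_mult_closed[OF p v]] r_def by (rule ip_right_cong[OF v])
  have pv: "p \<otimes>\<^bsub>W.R\<^esub> v \<in> carrier W.R" using p v by simp
  have "ip (v - p \<otimes>\<^bsub>W.R\<^esub> v) (v - p \<otimes>\<^bsub>W.R\<^esub> v) = ip v v - r"
    using v pv by (simp add: N.ip_diff_left N.ip_diff_right r1 r2 r_def[symmetric])
  then have "0 \<le> Re (ip v v - r)" using N.ip_self[of "v - p \<otimes>\<^bsub>W.R\<^esub> v"] v pv by simp
  then show "Re (ip (Poly_Mapping.single [q] 1 \<otimes>\<^bsub>W.R\<^esub> v) (Poly_Mapping.single [q] 1 \<otimes>\<^bsub>W.R\<^esub> v)) \<le> 1 * Re (ip v v)"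
    unfolding p_def[symmetric] by (simp add: r2)
qed

lemma word_dominated:
  assumes "u \<in> lists (G \<times> UNIV)"
  shows "dominated (Poly_Mapping.single u 1) 1"
  using assms
proof (induction u rule: list.induct)
  case Nil
  show ?case using W.R_l_one by (simp add: W.R_one)
next
  case (Cons q u)
  then have q: "q \<in> G \<times> UNIV" and u: "u \<in> lists (G \<times> UNIV)" by simp_all
  have su: "Poly_Mapping.single u (1::complex) \<in> carrier W.R" using u by (intro W.single_closed) simp
  have sq: "Poly_Mapping.single [q] (1::complex) \<in> carrier W.R" using q by (intro W.single_closed) simp
  show ?case
  proof
    fix v assume v: "v \<in> carrier W.R"
    have "Poly_Mapping.single (q # u) 1 \<otimes>\<^bsub>W.R\<^esub> v =
        Poly_Mapping.single [q] 1 \<otimes>\<^bsub>W.R\<^esub> (Poly_Mapping.single u 1 \<otimes>\<^bsub>W.R\<^esub> v)"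
      using W.R_assoc[OF sq su v] by (simp add: W.single_mult)
    then show "Re (ip (Poly_Mapping.single (q # u) 1 \<otimes>\<^bsub>W.R\<^esub> v) (Poly_Mapping.single (q # u) 1 \<otimes>\<^bsub>W.R\<^esub> v)) \<le> 1 * Re (ip v v)"
      using letter_dominated[OF q] Cons.IH[OF u] W.R_mult_closed[OF su v] v by fastforce
  qed
qed

text \<open>
  Words act as contractions by \<open>letter_dominated\<close>, and the parallelogram law extends boundedness to their linear
  combinations.
\<close>

lemma left_mult_dominated:
  assumes z: "z \<in> carrier W.R"
  shows "\<exists>K>0. dominated z K"
proof -
  have dom: "\<exists>K>0. dominated (\<Sum>u\<in>A. scale (Poly_Mapping.lookup z u) (Poly_Mapping.single u 1)) K"
    if "finite A" "A \<subseteq> lists (G \<times> UNIV)" for A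
    using that
  proof (induction A rule: finite_induct)
    case empty
    have "0 \<otimes>\<^bsub>W.R\<^esub> v = 0" for v by (rule ev_eqI) (simp add: W.ev_mult)
    then show ?case using N.ip_self by (intro exI[of _ 1]) (simp add: N.ip_zero_right)
  next
    case (insert u A)
    then obtain K where K: "K > 0" "dominated (\<Sum>u\<in>A. scale (Poly_Mapping.lookup z u) (Poly_Mapping.single u 1)) K"
      by auto
    let ?c = "Poly_Mapping.lookup z u"
    let ?a = "Poly_Mapping.single u (1::complex)"
    let ?s = "\<Sum>u\<in>A. scale (Poly_Mapping.lookup z u) (Poly_Mapping.single u 1)"
    have a: "?a \<in> carrier W.R" using insert.prems by (intro W.single_closed) simp
    have s: "?s \<in> carrier W.R" using insert.prems by (intro W.R_sum_closed W.R_scale_closed W.single_closed) auto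
    have "dominated (scale ?c ?a + ?s) (2 * (cmod ?c)\<^sup>2 + 2 * K)"
    proof
      fix v assume v: "v \<in> carrier W.R"
      have av: "?a \<otimes>\<^bsub>W.R\<^esub> v \<in> carrier W.R" and sv: "?s \<otimes>\<^bsub>W.R\<^esub> v \<in> carrier W.R" using a s v by simp_all
      have e: "(scale ?c ?a + ?s) \<otimes>\<^bsub>W.R\<^esub> v = scale ?c (?a \<otimes>\<^bsub>W.R\<^esub> v) + ?s \<otimes>\<^bsub>W.R\<^esub> v"
        by (simp only: W.mult_add_left W.mult_scale_left)
      have "ip (scale ?c (?a \<otimes>\<^bsub>W.R\<^esub> v)) (scale ?c (?a \<otimes>\<^bsub>W.R\<^esub> v)) = of_real ((cmod ?c)\<^sup>2) * ip (?a \<otimes>\<^bsub>W.R\<^esub> v) (?a \<otimes>\<^bsub>W.R\<^esub> v)"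
        using av by (simp add: N.ip_scale_left N.ip_scale_right complex_norm_square mult_ac del: of_real_power)
      then have "Re (ip (scale ?c (?a \<otimes>\<^bsub>W.R\<^esub> v)) (scale ?c (?a \<otimes>\<^bsub>W.R\<^esub> v))) = (cmod ?c)\<^sup>2 * Re (ip (?a \<otimes>\<^bsub>W.R\<^esub> v) (?a \<otimes>\<^bsub>W.R\<^esub> v))"
        by (simp del: of_real_power)
      also have "\<dots> \<le> (cmod ?c)\<^sup>2 * Re (ip v v)"
        using word_dominated[of u] insert.prems v by (intro mult_left_mono) auto
      finally have "2 * Re (ip (scale ?c (?a \<otimes>\<^bsub>W.R\<^esub> v)) (scale ?c (?a \<otimes>\<^bsub>W.R\<^esub> v))) + 2 * Re (ip (?s \<otimes>\<^bsub>W.R\<^esub> v) (?s \<otimes>\<^bsub>W.R\<^esub> v))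
          \<le> 2 * ((cmod ?c)\<^sup>2 * Re (ip v v)) + 2 * (K * Re (ip v v))"
        using K(2) v by (intro add_mono mult_left_mono) auto
      then show "Re (ip ((scale ?c ?a + ?s) \<otimes>\<^bsub>W.R\<^esub> v) ((scale ?c ?a + ?s) \<otimes>\<^bsub>W.R\<^esub> v)) \<le> (2 * (cmod ?c)\<^sup>2 + 2 * K) * Re (ip v v)"
        using N.ip_parallelogram[OF W.R_scale_closed[OF av, of ?c] sv] unfolding e
        by (simp add: distrib_right mult.assoc)
    qed
    moreover have "2 * (cmod ?c)\<^sup>2 + 2 * K > 0" using K(1) by (simp add: add_nonneg_pos)
    ultimately show ?case unfolding sum.insert[OF insert.hyps] by blast
  qed
  have "Poly_Mapping.keys z \<subseteq> lists (G \<times> UNIV)" using z by (simp add: W.R_carrier)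
  from dom[OF finite_keys this] show ?thesis unfolding sum_scale_single .
qed

lemma left_mult_bounded:
  assumes z: "z \<in> carrier W.R"
  obtains K where "N.bounded_on (\<lambda>v. z \<otimes>\<^bsub>W.R\<^esub> v) K"
  using left_mult_dominated[OF z] z
  by (auto simp: N.bounded_on_def W.mult_add_right W.mult_scale_right)

text \<open>
  \<^const>\<open>N.adj_op\<close> extends the adjoint of its argument, so left multiplication by \<open>z\<close> is obtained from
  that by \<open>z\<^sup>*\<close>.
\<close>

definition rep_op where
  "rep_op z = N.adj_op (\<lambda>v. star W.R z \<otimes>\<^bsub>W.R\<^esub> v)"

definition gns :: "('v1, 'v2, 'e1, 'e2) qiso_elem \<Rightarrow> (nat \<Rightarrow> complex) \<Rightarrow> nat \<Rightarrow> complex" where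
  "gns X = rep_op (SOME z. z \<in> carrier W.R \<and> X = P.cl z)"

abbreviation "H \<equiv> l2 N.supp"

lemma rep_op_cong:
  assumes "z \<in> carrier W.R" "z' \<in> carrier W.R" "z - z' \<in> P.I"
  shows "rep_op z = rep_op z'"
proof -
  have "N.coord (star W.R z \<otimes>\<^bsub>W.R\<^esub> N.gs m) n = N.coord (star W.R z' \<otimes>\<^bsub>W.R\<^esub> N.gs m) n" for m n
    unfolding N.coord_def
  proof (rule ip_right_cong[OF N.gs_in])
    have "star W.R (z - z') \<otimes>\<^bsub>W.R\<^esub> N.gs m \<in> P.I"
      by (intro P.I_mult_right P.I_star assms N.gs_in)
    then show "star W.R z \<otimes>\<^bsub>W.R\<^esub> N.gs m - star W.R z' \<otimes>\<^bsub>W.R\<^esub> N.gs m \<in> P.I"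
      by (simp add: W.star_diff W.mult_diff_left)
  qed
  then show ?thesis by (simp add: rep_op_def N.adj_op_def fun_eq_iff)
qed

lemma gns_cl:
  assumes z: "z \<in> carrier W.R"
  shows "gns (P.cl z) = rep_op z"
proof -
  define w where "w = (SOME w. w \<in> carrier W.R \<and> P.cl z = P.cl w)"
  have w: "w \<in> carrier W.R \<and> P.cl z = P.cl w"
    unfolding w_def by (rule someI[of _ z]) (simp add: z)
  then have "w - z \<in> P.I" by (metis P.cl_eq_iff)
  then have "rep_op w = rep_op z" using w z by (intro rep_op_cong) auto
  then show ?thesis by (simp add: gns_def w_def[symmetric])
qed

lemma coord_mult_square_summable:
  "f \<in> carrier W.R \<Longrightarrow> square_summable (N.coord (f \<otimes>\<^bsub>W.R\<^esub> N.gs m))"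
  by (intro N.coord_square_summable W.R_mult_closed N.gs_in)

lemma rep_op_bounded:
  assumes z: "z \<in> carrier W.R"
  shows "bounded_operator H (rep_op z)"
proof -
  obtain K where K: "N.bounded_on (\<lambda>v. star W.R z \<otimes>\<^bsub>W.R\<^esub> v) K"
    using left_mult_bounded[OF W.R_star_closed[OF z]] .
  have "hnorm H (rep_op z f) \<le> sqrt K * hnorm H f" if f: "f \<in> carrier H" for f
  proof -
    have "sqrt (sqnorm (rep_op z f)) \<le> sqrt (K * sqnorm f)"
      unfolding rep_op_def using N.adj_op_bounded(2)[OF K f] by simp
    then show ?thesis
      using N.adj_op_bounded(1)[OF K f] f by (simp add: hnorm_l2 rep_op_def real_sqrt_mult)
  qed
  then have "\<exists>k. \<forall>f\<in>carrier H. hnorm H (rep_op z f) \<le> k * hnorm H f" by blast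
  moreover have "rep_op z f \<in> carrier H" if "f \<in> carrier H" for f
    unfolding rep_op_def by (rule N.adj_op_bounded(1)[OF K that])
  moreover have "rep_op z (f \<oplus>\<^bsub>H\<^esub> g) = rep_op z f \<oplus>\<^bsub>H\<^esub> rep_op z g" if "f \<in> carrier H" "g \<in> carrier H" for f g
    unfolding rep_op_def l2_simps(3) by (rule N.adj_op_add[OF K that])
  moreover have "rep_op z (c \<odot>\<^bsub>H\<^esub> f) = c \<odot>\<^bsub>H\<^esub> rep_op z f" if "f \<in> carrier H" for f c
    unfolding rep_op_def l2_simps(4) by (rule N.adj_op_scale[OF K that])
  ultimately show ?thesis unfolding bounded_operator_def by blast
qed

lemma rep_op_one:
  assumes f: "f \<in> carrier H"
  shows "rep_op \<one>\<^bsub>W.R\<^esub> f = f"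
proof
  fix m
  have "rep_op \<one>\<^bsub>W.R\<^esub> f m = l2_inner (N.coord (N.gs m)) f"
    by (simp add: rep_op_def N.adj_op_def W.star_one W.R_l_one)
  also have "\<dots> = (\<Sum>n\<in>{m}. cnj (N.coord (N.gs m) n) * f n)"
    by (rule suminf_finite) (auto simp: N.coord_def N.gs_orthonormal)
  also have "\<dots> = f m" using f by (auto simp: N.coord_def N.gs_orthonormal N.supp_def)
  finally show "rep_op \<one>\<^bsub>W.R\<^esub> f m = f m" .
qed

lemma rep_op_add:
  assumes "z \<in> carrier W.R" "w \<in> carrier W.R" "f \<in> carrier H"
  shows "rep_op (z + w) f = (\<lambda>m. rep_op z f m + rep_op w f m)"
proof
  fix m
  have "N.coord (star W.R (z + w) \<otimes>\<^bsub>W.R\<^esub> N.gs m) =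
    (\<lambda>n. N.coord (star W.R z \<otimes>\<^bsub>W.R\<^esub> N.gs m) n + N.coord (star W.R w \<otimes>\<^bsub>W.R\<^esub> N.gs m) n)"
    using assms by (intro ext) (simp add: N.coord_def W.star_add W.mult_add_left N.ip_add_right)
  then show "rep_op (z + w) f m = rep_op z f m + rep_op w f m"
    unfolding rep_op_def N.adj_op_def using assms
    by (simp only:) (intro l2_inner_add_left coord_mult_square_summable W.R_star_closed, auto)
qed

lemma rep_op_scale:
  assumes "z \<in> carrier W.R" "f \<in> carrier H"
  shows "rep_op (scale c z) f = (\<lambda>m. c * rep_op z f m)"
proof
  fix m
  have "N.coord (star W.R (scale c z) \<otimes>\<^bsub>W.R\<^esub> N.gs m) = (\<lambda>n. cnj c * N.coord (star W.R z \<otimes>\<^bsub>W.R\<^esub> N.gs m) n)"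
    using assms by (intro ext) (simp add: N.coord_def W.star_scale W.mult_scale_left N.ip_scale_right)
  then show "rep_op (scale c z) f m = c * rep_op z f m"
    using l2_inner_scale_left[OF coord_mult_square_summable[OF W.R_star_closed[OF assms(1)]], of f "cnj c" m] assms
    unfolding rep_op_def N.adj_op_def by simp
qed

lemma rep_op_adjoint:
  assumes z: "z \<in> carrier W.R" and "f \<in> carrier H" "g \<in> carrier H"
  shows "l2_inner (rep_op (star W.R z) f) g = l2_inner f (rep_op z g)"
proof -
  obtain K where K: "N.bounded_on (\<lambda>v. z \<otimes>\<^bsub>W.R\<^esub> v) K" using left_mult_bounded[OF z] .
  obtain K' where K': "N.bounded_on (\<lambda>v. star W.R z \<otimes>\<^bsub>W.R\<^esub> v) K'"
    using left_mult_bounded[OF W.R_star_closed[OF z]] .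
  show ?thesis
    unfolding rep_op_def W.star_star[OF z]
    by (rule N.adj_op_adjoint[OF K K']) (use assms in \<open>auto simp: ip_mult_left\<close>)
qed

lemma rep_op_coord:
  assumes z: "z \<in> carrier W.R" and u: "u \<in> carrier W.R"
  shows "rep_op z (N.coord u) = N.coord (z \<otimes>\<^bsub>W.R\<^esub> u)"
proof -
  obtain K where K: "N.bounded_on (\<lambda>v. star W.R z \<otimes>\<^bsub>W.R\<^esub> v) K"
    using left_mult_bounded[OF W.R_star_closed[OF z]] .
  show ?thesis
    unfolding rep_op_def by (rule N.adj_op_coord[OF K _ u]) (use z in \<open>simp add: ip_mult_left W.star_star\<close>)
qed

lemma rep_op_mult:
  assumes z: "z \<in> carrier W.R" and w: "w \<in> carrier W.R" and f: "f \<in> carrier H"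
  shows "rep_op (z \<otimes>\<^bsub>W.R\<^esub> w) f = rep_op z (rep_op w f)"
proof
  fix m
  define u where "u = star W.R z \<otimes>\<^bsub>W.R\<^esub> N.gs m"
  have u: "u \<in> carrier W.R" unfolding u_def using z by (intro W.R_mult_closed N.gs_in) simp
  have "rep_op z (rep_op w f) m = l2_inner (N.coord u) (rep_op w f)"
    by (simp add: rep_op_def[of z] N.adj_op_def u_def)
  also have "\<dots> = l2_inner (rep_op (star W.R w) (N.coord u)) f"
    by (rule rep_op_adjoint[OF w N.coord_in_l2[OF u] f, symmetric])
  also have "\<dots> = l2_inner (N.coord (star W.R w \<otimes>\<^bsub>W.R\<^esub> u)) f"
    using w u by (simp add: rep_op_coord)
  also have "star W.R w \<otimes>\<^bsub>W.R\<^esub> u = star W.R (z \<otimes>\<^bsub>W.R\<^esub> w) \<otimes>\<^bsub>W.R\<^esub> N.gs m"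
    unfolding u_def W.star_mult[OF z w] by (rule W.R_assoc[symmetric]) (use z w in auto)
  finally show "rep_op (z \<otimes>\<^bsub>W.R\<^esub> w) f m = rep_op z (rep_op w f) m"
    by (simp add: rep_op_def[of "z \<otimes>\<^bsub>W.R\<^esub> w"] N.adj_op_def)
qed

lemma gns_representation: "star_representation P.Q H gns"
  unfolding star_representation_def
proof (intro conjI ballI allI)
  fix X assume "X \<in> carrier P.Q"
  then show "bounded_operator H (gns X)"
    by (elim P.Q_cases) (simp add: gns_cl rep_op_bounded)
next
  fix f assume f: "f \<in> carrier H"
  show "gns \<one>\<^bsub>P.Q\<^esub> f = f" using rep_op_one[OF f] by (simp add: P.Q_one gns_cl)
  fix X assume X: "X \<in> carrier P.Q"
  show "gns (c \<odot>\<^bsub>P.Q\<^esub> X) f = c \<odot>\<^bsub>H\<^esub> gns X f" for c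
    using X by (elim P.Q_cases) (simp add: P.Q_smult gns_cl rep_op_scale[OF _ f])
  fix Y assume Y: "Y \<in> carrier P.Q"
  show "gns (X \<oplus>\<^bsub>P.Q\<^esub> Y) f = gns X f \<oplus>\<^bsub>H\<^esub> gns Y f"
    using X Y by (elim P.Q_cases) (simp add: P.Q_add gns_cl rep_op_add[OF _ _ f])
  show "gns (X \<otimes>\<^bsub>P.Q\<^esub> Y) f = gns X (gns Y f)"
    using X Y by (elim P.Q_cases) (simp add: P.Q_mult gns_cl rep_op_mult[OF _ _ f])
next
  fix X f g assume "X \<in> carrier P.Q" and fg: "f \<in> carrier H" "g \<in> carrier H"
  then show "inner_prod H (gns (star P.Q X) f) g = inner_prod H f (gns X g)"
    by (elim P.Q_cases) (simp add: P.Q_star gns_cl inner_prod_l2 rep_op_adjoint[OF _ fg])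
qed

lemma gns_nonzero: "nonzero_representation P.Q H gns"
  unfolding nonzero_representation_def
proof (intro bexI)
  have o: "\<one>\<^bsub>W.R\<^esub> \<in> carrier W.R" by simp
  show c: "N.coord \<one>\<^bsub>W.R\<^esub> \<in> carrier H" by (rule N.coord_in_l2) simp
  have "ip \<one>\<^bsub>W.R\<^esub> \<one>\<^bsub>W.R\<^esub> = ev h \<one>\<^bsub>W.R\<^esub>"
    unfolding ip_def W.star_one W.R_l_one[OF o] ..
  also have "\<dots> = 1" by (simp add: W.R_one wval_def)
  finally have "sqnorm (N.coord \<one>\<^bsub>W.R\<^esub>) = 1" using N.coord_sqnorm[OF o] by simp
  then have "N.coord \<one>\<^bsub>W.R\<^esub> \<noteq> (\<lambda>n. 0)" by (auto simp: sqnorm_def)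
  then show "gns \<one>\<^bsub>P.Q\<^esub> (N.coord \<one>\<^bsub>W.R\<^esub>) \<noteq> \<zero>\<^bsub>H\<^esub>"
    using rep_op_one[OF c] by (simp add: P.Q_one gns_cl)
  show "\<one>\<^bsub>P.Q\<^esub> \<in> carrier P.Q" by (rule P.Q_rules(11))
qed

end


theorem theorem4p4:
  fixes \<Lambda>1 :: "('v1, 'e1) hypergraph" and \<Lambda>2 :: "('v2, 'e2) hypergraph"
  assumes "full_hypergraph \<Lambda>1" and "full_hypergraph \<Lambda>2"
    and "carrier (\<O> \<Lambda>1 \<Lambda>2) \<noteq> {\<zero>\<^bsub>\<O> \<Lambda>1 \<Lambda>2\<^esub>}"
  shows "(\<exists>(H :: (nat \<Rightarrow> complex) inner_product_space) \<pi>.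
            hilbert_space H \<and> star_representation (\<O> \<Lambda>1 \<Lambda>2) H \<pi> \<and>
            nonzero_representation (\<O> \<Lambda>1 \<Lambda>2) H \<pi>) \<and>
         (\<exists>\<tau>. state (\<O> \<Lambda>1 \<Lambda>2) \<tau> \<and> faithful (\<O> \<Lambda>1 \<Lambda>2) \<tau> \<and>
            bi_invariant \<Lambda>1 \<Lambda>2 \<tau> \<and> tracial (\<O> \<Lambda>1 \<Lambda>2) \<tau>)"
proof -
  interpret qiso_nonzero \<Lambda>1 \<Lambda>2
    by (intro qiso_nonzero.intro qiso_pair.intro qiso_nonzero_axioms.intro assms)
  show ?thesis
    unfolding O_eq
    using hilbert_space_l2[of N.supp] gns_representation gns_nonzero
      \<tau>_state \<tau>_faithful \<tau>_bi_invariant \<tau>_tracial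
    by blast
qed

end
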